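(* Let $L=(l_1,\dots,l_n)$ be a sequence of pairwise different positive real numbers. Let $F_n^0=\ker(\pi\colon F_n\to S_n)$, acting by swaps on the moduli spaces $M_2(L)$ and $M_3(L)$, let $R\subset F_n^0$ be the subgroup of relations, and let $\overline{B_n^0}$ be the factor group of the group of pure balanced annular braids (all defined in the context). Then: (1) the group $F_n^0/R$ acts on the moduli spaces $M_2(L)$ and $M_3(L)$; (2) the group $F_n^0/R$ is isomorphic to $\overline{B_n^0}$; thus the elements of the group $F_n^0/R$ can be represented by balanced annular braids. For instance, the group has generators, indexed by $i=2,\dots,n$, each represented by a balanced annular braid whose vector of winding numbers of the strands around the central part of the cylinder has the form $(1,0,\dots,0,-1,0,\dots,0)$, with just two non-zero entries; (3) the group $F_n^0/R$ is isomorphic to $\mathbb{Z}^{n-1}$, and is therefore commutative.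
   Context: The numbering is modulo $n$ (so $n+1=1$). Moduli space: for a sequence $L=(l_1,\dots,l_n)$ of positive numbers (a polygonal $n$-linkage), a configuration in $\mathbb{R}^d$ is a sequence of points $P=(p_1,\dots,p_n)$, $p_i\in\mathbb{R}^d$, with $|p_ip_{i+1}|=l_i$ for all $i$ (in particular $|p_np_1|=l_n$). $M_d(L)$ is the set of all configurations modulo the action of orientation preserving isometries. Here $d\in\{2,3\}$. Swaps: for a configuration $P$, the polygon $s_i(P)$ is obtained from $P$ by transposing the two edges adjacent to the vertex $p_i$: all vertices other than $p_i$ stay fixed, and $p_i$ is replaced by its mirror image in the perpendicular bisector (a line if $d=2$, a plane if $d=3$) of the segment $p_{i-1}p_{i+1}$; for $d=3$ the new pair of edges lies in the plane spanned by the old pair. This gives a homeomorphism $s_i\colon M_d(L)\to M_d(\sigma_iL)$, where $\sigma_i\in S_n$ is the transposition induced by $s_i$ (it exchanges the two edges adjacent to $p_i$), and likewise for every permutation of $L$. Groups: $F_n$ is the free group whose generators are the symbols $s_1,\dots,s_n$; it acts by swaps on the disjoint union of the moduli spaces $M_d(\sigma L)$, $\sigma\in S_n$. $\pi\colon F_n\to S_n$ is the homomorphism with $\pi(s_i)=\sigma_i$, and $F_n^0=\ker\pi$; the group $F_n^0$ acts on $M_d(L)$. $R\subset F_n^0$ is the subgroup generated by the elements of the following three types: $s_i^2$; $s_is_js_i^{-1}s_j^{-1}$ whenever $|i-j|>1$ (indices modulo $n$, i.e. $i,j$ distinct and not cyclically adjacent); $s_is_{i+1}s_is_{i+1}^{-1}s_i^{-1}s_{i+1}^{-1}$.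 Braids: the balanced annular braid group is $$B_n=\langle \Sigma_1,\dots,\Sigma_n \mid \Sigma_i\Sigma_j=\Sigma_j\Sigma_i \text{ if } i-j\neq\pm1,\ \ \Sigma_i\Sigma_{i'}\Sigma_i=\Sigma_{i'}\Sigma_i\Sigma_{i'} \text{ if } i-i'=\pm1\rangle$$ (indices modulo $n$). The group $B_n^0$ of pure balanced annular braids is the kernel of the natural map $B_n\to S_n$, $\Sigma_i\mapsto\sigma_i$. A braid is visualized as $n$ non-intersecting strands in a thick cylinder going from the top to the bottom. The group $\overline{B_n^0}$ is $B_n^0$ factorized by all relations of type $\Sigma_i^2=1$; this means that the strands can pass freely through each other, but not through the central part of the cylinder.
   Formalization: R is taken as the normal closure in F_n of the three types of elements, since the subgroup they generate is not normal and F_n^0/R would not be a group; likewise the relations Σ_i^2=1 are imposed via the normal closure in B_n; n≥3 is assumed, as (3) fails for n≤2. *)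

theory Defs
  imports "HOL-Analysis.Analysis" "HOL-Algebra.Algebra"
begin

section \<open>Free groups and presentations\<close>

text \<open>The letter \<open>(a, True)\<close> is the generator \<open>a\<close>, the letter \<open>(a, False)\<close> is its inverse. The free
  group consists of the reduced words.\<close>

type_synonym 'a word = "('a \<times> bool) list"

fun cancel_cons :: "'a \<times> bool \<Rightarrow> 'a word \<Rightarrow> 'a word" where
  "cancel_cons x [] = [x]"
| "cancel_cons x (y # w) = (if fst x = fst y \<and> snd x \<noteq> snd y then w else x # y # w)"

definition reduced :: "'a word \<Rightarrow> bool" where
  "reduced w \<longleftrightarrow> successively (\<lambda>x y. \<not> (fst x = fst y \<and> snd x \<noteq> snd y)) w"

definition free_group :: "'a set \<Rightarrow> 'a word monoid" where
  "free_group S = \<lparr>carrier = {w \<in> lists (S \<times> UNIV). reduced w},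
                   monoid.mult = foldr cancel_cons,
                   one = []\<rparr>"

definition gen :: "'a \<Rightarrow> 'a word" where
  "gen a = [(a, True)]"

text \<open>The homomorphism from the free group to \<open>G\<close> that extends \<open>f\<close>.\<close>

definition free_lift :: "('b, 'c) monoid_scheme \<Rightarrow> ('a \<Rightarrow> 'b) \<Rightarrow> 'a word \<Rightarrow> 'b" where
  "free_lift G f w =
     foldr (\<lambda>(a, b) y. (if b then f a else inv\<^bsub>G\<^esub> f a) \<otimes>\<^bsub>G\<^esub> y) w \<one>\<^bsub>G\<^esub>"

definition normal_closure :: "('a, 'b) monoid_scheme \<Rightarrow> 'a set \<Rightarrow> 'a set" where
  "normal_closure G Y =
     generate G {g \<otimes>\<^bsub>G\<^esub> x \<otimes>\<^bsub>G\<^esub> inv\<^bsub>G\<^esub> g | g x. g \<in> carrier G \<and> x \<in> Y}"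

text \<open>The group with generators \<open>S\<close> and relations \<open>u = v\<close> for \<open>(u, v) \<in> E\<close> is the quotient of
  \<open>free_group S\<close> by \<open>relators S E\<close>.\<close>

definition relators :: "'a set \<Rightarrow> ('a word \<times> 'a word) set \<Rightarrow> 'a word set" where
  "relators S E =
     normal_closure (free_group S)
       {u \<otimes>\<^bsub>free_group S\<^esub> inv\<^bsub>free_group S\<^esub> v | u v. (u, v) \<in> E}"


section \<open>Linkages and moduli spaces\<close>

text \<open>Indices run cyclically through \<open>{1..n}\<close>.\<close>

definition cyc_succ :: "nat \<Rightarrow> nat \<Rightarrow> nat" where
  "cyc_succ n i = (if i = n then 1 else i + 1)"

definition cyc_pred :: "nat \<Rightarrow> nat \<Rightarrow> nat" where
  "cyc_pred n i = (if i = 1 then n else i - 1)"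

definition cyc_adjacent :: "nat \<Rightarrow> nat \<Rightarrow> nat \<Rightarrow> bool" where
  "cyc_adjacent n i j \<longleftrightarrow> j = cyc_succ n i \<or> i = cyc_succ n j"

definition configurations :: "nat \<Rightarrow> (nat \<Rightarrow> real) \<Rightarrow> (nat \<Rightarrow> real ^ 'd) set" where
  "configurations n L =
     {P \<in> {1..n} \<rightarrow>\<^sub>E UNIV. \<forall>i\<in>{1..n}. dist (P i) (P (cyc_succ n i)) = L i}"

definition orientation_preserving_isometry :: "(real ^ 'd \<Rightarrow> real ^ 'd) \<Rightarrow> bool" where
  "orientation_preserving_isometry g \<longleftrightarrow>
     (\<exists>A b. rotation_matrix A \<and> g = (\<lambda>x. A *v x + b))"

definition congruence ::
    "nat \<Rightarrow> (nat \<Rightarrow> real) \<Rightarrow> ((nat \<Rightarrow> real ^ 'd) \<times> (nat \<Rightarrow> real ^ 'd)) set" where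
  "congruence n L =
     {(P, Q). P \<in> configurations n L \<and> Q \<in> configurations n L \<and>
        (\<exists>g. orientation_preserving_isometry g \<and> Q = restrict (g \<circ> P) {1..n})}"

definition moduli_space :: "nat \<Rightarrow> (nat \<Rightarrow> real) \<Rightarrow> (nat \<Rightarrow> real ^ 'd) set set" where
  "moduli_space n L = configurations n L // congruence n L"

definition quotient_topology :: "'a topology \<Rightarrow> ('a \<Rightarrow> 'b) \<Rightarrow> 'b topology" where
  "quotient_topology Y f =
     topology (\<lambda>U. U \<subseteq> f ` topspace Y \<and> openin Y {x \<in> topspace Y. f x \<in> U})"

lemma openin_quotient_topology:
  "openin (quotient_topology Y f) U \<longleftrightarrow>
     U \<subseteq> f ` topspace Y \<and> openin Y {x \<in> topspace Y. f x \<in> U}"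
proof -
  have "istopology (\<lambda>U. U \<subseteq> f ` topspace Y \<and> openin Y {x \<in> topspace Y. f x \<in> U})"
    unfolding istopology_def
  proof (intro conjI allI impI; (elim conjE)?)
    fix S T
    assume "openin Y {x \<in> topspace Y. f x \<in> S}" "openin Y {x \<in> topspace Y. f x \<in> T}"
    then have "openin Y ({x \<in> topspace Y. f x \<in> S} \<inter> {x \<in> topspace Y. f x \<in> T})"
      by (rule openin_Int)
    moreover have "{x \<in> topspace Y. f x \<in> S} \<inter> {x \<in> topspace Y. f x \<in> T}
        = {x \<in> topspace Y. f x \<in> S \<inter> T}"
      by auto
    ultimately show "openin Y {x \<in> topspace Y. f x \<in> S \<inter> T}"
      by simp
  next
    fix \<K>
    assume K: "\<forall>K\<in>\<K>. K \<subseteq> f ` topspace Y \<and> openin Y {x \<in> topspace Y. f x \<in> K}"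
    then have "openin Y (\<Union>K\<in>\<K>. {x \<in> topspace Y. f x \<in> K})"
      by blast
    moreover have "(\<Union>K\<in>\<K>. {x \<in> topspace Y. f x \<in> K}) = {x \<in> topspace Y. f x \<in> \<Union>\<K>}"
      by auto
    ultimately show "openin Y {x \<in> topspace Y. f x \<in> \<Union>\<K>}"
      by simp
  qed auto
  then show ?thesis
    by (simp add: quotient_topology_def topology_inverse')
qed

lemma topspace_quotient_topology: "topspace (quotient_topology Y f) = f ` topspace Y"
proof
  show "topspace (quotient_topology Y f) \<subseteq> f ` topspace Y"
    using openin_topspace[of "quotient_topology Y f"]
    unfolding openin_quotient_topology by simp
  have "{x \<in> topspace Y. f x \<in> f ` topspace Y} = topspace Y"
    by auto
  then have "openin (quotient_topology Y f) (f ` topspace Y)"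
    by (simp add: openin_quotient_topology)
  then show "f ` topspace Y \<subseteq> topspace (quotient_topology Y f)"
    by (rule openin_subset)
qed

definition moduli_topology :: "nat \<Rightarrow> (nat \<Rightarrow> real) \<Rightarrow> (nat \<Rightarrow> real ^ 'd) set topology" where
  "moduli_topology n L =
     quotient_topology
       (subtopology (product_topology (\<lambda>_. euclidean) {1..n}) (configurations n L))
       (\<lambda>P. congruence n L `` {P})"

lemma topspace_moduli_topology:
  "topspace (moduli_topology n L) = (moduli_space n L :: (nat \<Rightarrow> real ^ 'd) set set)"
proof -
  let ?C = "configurations n L :: (nat \<Rightarrow> real ^ 'd) set"
  have "?C \<subseteq> {1..n} \<rightarrow>\<^sub>E UNIV"
    by (auto simp: configurations_def)
  then have "topspace (subtopology (product_topology (\<lambda>_. euclidean) {1..n}) ?C) = ?C"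
    by (simp add: Int_absorb1)
  then show ?thesis
    by (auto simp: moduli_topology_def moduli_space_def quotient_def topspace_quotient_topology)
qed


section \<open>Swaps\<close>

definition bisector_mirror :: "real ^ 'd \<Rightarrow> real ^ 'd \<Rightarrow> real ^ 'd \<Rightarrow> real ^ 'd" where
  "bisector_mirror a b x =
     x - (2 * ((x - midpoint a b) \<bullet> (b - a)) / ((b - a) \<bullet> (b - a))) *\<^sub>R (b - a)"

definition swap :: "nat \<Rightarrow> nat \<Rightarrow> (nat \<Rightarrow> real ^ 'd) \<Rightarrow> nat \<Rightarrow> real ^ 'd" where
  "swap n i P = P(i := bisector_mirror (P (cyc_pred n i)) (P (cyc_succ n i)) (P i))"

text \<open>The edge \<open>i\<close> joins the vertices \<open>i\<close> and \<open>cyc_succ n i\<close>, so the edges adjacent to the vertex \<open>i\<close>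
  have the numbers \<open>cyc_pred n i\<close> and \<open>i\<close>.\<close>

definition edge_transposition :: "nat \<Rightarrow> nat \<Rightarrow> nat \<Rightarrow> nat" where
  "edge_transposition n i = Transposition.transpose (cyc_pred n i) i"

text \<open>A congruence class is a full orbit of the orientation preserving isometries, and swaps commute
  with isometries. So the map induced by a swap sends a class \<open>c\<close> to the image set \<open>swap n i ` c\<close>. The
  spaces in the union are disjoint if the entries of \<open>L\<close> are distinct.\<close>

definition all_moduli :: "nat \<Rightarrow> (nat \<Rightarrow> real) \<Rightarrow> (nat \<Rightarrow> real ^ 'd) set set" where
  "all_moduli n L = (\<Union>\<sigma>\<in>carrier (sym_group n). moduli_space n (L \<circ> inv\<^bsub>sym_group n\<^esub> \<sigma>))"

definition swap_action ::
    "nat \<Rightarrow> (nat \<Rightarrow> real) \<Rightarrow> nat word \<Rightarrow> (nat \<Rightarrow> real ^ 'd) set \<Rightarrow> (nat \<Rightarrow> real ^ 'd) set" where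
  "swap_action n L =
     free_lift (BijGroup (all_moduli n L)) (\<lambda>i. \<lambda>c\<in>all_moduli n L. swap n i ` c)"

abbreviation FG :: "nat \<Rightarrow> nat word monoid" where
  "FG n \<equiv> free_group {1..n}"

definition perm_of :: "nat \<Rightarrow> nat word \<Rightarrow> nat \<Rightarrow> nat" where
  "perm_of n = free_lift (sym_group n) (edge_transposition n)"

definition FG0 :: "nat \<Rightarrow> nat word monoid" where
  "FG0 n = (FG n)\<lparr>carrier := kernel (FG n) (sym_group n) (perm_of n)\<rparr>"

text \<open>The subgroup of relations is generated by all conjugates (in \<open>FG n\<close>) of the listed elements: the
  subgroup generated by the listed elements alone is not normal.\<close>

definition swap_relations :: "nat \<Rightarrow> nat word set" where
  "swap_relations n = normal_closure (FG n)
     ({gen i \<otimes>\<^bsub>FG n\<^esub> gen i | i. i \<in> {1..n}}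
      \<union> {gen i \<otimes>\<^bsub>FG n\<^esub> gen j \<otimes>\<^bsub>FG n\<^esub> inv\<^bsub>FG n\<^esub> gen i \<otimes>\<^bsub>FG n\<^esub> inv\<^bsub>FG n\<^esub> gen j | i j.
           i \<in> {1..n} \<and> j \<in> {1..n} \<and> i \<noteq> j \<and> \<not> cyc_adjacent n i j}
      \<union> {gen i \<otimes>\<^bsub>FG n\<^esub> gen (cyc_succ n i) \<otimes>\<^bsub>FG n\<^esub> gen i
           \<otimes>\<^bsub>FG n\<^esub> inv\<^bsub>FG n\<^esub> gen (cyc_succ n i) \<otimes>\<^bsub>FG n\<^esub> inv\<^bsub>FG n\<^esub> gen i
           \<otimes>\<^bsub>FG n\<^esub> inv\<^bsub>FG n\<^esub> gen (cyc_succ n i) | i. i \<in> {1..n}})"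


section \<open>Balanced annular braids\<close>

definition braid_relators :: "nat \<Rightarrow> nat word set" where
  "braid_relators n = relators {1..n}
     ({(gen i \<otimes>\<^bsub>FG n\<^esub> gen j, gen j \<otimes>\<^bsub>FG n\<^esub> gen i) | i j.
         i \<in> {1..n} \<and> j \<in> {1..n} \<and> \<not> cyc_adjacent n i j}
      \<union> {(gen i \<otimes>\<^bsub>FG n\<^esub> gen j \<otimes>\<^bsub>FG n\<^esub> gen i, gen j \<otimes>\<^bsub>FG n\<^esub> gen i \<otimes>\<^bsub>FG n\<^esub> gen j) | i j.
         i \<in> {1..n} \<and> j \<in> {1..n} \<and> cyc_adjacent n i j})"

definition braid_group :: "nat \<Rightarrow> nat word set monoid" where
  "braid_group n = FG n Mod braid_relators n"

definition braid_class :: "nat \<Rightarrow> nat word \<Rightarrow> nat word set" where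
  "braid_class n w = braid_relators n #>\<^bsub>FG n\<^esub> w"

definition braid_perm :: "nat \<Rightarrow> nat word set \<Rightarrow> nat \<Rightarrow> nat" where
  "braid_perm n \<beta> = the_elem (perm_of n ` \<beta>)"

definition pure_braid_group :: "nat \<Rightarrow> nat word set monoid" where
  "pure_braid_group n =
     (braid_group n)\<lparr>carrier := kernel (braid_group n) (sym_group n) (braid_perm n)\<rparr>"

text \<open>The relations \<open>\<Sigma>\<^sub>i\<^sup>2 = 1\<close> may be applied anywhere inside a braid, hence the normal closure in the
  whole braid group.\<close>

definition square_relations :: "nat \<Rightarrow> nat word set set" where
  "square_relations n = normal_closure (braid_group n)
     {braid_class n (gen i) \<otimes>\<^bsub>braid_group n\<^esub> braid_class n (gen i) | i. i \<in> {1..n}}"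

definition pure_braid_quotient :: "nat \<Rightarrow> nat word set set monoid" where
  "pure_braid_quotient n = pure_braid_group n Mod square_relations n"

text \<open>In the universal cover of the cylinder, the \<open>n\<close> positions of the strands become the integers.
  The braid \<open>\<Sigma>\<^sub>i\<close> and its inverse both interchange the neighbouring positions \<open>i - 1\<close> and \<open>i\<close> (they
  differ in which strand passes over), so the one strand moves by \<open>1/n\<close> of a full turn forwards and
  the other one by \<open>1/n\<close> of a full turn backwards. As for swaps, in a product the right factor comes
  first.\<close>

definition crossing_lift :: "nat \<Rightarrow> nat \<Rightarrow> int \<Rightarrow> int" where
  "crossing_lift n i x =
     (if x mod int n = (int i - 1) mod int n then x + 1
      else if x mod int n = int i mod int n then x - 1
      else x)"

definition strand_end :: "nat \<Rightarrow> nat word \<Rightarrow> int \<Rightarrow> int" where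
  "strand_end n w x = foldr (\<lambda>(i, _). crossing_lift n i) w x"

definition winding_vector :: "nat \<Rightarrow> nat word set \<Rightarrow> nat \<Rightarrow> int" where
  "winding_vector n \<beta> =
     the_elem ((\<lambda>w. \<lambda>k\<in>{1..n}. (strand_end n w (int k) - int k) div int n) ` \<beta>)"

end

theory Submission
  imports Defs
begin

text \<open>Part (1) amounts to the relations for the swaps on configurations, of which only the braid relation is
  not immediate. Identify the edges with imaginary quaternions. A swap of neighbouring edges \<open>x, y\<close>
  preserves \<open>x + y\<close> and \<open>x y\<close>, hence the polynomial \<open>(\<lambda> + x) (\<lambda> + y) (\<lambda> + z)\<close> of three
  consecutive edges, and such a factorization is determined by the lengths of the factors in their
  order if these are distinct. So both sides of the braid relation give the same edges.

  For (2) and (3), \<open>F\<^sub>n / R\<close> is the group with the Coxeter presentation of the affine symmetric group;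
  it acts on the integers, and \<open>F\<^sub>n\<^sup>0 / R\<close> consists of the elements that fix all residues modulo \<open>n\<close>.
  The product \<open>D a\<close> of all generators but one, in cyclic order, satisfies
  \<open>D a \<cdot> s k = s (k + 1) \<cdot> D (s k a)\<close>. Hence conjugation by \<open>g\<close> takes \<open>(D a)\<inverse> D b\<close> to
  \<open>(D (g a))\<inverse> D (g b)\<close>, so these elements generate a normal subgroup \<open>T\<close> and commute with everything
  that fixes the residues. The group is the product of \<open>T\<close> and the subgroup generated by
  \<open>s 2, \<dots>, s n\<close>, which acts faithfully on \<open>{1..n}\<close>; therefore \<open>F\<^sub>n\<^sup>0 / R = T\<close>. Winding numbers
  show that the generators \<open>(D 1)\<inverse> D i\<close> of \<open>T\<close> are independent.\<close>

text \<open>The obstacle in (2) and (3) is that R is given by relations only: the presented group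
  has to be bounded from above before it is known to act faithfully on the integers. So commutation
  and factorization are derived from the relations, while the action labels elements and finally
  tells them apart.

  The elements \<open>D a\<close> come from the extended affine symmetric group, which also contains
  the shift of all integers by one. There \<open>D a\<close> is the shift combined with one full
  turn backwards on the class of a. The shift itself is not a product of crossings, but it cancels
  in (D a)^-1 D b, and what remains are the translations of the root lattice, of rank n - 1.

  In (1) the distinct lengths enter twice: they keep the two neighbours of a vertex apart, so that
  the perpendicular bisector exists, and they exclude a second factorization of the polynomial. The
  second use is essential to the method, because factorizations over the quaternions are not unique
  in general. The plane is treated as a subspace of space.\<close>

section \<open>Free groups\<close>

definition flip :: "'a \<times> bool \<Rightarrow> 'a \<times> bool" where
  "flip x = (fst x, \<not> snd x)"

lemma flip_flip [simp]: "flip (flip x) = x"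
  by (simp add: flip_def)

lemma cancel_cons_Cons:
  "cancel_cons x (y # w) = (if y = flip x then w else x # y # w)"
  by (auto simp: flip_def prod_eq_iff)

declare cancel_cons.simps(2) [simp del]

lemma reduced_Nil [simp]: "reduced []"
  by (simp add: reduced_def)

lemma reduced_Cons: "reduced (x # w) \<longleftrightarrow> (w \<noteq> [] \<longrightarrow> hd w \<noteq> flip x) \<and> reduced w"
  by (cases w) (auto simp: reduced_def flip_def prod_eq_iff)

lemma reduced_cancel_cons: "reduced w \<Longrightarrow> reduced (cancel_cons x w)"
  by (cases w) (auto simp: cancel_cons_Cons reduced_Cons)

lemma cancel_cons_reduced: "reduced (x # w) \<Longrightarrow> cancel_cons x w = x # w"
  by (cases w) (auto simp: cancel_cons_Cons reduced_Cons)

lemma cancel_cons_flip: "reduced w \<Longrightarrow> cancel_cons x (cancel_cons (flip x) w) = w"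
  by (cases w) (auto simp: cancel_cons_Cons cancel_cons_reduced)

lemma reduced_foldr_cancel_cons: "reduced w \<Longrightarrow> reduced (foldr cancel_cons u w)"
  by (induction u) (auto intro: reduced_cancel_cons)

text \<open>The heart of associativity. If \<open>x\<close> cancels the first letter of
  \<open>u\<close>, the right-hand side prepends \<open>flip x\<close> and then \<open>x\<close> to
  a reduced word, which changes nothing by \<open>cancel_cons_flip\<close>.\<close>

lemma foldr_cancel_cons_cancel_cons:
  "reduced w \<Longrightarrow> foldr cancel_cons (cancel_cons x u) w = cancel_cons x (foldr cancel_cons u w)"
  by (cases u) (auto simp: cancel_cons_Cons cancel_cons_flip reduced_foldr_cancel_cons)

lemma foldr_cancel_cons_assoc:
  "reduced w \<Longrightarrow>
    foldr cancel_cons (foldr cancel_cons u v) w = foldr cancel_cons u (foldr cancel_cons v w)"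
  by (induction u) (auto simp: foldr_cancel_cons_cancel_cons)

lemma cancel_cons_in_lists: "x \<in> A \<Longrightarrow> w \<in> lists A \<Longrightarrow> cancel_cons x w \<in> lists A"
  by (cases w) (auto simp: cancel_cons_Cons)

lemma foldr_cancel_cons_in_lists:
  "u \<in> lists A \<Longrightarrow> w \<in> lists A \<Longrightarrow> foldr cancel_cons u w \<in> lists A"
  by (induction u) (auto simp: cancel_cons_in_lists simp del: in_lists_conv_set)

lemma free_group_simps:
  "carrier (free_group S) = {w \<in> lists (S \<times> UNIV). reduced w}"
  "u \<otimes>\<^bsub>free_group S\<^esub> v = foldr cancel_cons u v"
  "\<one>\<^bsub>free_group S\<^esub> = []"
  by (simp_all add: free_group_def)

lemma group_free_group: "group (free_group S)"
proof (rule groupI)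
  fix u v assume "u \<in> carrier (free_group S)" "v \<in> carrier (free_group S)"
  then show "u \<otimes>\<^bsub>free_group S\<^esub> v \<in> carrier (free_group S)"
    by (simp add: free_group_simps foldr_cancel_cons_in_lists reduced_foldr_cancel_cons
        del: in_lists_conv_set)
next
  fix u assume "u \<in> carrier (free_group S)"
  then have u: "u \<in> lists (S \<times> UNIV)" "reduced u"
    by (simp_all add: free_group_simps)
  then show "\<exists>y\<in>carrier (free_group S). y \<otimes>\<^bsub>free_group S\<^esub> u = \<one>\<^bsub>free_group S\<^esub>"
  proof (induction u)
    case Nil
    then show ?case
      by (auto simp: free_group_simps intro!: exI[of _ "[]"])
  next
    case (Cons x u)
    have "reduced u"
      using Cons.prems by (simp add: reduced_Cons)
    with Cons obtain y where y: "y \<in> lists (S \<times> UNIV)" "reduced y" "foldr cancel_cons y u = []"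
      by (auto simp: free_group_simps)
    \<comment> \<open>The inverse \<open>y\<close> of the tail, followed by the inverse of the first
      letter.\<close>
    let ?z = "foldr cancel_cons y [flip x]"
    have red: "reduced [flip x]" and xs: "[flip x] \<in> lists (S \<times> UNIV)"
      using Cons.hyps by (auto simp: reduced_Cons flip_def)
    have "foldr cancel_cons ?z (x # u) = foldr cancel_cons y (foldr cancel_cons [flip x] (x # u))"
      using Cons.prems by (intro foldr_cancel_cons_assoc) auto
    also have "\<dots> = []"
      using y by (simp add: cancel_cons_Cons)
    finally show ?case
      using foldr_cancel_cons_in_lists[OF y(1) xs] reduced_foldr_cancel_cons[OF red]
      by (auto simp: free_group_simps simp del: foldr_append intro!: exI[of _ ?z])
  qed
qed (auto simp: free_group_simps foldr_cancel_cons_assoc)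

lemma gen_in_free_group: "a \<in> S \<Longrightarrow> gen a \<in> carrier (free_group S)"
  by (simp add: free_group_simps gen_def reduced_Cons)

lemma inv_gen:
  assumes "a \<in> S"
  shows "inv\<^bsub>free_group S\<^esub> gen a = [(a, False)]"
proof (rule group.inv_equality[OF group_free_group])
  show "[(a, False)] \<otimes>\<^bsub>free_group S\<^esub> gen a = \<one>\<^bsub>free_group S\<^esub>"
    by (simp add: free_group_simps gen_def cancel_cons_Cons flip_def)
qed (use assms in \<open>auto simp: free_group_simps gen_def reduced_Cons\<close>)

lemma free_group_Cons:
  assumes "(a, b) # w \<in> carrier (free_group S)"
  shows "a \<in> S" "w \<in> carrier (free_group S)"
    "(a, b) # w = (if b then gen a else inv\<^bsub>free_group S\<^esub> gen a) \<otimes>\<^bsub>free_group S\<^esub> w"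
proof -
  show a: "a \<in> S" and "w \<in> carrier (free_group S)"
    using assms by (auto simp: free_group_simps reduced_Cons)
  have "cancel_cons (a, b) w = (a, b) # w"
    using assms by (intro cancel_cons_reduced) (simp add: free_group_simps)
  then show "(a, b) # w = (if b then gen a else inv\<^bsub>free_group S\<^esub> gen a) \<otimes>\<^bsub>free_group S\<^esub> w"
    by (cases b) (simp_all add: inv_gen a, simp_all add: free_group_simps gen_def)
qed

lemma free_lift_Nil [simp]: "free_lift G f [] = \<one>\<^bsub>G\<^esub>"
  by (simp add: free_lift_def)

lemma free_lift_Cons:
  "free_lift G f (x # w) = (if snd x then f (fst x) else inv\<^bsub>G\<^esub> f (fst x)) \<otimes>\<^bsub>G\<^esub> free_lift G f w"
  by (simp add: free_lift_def case_prod_beta)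

text \<open>Evaluation letter by letter sends \<open>flip x\<close> to the inverse of the value of
  \<open>x\<close>, so a cancellation in the word does not change its value.\<close>

lemma free_lift_hom:
  fixes G :: "('g, 'r) monoid_scheme" (structure)
  assumes "group G" and f: "f \<in> S \<rightarrow> carrier G"
  shows "free_lift G f \<in> hom (free_group S) G"
proof -
  interpret group G by fact
  define l where "l x = (if snd x then f (fst x) else inv f (fst x))" for x
  have l: "l x \<in> carrier G" "l (flip x) = inv l x" if "fst x \<in> S" for x
    using that f by (auto simp: l_def flip_def Pi_iff)
  have cl: "free_lift G f w \<in> carrier G" if "w \<in> lists (S \<times> UNIV)" for w
    using that by induction (simp_all add: free_lift_Cons l(1) mem_Times_iff flip: l_def)
  have cc: "free_lift G f (cancel_cons x w) = l x \<otimes> free_lift G f w"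
    if "fst x \<in> S" "w \<in> lists (S \<times> UNIV)" for x w
  proof (cases w)
    case (Cons y v)
    show ?thesis
    proof (cases "y = flip x")
      case True
      have "v \<in> lists (S \<times> UNIV)"
        using Cons that by auto
      then show ?thesis
        using Cons True l[OF that(1)] cl
        by (simp add: cancel_cons_Cons free_lift_Cons flip: l_def m_assoc)
    qed (simp add: Cons cancel_cons_Cons free_lift_Cons l_def)
  qed (simp add: free_lift_Cons l_def)
  have mult: "free_lift G f (foldr cancel_cons u v) = free_lift G f u \<otimes> free_lift G f v"
    if "u \<in> lists (S \<times> UNIV)" and v: "v \<in> lists (S \<times> UNIV)" for u v
    using that(1)
  proof induction
    case (Cons x u)
    then have "fst x \<in> S" by auto
    then show ?case
      using Cons v l cl[OF Cons(2)] cl[OF v] foldr_cancel_cons_in_lists[OF Cons(2) v]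
      by (simp add: cc free_lift_Cons m_assoc flip: l_def)
  qed (use cl v in auto)
  show ?thesis
    by (auto intro!: homI cl mult simp: free_group_simps simp del: in_lists_conv_set)
qed

lemma free_lift_gen: "group G \<Longrightarrow> f a \<in> carrier G \<Longrightarrow> free_lift G f (gen a) = f a"
  by (simp add: gen_def free_lift_Cons group.is_monoid)


section \<open>Normal closures and quotients\<close>

lemma (in group) normal_closure_normal:
  assumes "Y \<subseteq> carrier G"
  shows "normal_closure G Y \<lhd> G"
  unfolding normal_closure_def
proof (rule normal_generateI)
  show "{g \<otimes> x \<otimes> inv g |g x. g \<in> carrier G \<and> x \<in> Y} \<subseteq> carrier G"
    using assms by auto
  fix h k
  assume "h \<in> {g \<otimes> x \<otimes> inv g |g x. g \<in> carrier G \<and> x \<in> Y}" and k: "k \<in> carrier G"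
  then obtain g x where g: "g \<in> carrier G" "x \<in> Y" "h = g \<otimes> x \<otimes> inv g"
    by blast
  then have "k \<otimes> h \<otimes> inv k = (k \<otimes> g) \<otimes> x \<otimes> inv (k \<otimes> g)"
    using k assms by (auto simp: m_assoc inv_mult_group subset_iff)
  then show "k \<otimes> h \<otimes> inv k \<in> {g \<otimes> x \<otimes> inv g |g x. g \<in> carrier G \<and> x \<in> Y}"
    using g k by blast
qed

lemma (in group) normal_closure_incl:
  assumes "Y \<subseteq> carrier G"
  shows "Y \<subseteq> normal_closure G Y"
proof
  fix x assume x: "x \<in> Y"
  then have "x = \<one> \<otimes> x \<otimes> inv \<one>"
    using assms by auto
  with x show "x \<in> normal_closure G Y"
    unfolding normal_closure_def by (blast intro: generate.incl)
qed

lemma (in group) normal_closure_minimal: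
  assumes "N \<lhd> G" "Y \<subseteq> N"
  shows "normal_closure G Y \<subseteq> N"
  unfolding normal_closure_def
proof (rule generate_subgroup_incl)
  show "subgroup N G"
    using assms(1) by (rule normal_imp_subgroup)
  show "{g \<otimes> x \<otimes> inv g |g x. g \<in> carrier G \<and> x \<in> Y} \<subseteq> N"
    using normal.inv_op_closed2[OF assms(1)] assms(2) by auto
qed

lemma (in normal) rcos_eq_iff:
  assumes "x \<in> carrier G" "y \<in> carrier G"
  shows "H #> x = H #> y \<longleftrightarrow> x \<otimes> inv y \<in> H"
  by (metis assms rcos_module rcos_self repr_independence is_group is_subgroup)

lemma (in normal) rcos_eq_self_iff:
  assumes "x \<in> carrier G"
  shows "H #> x = H \<longleftrightarrow> x \<in> H"
  by (metis assms coset_join1 coset_join2 is_subgroup subset)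

lemma (in group_hom) hom_eq_on_coset:
  assumes "N \<lhd> G" "N \<subseteq> kernel G H h" "w \<in> carrier G" "v \<in> N #> w"
  shows "h v = h w"
proof -
  obtain r where "r \<in> N" "v = r \<otimes> w"
    using assms(4) by (auto simp: r_coset_def)
  then show ?thesis
    using assms by (auto simp: kernel_def)
qed

text \<open>Maps on quotient groups, \<open>braid_perm\<close> among them, are written as
  \<open>the_elem\<close> of an image, without a choice of representatives; this lemma computes
  them.\<close>

lemma (in group_hom) the_elem_coset:
  assumes "N \<lhd> G" "N \<subseteq> kernel G H h" "w \<in> carrier G"
  shows "the_elem (h ` (N #> w)) = h w"
proof -
  have "w \<in> N #> w"
    using assms by (metis G.rcos_self normal_imp_subgroup)
  then have "h ` (N #> w) = {h w}"
    using hom_eq_on_coset[OF assms] by blast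
  then show ?thesis by simp
qed

lemma (in group_hom) hom_the_elem_Mod:
  assumes N: "N \<lhd> G" "N \<subseteq> kernel G H h"
  shows "(\<lambda>C. the_elem (h ` C)) \<in> hom (G Mod N) H"
proof (rule homI)
  fix C D assume "C \<in> carrier (G Mod N)" "D \<in> carrier (G Mod N)"
  then obtain x y where "x \<in> carrier G" "y \<in> carrier G" "C = N #> x" "D = N #> y"
    by (auto simp: carrier_FactGroup)
  then show "the_elem (h ` (C \<otimes>\<^bsub>G Mod N\<^esub> D)) = the_elem (h ` C) \<otimes>\<^bsub>H\<^esub> the_elem (h ` D)"
    by (simp add: normal.rcos_sum[OF N(1)] the_elem_coset[OF N])
qed (auto simp: carrier_FactGroup the_elem_coset[OF N])

section \<open>Affine permutations\<close>

text \<open>The affine reflection that exchanges i - 1 and i together with all their translates by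
  m. In contrast to \<open>crossing_lift\<close> the index is an integer, so that shifts of the
  index need no wrap-around.\<close>

definition cross :: "int \<Rightarrow> int \<Rightarrow> int \<Rightarrow> int" where
  "cross m i x =
     (if x mod m = (i - 1) mod m then x + 1 else if x mod m = i mod m then x - 1 else x)"

lemma mod_eq_iff_near:
  fixes u v m :: int
  assumes "\<bar>u - v\<bar> < m"
  shows "u mod m = v mod m \<longleftrightarrow> u = v"
  using assms dvd_imp_le_int[of "u - v" m] by (auto simp: mod_eq_dvd_iff)

text \<open>In a window of m consecutive integers congruence is equality
  (\<open>mod_eq_iff_near\<close>), and \<open>cross\<close> is an ordinary transposition if the
  window contains i - 1 and i. As crossings commute with the translation by m, identities between
  them become finite case distinctions.\<close>

lemma window_representative:
  fixes x c m :: int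
  assumes "m > 0"
  obtains y q where "x = y + m * q" "c - m < y" "y \<le> c"
proof
  show "x = (c - m + 1 + (x - (c - m + 1)) mod m) + m * ((x - (c - m + 1)) div m)"
    using mult_div_mod_eq[of m "x - (c - m + 1)"] by linarith
qed (use pos_mod_bound[OF assms, of "x - (c - m + 1)"] pos_mod_sign[OF assms, of "x - (c - m + 1)"]
     in linarith)+

lemma cross_window:
  assumes "c - m < x" "x \<le> c" "c - m < i - 1" "i \<le> c"
  shows "cross m i x = (if x = i - 1 then x + 1 else if x = i then x - 1 else x)"
  using assms by (simp add: cross_def mod_eq_iff_near)

lemma cross_add_period: "cross m i (x + m * q) = cross m i x + m * q"
  by (simp add: cross_def)

lemma cross_index_cong: "i mod m = j mod m \<Longrightarrow> cross m i = cross m j"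
  using mod_diff_cong[of i m j 1 1] by (simp add: cross_def fun_eq_iff)

lemma cross_cross:
  assumes "m \<ge> 3"
  shows "cross m i (cross m i x) = x"
proof -
  obtain y q where y: "x = y + m * q" "i - 2 + m - m < y" "y \<le> i - 2 + m"
    by (rule window_representative[of m x "i - 2 + m"]) (use assms(1) in auto)
  then consider "y = i - 1" | "y = i" | "i < y"
    by linarith
  then have "cross m i (cross m i y) = y"
    by cases (use y assms in \<open>simp_all add: cross_window[where c = "i - 2 + m"]\<close>)
  then show ?thesis
    by (simp only: y(1) cross_add_period)
qed

lemma cross_braid:
  assumes "m \<ge> 3"
  shows "cross m i (cross m (i + 1) (cross m i x)) = cross m (i + 1) (cross m i (cross m (i + 1) x))"
proof -
  \<comment> \<open>The window starts at i - 1, and because m is at least 3 it also holds i and i +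
    1: both crossings are transpositions of this window.\<close>
  obtain y q where y: "x = y + m * q" "i - 2 + m - m < y" "y \<le> i - 2 + m"
    by (rule window_representative[of m x "i - 2 + m"]) (use assms(1) in auto)
  then consider "y = i - 1" | "y = i" | "y = i + 1" | "i + 1 < y"
    by linarith
  then have "cross m i (cross m (i + 1) (cross m i y)) = cross m (i + 1) (cross m i (cross m (i + 1) y))"
    by cases (use y assms in \<open>simp_all add: cross_window[where c = "i - 2 + m"]\<close>)
  then show ?thesis
    by (simp only: y(1) cross_add_period)
qed

lemma cross_commute:
  assumes "m \<ge> 3" "\<not> m dvd i - j - 1" "\<not> m dvd i - j + 1"
  shows "cross m i (cross m j x) = cross m j (cross m i x)"
proof -
  obtain k p where k: "j = k + m * p" "i - 1 + m - m < k" "k \<le> i - 1 + m"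
    by (rule window_representative[of m j "i - 1 + m"]) (use assms(1) in auto)
  have "k \<noteq> i + 1"
  proof
    assume "k = i + 1"
    with k have "i - j + 1 = m * (- p)"
      by simp
    then show False
      using assms(3) by (metis dvd_triv_left)
  qed
  moreover have "k \<noteq> i - 1 + m"
  proof
    assume "k = i - 1 + m"
    with k have "i - j - 1 = m * (- p - 1) "
      by (simp add: algebra_simps)
    then show False
      using assms(2) by (metis dvd_triv_left)
  qed
  \<comment> \<open>Either the two crossings coincide, or i - 1, i, k - 1 and k are four different
    elements of the window from i - 1 to i - 2 + m.\<close>
  ultimately have r: "k = i \<or> i + 2 \<le> k \<and> k \<le> i - 2 + m"
    using k by linarith
  have j: "cross m j = cross m k"
    by (rule cross_index_cong) (simp add: k)
  obtain y q where y: "x = y + m * q" "i - 2 + m - m < y" "y \<le> i - 2 + m"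
    by (rule window_representative[of m x "i - 2 + m"]) (use assms(1) in auto)
  from r have "cross m i (cross m k y) = cross m k (cross m i y)"
  proof
    assume "i + 2 \<le> k \<and> k \<le> i - 2 + m"
    then have k: "i + 2 \<le> k" "k \<le> i - 2 + m"
      by auto
    consider "y = i - 1" | "y = i" | "i < y" "y < k - 1" | "y = k - 1" | "y = k" | "k < y"
      using y by linarith
    then show ?thesis
      by cases (use y k assms(1) in \<open>simp_all add: cross_window[where c = "i - 2 + m"]\<close>)
  qed simp
  then show ?thesis
    by (simp only: j y(1) cross_add_period)
qed

section \<open>The affine symmetric group\<close>

text \<open>Later instantiated with the quotient of the free group by R. The hypotheses are the
  Coxeter relations and an action that realizes them; that the action is faithful is not assumed.
  Integer indices, periodic by \<open>s_cong\<close>, allow words that run around the cycle.\<close>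

locale affine_presentation = group G for G (structure) +
  fixes n :: nat and s :: "int \<Rightarrow> 'a" and act :: "'a \<Rightarrow> int \<Rightarrow> int"
  assumes n: "n \<ge> 3"
    and s_closed [simp, intro]: "s i \<in> carrier G"
    and s_cong: "i mod int n = j mod int n \<Longrightarrow> s i = s j"
    and s_square: "s i \<otimes> s i = \<one>"
    and s_commute: "\<not> int n dvd i - j - 1 \<Longrightarrow> \<not> int n dvd i - j + 1 \<Longrightarrow> s i \<otimes> s j = s j \<otimes> s i"
    and s_braid: "s i \<otimes> s (i + 1) \<otimes> s i = s (i + 1) \<otimes> s i \<otimes> s (i + 1)"
    and s_generate: "carrier G = generate G (range s)"
    and act_mult: "x \<in> carrier G \<Longrightarrow> y \<in> carrier G \<Longrightarrow> act (x \<otimes> y) k = act x (act y k)"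
    and act_s: "act (s i) = cross (int n) i"
begin

abbreviation m :: int where "m \<equiv> int n"

lemma m: "m \<ge> 3"
  using n by simp

definition pr :: "int list \<Rightarrow> 'a" where
  "pr is = foldr (\<lambda>i x. s i \<otimes> x) is \<one>"

lemma pr_Nil [simp]: "pr [] = \<one>"
  and pr_Cons: "pr (i # is) = s i \<otimes> pr is"
  by (simp_all add: pr_def)

lemma pr_closed [simp, intro]: "pr is \<in> carrier G"
  by (induction "is") (auto simp: pr_Cons)

lemma pr_append: "pr (is @ js) = pr is \<otimes> pr js"
  by (induction "is") (auto simp: pr_Cons m_assoc)

lemma pr_sing: "pr [i] = s i"
  by (simp add: pr_Cons)

lemma inv_s: "inv (s i) = s i"
  by (rule inv_equality) (auto simp: s_square)

lemma mult_inv_cancel: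
  assumes "x \<in> carrier G" "y \<in> carrier G"
  shows "x \<otimes> (inv x \<otimes> y) = y" "inv x \<otimes> (x \<otimes> y) = y"
  using assms by (simp_all flip: m_assoc)

lemma s_cancel: "x \<in> carrier G \<Longrightarrow> s i \<otimes> (s i \<otimes> x) = x"
  by (simp add: s_square flip: m_assoc)

lemma pr_rev: "pr (rev is) = inv pr is"
  by (induction "is") (auto simp: pr_Cons pr_append inv_mult_group inv_s)

lemma ex_pr:
  assumes "x \<in> carrier G"
  shows "\<exists>is. x = pr is"
proof -
  from assms have "x \<in> generate G (range s)"
    using s_generate by simp
  then show ?thesis
  proof induction
    case one
    then show ?case by (metis pr_Nil)
  next
    case (incl h)
    then show ?case by (metis pr_sing rangeE)
  next
    case (inv h)
    then show ?case by (metis inv_s pr_sing rangeE)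
  next
    case (eng h1 h2)
    then show ?case by (metis pr_append)
  qed
qed

lemma act_one: "act \<one> k = k"
  using act_mult[of "s 0" "s 0" k] by (simp add: s_square act_s cross_cross[OF m])

lemma act_pr: "act (pr is) k = foldr (cross m) is k"
  by (induction "is") (auto simp: pr_Cons act_one act_mult act_s)

lemma act_add_period:
  assumes "x \<in> carrier G"
  shows "act x (k + m * q) = act x k + m * q"
proof -
  have "foldr (cross m) is (k + m * q) = foldr (cross m) is k + m * q" for "is"
    by (induction "is") (auto simp: cross_add_period)
  then show ?thesis
    using ex_pr[OF assms] by (auto simp: act_pr)
qed

lemma act_inv:
  assumes "x \<in> carrier G"
  shows "act (inv x) (act x k) = k" "act x (act (inv x) k) = k"
  using assms by (simp_all add: act_one flip: act_mult)

lemma pr_commute_s: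
  "(\<And>i. i \<in> set is \<Longrightarrow> s k \<otimes> s i = s i \<otimes> s k) \<Longrightarrow> pr is \<otimes> s k = s k \<otimes> pr is"
proof (induction "is")
  case (Cons i "is")
  have "pr (i # is) \<otimes> s k = s i \<otimes> (s k \<otimes> pr is)"
    using Cons by (simp add: pr_Cons m_assoc)
  also have "\<dots> = s k \<otimes> pr (i # is)"
    using Cons.prems[of i] by (simp add: pr_Cons flip: m_assoc)
  finally show ?case .
qed simp

lemma s_commute_near:
  assumes "2 \<le> i - j" "i - j \<le> m - 2"
  shows "s i \<otimes> s j = s j \<otimes> s i"
proof (rule s_commute)
  show "\<not> m dvd i - j - 1" "\<not> m dvd i - j + 1"
    using assms zdvd_not_zless[of "i - j - 1" m] zdvd_not_zless[of "i - j + 1" m] by auto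
qed

lemma upto_split: "a \<le> k \<Longrightarrow> k < b \<Longrightarrow> [a..b] = [a..k - 1] @ [k, k + 1] @ [k + 2..b]"
  using upto_split2[of a "k" b] upto_rec1[of k b] upto_rec1[of "k + 1" b] upto_split1[of a k b]
  by (auto simp: add.assoc)

text \<open>\<open>s k\<close> commutes past the letters beyond k + 1, the braid relation turns it
  into \<open>s (k + 1)\<close>, and this commutes past the letters below k. The bound on b - a
  prevents the two ends of the word from being cyclic neighbours.\<close>

lemma pr_upto_s:
  assumes "a \<le> k" "k < b" "b - a \<le> m - 2"
  shows "pr [a..b] \<otimes> s k = s (k + 1) \<otimes> pr [a..b]"
proof -
  have "pr [k + 2..b] \<otimes> s k = s k \<otimes> pr [k + 2..b]"
    using assms by (intro pr_commute_s s_commute_near[symmetric]) auto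
  then have "pr [a..b] \<otimes> s k = pr [a..k - 1] \<otimes> (s k \<otimes> (s (k + 1) \<otimes> (s k \<otimes> pr [k + 2..b])))"
    using assms by (simp add: upto_split[OF assms(1,2)] pr_append pr_Cons m_assoc)
  also have "s k \<otimes> (s (k + 1) \<otimes> (s k \<otimes> pr [k + 2..b]))
      = s (k + 1) \<otimes> (s k \<otimes> (s (k + 1) \<otimes> pr [k + 2..b]))"
    using s_braid[of k] by (simp flip: m_assoc)
  also have "pr [a..k - 1] \<otimes> (s (k + 1) \<otimes> (s k \<otimes> (s (k + 1) \<otimes> pr [k + 2..b])))
      = (pr [a..k - 1] \<otimes> s (k + 1)) \<otimes> (s k \<otimes> (s (k + 1) \<otimes> pr [k + 2..b]))"
    by (simp add: m_assoc)
  also have "pr [a..k - 1] \<otimes> s (k + 1) = s (k + 1) \<otimes> pr [a..k - 1]"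
    using assms by (intro pr_commute_s s_commute_near) auto
  finally show ?thesis
    using assms by (simp add: upto_split[OF assms(1,2)] pr_append pr_Cons m_assoc)
qed

section \<open>The elements \<open>D a\<close> and their quotients\<close>

text \<open>The element \<open>D a\<close> takes every strand one position forwards, except for the strand at position
  \<open>a\<close>, which goes around the cylinder in the opposite direction and arrives at \<open>a + 1\<close> as well.\<close>

definition D :: "int \<Rightarrow> 'a" where
  "D a = pr [a + 2..a + m]"

lemma D_closed [simp, intro]: "D a \<in> carrier G"
  by (simp add: D_def)

lemma D_cong:
  assumes "a mod m = b mod m"
  shows "D a = D b"
proof -
  have 1: "pr (map (\<lambda>i. i + (b - a)) is) = pr is" for "is"
  proof (induction "is")
    case (Cons i "is")
    have "s (i + (b - a)) = s i"
      using assms by (intro s_cong) (simp add: mod_eq_dvd_iff dvd_diff_commute)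
    with Cons show ?case
      by (simp add: pr_Cons)
  qed simp
  have "[b + 2..b + m] = map (\<lambda>i. i + (b - a)) [a + 2..a + m]"
    by (rule nth_equalityI) auto
  then show ?thesis
    by (simp add: D_def 1)
qed

text \<open>The word of \<open>D a\<close> contains every generator but \<open>s (a + 1)\<close>.
  All its letters except the last are shifted by \<open>pr_upto_s\<close>. The missing letter,
  appended as index a + m + 1, leaves the word of \<open>D (a + 1)\<close> once
  \<open>s (a + 2)\<close> is split off in front. The last letter cancels, and inserting
  \<open>s (a + 1)\<close> twice in front produces the word of \<open>D (a - 1)\<close>.\<close>

lemma D_s: "D a \<otimes> s k = s (k + 1) \<otimes> D (cross m k a)"
proof -
  obtain j q where j: "k = j + m * q" "a + m - m < j" "j \<le> a + m"
    by (rule window_representative[of m k "a + m"]) (use n in auto)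
  have k: "s k = s j" "s (k + 1) = s (j + 1)" "cross m k = cross m j"
    by (rule s_cong, simp add: j)
      (rule s_cong, simp add: j mod_eq_dvd_iff, rule cross_index_cong, simp add: j)
  have rng: "[a + 2..a + m] = [a + 2..a + m - 1] @ [a + m]" "[a + 2..a + m + 1] = [a + 2..a + m] @ [a + m + 1]"
    "[a + 2..a + m + 1] = (a + 2) # [a + 3..a + m + 1]" "[a + 1..a + m - 1] = (a + 1) # [a + 2..a + m - 1]"
    using n upto_rec2[of "a + 2" "a + m"] upto_rec2[of "a + 2" "a + m + 1"]
      upto_rec1[of "a + 2" "a + m + 1"] upto_rec1[of "a + 1" "a + m - 1"]
    by (simp_all add: add.assoc)
  consider "j = a + 1" | "j = a + m" | "a + 2 \<le> j" "j < a + m"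
    using j by linarith
  then show ?thesis
  proof cases
    case 1
    have c: "cross m j a = a + 1"
      using n by (simp add: 1 cross_def)
    have s: "s j = s (a + m + 1)" "s (j + 1) = s (a + 2)"
      by (rule s_cong; simp add: 1 mod_eq_dvd_iff)+
    have D: "D (a + 1) = pr [a + 3..a + m + 1]"
      unfolding D_def by (rule arg_cong[where f = pr]) (simp add: ac_simps)
    have "D a \<otimes> s (a + m + 1) = pr [a + 2..a + m + 1]"
      unfolding D_def rng(2) by (simp add: pr_append pr_sing)
    also have "\<dots> = s (a + 2) \<otimes> pr [a + 3..a + m + 1]"
      unfolding rng(3) by (rule pr_Cons)
    finally show ?thesis
      unfolding k c s D .
  next
    case 2
    have "cross m j a = a - 1"
      using n cross_window[of "a + m - 1" m a "a + m"] by (simp add: 2 cross_def mod_eq_iff_near)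
    moreover have "s (a + m + 1) = s (a + 1)"
      by (rule s_cong) (simp add: mod_eq_dvd_iff)
    moreover have "D (a - 1) = pr ((a + 1) # [a + 2..a + m - 1])"
      unfolding D_def rng(4)[symmetric] by (rule arg_cong[where f = pr]) (simp add: algebra_simps)
    ultimately show ?thesis
      using rng(1) unfolding k by (simp add: D_def 2 pr_append pr_Cons m_assoc s_square s_cancel)
  next
    case 3
    have "cross m j a = a"
      using 3 by (simp add: cross_def mod_eq_iff_near)
    with 3 show ?thesis
      unfolding k D_def by (simp add: pr_upto_s)
  qed
qed

text \<open>The left factor, the word with all indices shifted, does not depend on \<open>a\<close>.
  It therefore cancels in \<open>t a b\<close>, which is why conjugation only relabels the two
  indices in \<open>t_conj\<close>.\<close>

lemma D_pr: "D a \<otimes> pr is = pr (map (\<lambda>i. i + 1) is) \<otimes> D (foldr (cross m) (rev is) a)"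
proof (induction "is" arbitrary: a)
  case (Cons i "is")
  have "D a \<otimes> pr (i # is) = s (i + 1) \<otimes> (D (cross m i a) \<otimes> pr is)"
    using D_s[of a i] by (simp add: pr_Cons flip: m_assoc)
  also have "\<dots> = pr (map (\<lambda>i. i + 1) (i # is)) \<otimes> D (foldr (cross m) (rev (i # is)) a)"
    by (simp add: Cons.IH pr_Cons m_assoc)
  finally show ?case .
qed simp

text \<open>The letters act from the right, that is, with falling indices. The strand at a + m is
  met by each of them and is carried down to a + 1; every other strand y of the window is moved only
  once, by the letter y + 1.\<close>

lemma act_D: "act (D a) k = k + 1 - (if k mod m = a mod m then m else 0)"
proof -
  obtain y q where y: "k = y + m * q" "a + m - m < y" "y \<le> a + m"
    by (rule window_representative[of m k "a + m"]) (use n in auto)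
  have hit: "foldr (cross m) [j..a + m] (a + m) = j - 1" if "a + 2 \<le> j" "j \<le> a + m + 1" for j
    using that(2,1)
  proof (induction rule: int_le_induct)
    case (step i)
    then show ?case
      using cross_window[of "a + m" m "i - 1" "i - 1"] by (simp add: upto_rec1)
  qed simp
  have pass: "foldr (cross m) [j..a + m] y = (if j \<le> y + 1 then y + 1 else y)"
    if "a + 2 \<le> j" "j \<le> a + m + 1" "y < a + m" for j
    using that(2,1)
  proof (induction rule: int_le_induct)
    case (step i)
    then show ?case
      using y that cross_window[of "a + m" m y "i - 1"] cross_window[of "a + m" m "y + 1" "i - 1"]
      by (simp add: upto_rec1)
  qed (use that in simp)
  have "act (D a) y = y + 1 - (if y mod m = a mod m then m else 0)"
  proof (cases "y = a + m")
    case True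
    then show ?thesis
      using hit[of "a + 2"] n by (simp add: D_def act_pr)
  next
    case False
    then have "y mod m \<noteq> a mod m"
      using y by (subst mod_eq_iff_near) auto
    then show ?thesis
      using pass[of "a + 2"] y False n by (simp add: D_def act_pr)
  qed
  then show ?thesis
    by (simp add: y(1) act_add_period)
qed

text \<open>The shift common to \<open>D a\<close> and \<open>D b\<close> cancels, which leaves a
  translation: one turn forwards on the class of a and one turn backwards on the class of b
  (\<open>act_t\<close>).\<close>

definition t :: "int \<Rightarrow> int \<Rightarrow> 'a" where
  "t a b = inv D a \<otimes> D b"

lemma t_closed [simp, intro]: "t a b \<in> carrier G"
  by (simp add: t_def)

lemma t_cong: "a mod m = a' mod m \<Longrightarrow> b mod m = b' mod m \<Longrightarrow> t a b = t a' b'"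
  using D_cong[of a a'] D_cong[of b b'] by (simp add: t_def)

lemma act_t:
  "act (t a b) k = k + m * (of_bool (k mod m = a mod m) - of_bool (k mod m = b mod m))"
proof -
  let ?z = "k + m * (of_bool (k mod m = a mod m) - of_bool (k mod m = b mod m))"
  have "act (D a) (act (t a b) k) = act (D b) k"
    by (simp add: t_def flip: act_mult m_assoc)
  also have "\<dots> = act (D a) ?z"
    by (simp add: act_D)
  finally show ?thesis
    by (metis D_closed act_inv(1))
qed

lemma t_conj:
  assumes "g \<in> carrier G"
  shows "inv g \<otimes> t a b \<otimes> g = t (act (inv g) a) (act (inv g) b)"
proof -
  obtain "is" where g: "g = pr is"
    using ex_pr[OF assms] by blast
  let ?h = "pr (map (\<lambda>i. i + 1) is)"
  have *: "D c \<otimes> g = ?h \<otimes> D (act (inv g) c)" for c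
    by (simp add: D_pr g act_pr flip: pr_rev)
  have "inv g \<otimes> t a b \<otimes> g = inv (D a \<otimes> g) \<otimes> (D b \<otimes> g)"
    by (simp add: t_def inv_mult_group m_assoc assms)
  also have "\<dots> = t (act (inv g) a) (act (inv g) b)"
    unfolding * using assms by (simp add: t_def inv_mult_group m_assoc mult_inv_cancel)
  finally show ?thesis .
qed


section \<open>Pure elements and the subgroup of translations\<close>

definition Pure :: "'a set" where
  "Pure = {g \<in> carrier G. \<forall>k. act g k mod m = k mod m}"

lemma Pure_subgroup: "subgroup Pure G"
proof (rule subgroupI)
  show "inv g \<in> Pure" if "g \<in> Pure" for g
    using that act_inv(2)[of g] by (auto simp: Pure_def) metis
qed (auto simp: Pure_def act_one act_mult intro!: exI[of _ \<one>])

lemma t_Pure: "t a b \<in> Pure"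
  by (simp add: Pure_def act_t)

text \<open>Conjugation by g only moves the two indices (\<open>t_conj\<close>), and a pure g keeps
  their residues. Since \<open>t_conj\<close> comes from the relations, this holds in the presented
  group and not merely for maps of the integers.\<close>

lemma t_commute_Pure:
  assumes "g \<in> Pure"
  shows "t a b \<otimes> g = g \<otimes> t a b"
proof -
  have g: "g \<in> carrier G" "inv g \<in> Pure"
    using assms subgroup.m_inv_closed[OF Pure_subgroup] by (auto simp: Pure_def)
  then have "inv g \<otimes> t a b \<otimes> g = t a b"
    unfolding t_conj[OF g(1)] by (intro t_cong) (auto simp: Pure_def)
  moreover have "t a b \<otimes> g = g \<otimes> (inv g \<otimes> t a b \<otimes> g)"
    using g by (simp add: m_assoc mult_inv_cancel)
  ultimately show ?thesis
    by simp
qed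

definition T :: "'a set" where
  "T = generate G {t a b | a b. True}"

lemma t_T: "t a b \<in> T"
  unfolding T_def by (blast intro: generate.incl)

lemma T_normal: "T \<lhd> G"
  unfolding T_def
proof (rule normal_generateI)
  fix h g assume "h \<in> {t a b | a b. True}" "g \<in> carrier G"
  then show "g \<otimes> h \<otimes> inv g \<in> {t a b | a b. True}"
    using t_conj[of "inv g"] by auto
qed auto

lemma T_carrier: "u \<in> T \<Longrightarrow> u \<in> carrier G"
  by (rule subgroup.mem_carrier[OF normal_imp_subgroup[OF T_normal]])

lemma T_subset_Pure: "T \<subseteq> Pure"
  unfolding T_def using t_Pure by (intro generate_subgroup_incl Pure_subgroup) auto

lemma T_commute_Pure:
  assumes "u \<in> T" "g \<in> Pure"
  shows "u \<otimes> g = g \<otimes> u"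
  using assms(1) unfolding T_def
proof induction
  case one
  then show ?case
    using assms(2) by (simp add: Pure_def)
next
  case (incl h)
  then show ?case
    using assms(2) t_commute_Pure by auto
next
  case (inv h)
  then obtain a b where h: "h = t a b"
    by auto
  then have "inv h = t b a"
    by (simp add: t_def inv_mult_group)
  then show ?case
    using assms(2) t_commute_Pure by simp
next
  case (eng h1 h2)
  then have c: "h1 \<in> carrier G" "h2 \<in> carrier G" "g \<in> carrier G"
    using assms(2) T_carrier by (auto simp: T_def Pure_def)
  have "h1 \<otimes> h2 \<otimes> g = h1 \<otimes> (h2 \<otimes> g)"
    using c by (simp add: m_assoc)
  also have "\<dots> = (h1 \<otimes> g) \<otimes> h2"
    using c by (simp add: eng.IH(2) m_assoc)
  also have "\<dots> = g \<otimes> (h1 \<otimes> h2)"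
    using c by (simp add: eng.IH(1) m_assoc)
  finally show ?case .
qed

lemma T_eq_generate: "T = generate G (t 1 ` {2..m})"
proof
  let ?X = "generate G (t 1 ` {2..m})"
  have sub: "subgroup ?X G"
    by (rule generate_is_subgroup) auto
  have 1: "t 1 a \<in> ?X" for a
  proof -
    obtain b q where b: "a = b + m * q" "m - m < b" "b \<le> m"
      by (rule window_representative[of m a m]) (use n in auto)
    have t: "t 1 a = t 1 b"
      by (rule t_cong) (simp_all add: b)
    have "b = 1 \<or> b \<in> {2..m}"
      using b by auto
    then show ?thesis
      unfolding t by (auto simp: t_def intro: generate.one generate.incl)
  qed
  have "t a b = inv t 1 a \<otimes> t 1 b" for a b
    by (simp add: t_def inv_mult_group m_assoc mult_inv_cancel)
  then have "t a b \<in> ?X" for a b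
    using 1 sub by (metis subgroup.m_closed subgroup.m_inv_closed)
  then show "T \<subseteq> ?X"
    unfolding T_def by (intro generate_subgroup_incl sub) auto
  show "?X \<subseteq> T"
    unfolding T_def by (rule mono_generate) auto
qed

section \<open>The subgroup generated by \<open>s 2\<close>, ..., \<open>s n\<close>\<close>

text \<open>Coset representatives in the chain of the subgroups generated by \<open>s 2, \<dots>, s k\<close>; in this way the
  subgroup generated by \<open>s 2, \<dots>, s n\<close> turns out to act faithfully.\<close>

lemma finite_part_coset:
  assumes "set is \<subseteq> {2..k}" "1 \<le> k" "k \<le> m"
  shows "\<exists>j js. 2 \<le> j \<and> j \<le> k + 1 \<and> set js \<subseteq> {2..k - 1} \<and> pr is = pr [j..k] \<otimes> pr js"
  using assms(1)
proof (induction "is")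
  case Nil
  show ?case
    using assms(2) by (intro exI[of _ "k + 1"] exI[of _ "[]"]) auto
next
  case (Cons i "is")
  then obtain j js where j: "2 \<le> j" "j \<le> k + 1" "set js \<subseteq> {2..k - 1}" "pr is = pr [j..k] \<otimes> pr js"
    by auto
  then have eq: "pr (i # is) = (s i \<otimes> pr [j..k]) \<otimes> pr js"
    by (simp add: pr_Cons m_assoc)
  have i: "2 \<le> i" "i \<le> k"
    using Cons.prems by auto
  \<comment> \<open>The letter i meets the representative s j ... s k: it commutes past it, prolongs
    it, cancels its first letter, or passes through it with its index lowered by one.\<close>
  consider "i \<le> j - 2" | "i = j - 1" | "i = j" | "j < i"
    by linarith
  then show ?case
  proof cases
    case 1
    have "s i \<otimes> pr [j..k] = pr [j..k] \<otimes> s i"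
      using 1 i assms(3) by (intro pr_commute_s[symmetric] s_commute_near[symmetric]) auto
    with eq 1 j i show ?thesis
      by (intro exI[of _ j] exI[of _ "i # js"]) (auto simp: pr_Cons m_assoc)
  next
    case 2
    with eq i j show ?thesis
      by (intro exI[of _ "j - 1"] exI[of _ js]) (auto simp: upto_rec1[of "j - 1" k] pr_Cons)
  next
    case 3
    with eq i j show ?thesis
      by (intro exI[of _ "j + 1"] exI[of _ js]) (auto simp: upto_rec1[of j k] pr_Cons s_cancel)
  next
    case 4
    then have "s i \<otimes> pr [j..k] = pr [j..k] \<otimes> s (i - 1)"
      using pr_upto_s[of j "i - 1" k] i j assms(3) by simp
    with eq 4 j i show ?thesis
      by (intro exI[of _ j] exI[of _ "(i - 1) # js"]) (auto simp: pr_Cons m_assoc)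
  qed
qed

text \<open>In the induction step the factor from the smaller subgroup fixes the largest position k
  + 1, and the coset representative takes it to j - 1. Both positions lie between 1 and n, so purity
  forces them to be equal; the representative is then the empty word.\<close>

lemma finite_part_faithful:
  assumes "set is \<subseteq> {2..int k}" "k \<le> n" "pr is \<in> Pure"
  shows "pr is = \<one>"
  using assms
proof (induction k arbitrary: "is")
  case 0
  then have "is = []"
    by (cases "is") auto
  then show ?case
    by simp
next
  case (Suc k)
  obtain j js where j: "2 \<le> j" "j \<le> int k + 2" "set js \<subseteq> {2..int k}"
    "pr is = pr [j..int k + 1] \<otimes> pr js"
    using finite_part_coset[of "is" "int k + 1"] Suc.prems by (auto simp: add.commute)
  have fixed: "foldr (cross m) js (int k + 1) = int k + 1"
    using j(3)
  proof (induction js)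
    case (Cons i js)
    then have "cross m i (int k + 1) = int k + 1"
      using cross_window[of m m "int k + 1" i] Suc.prems by simp
    with Cons show ?case
      by simp
  qed simp
  have "foldr (cross m) [j..int k + 1] (int k + 1) = j - 1"
    using j(2,1)
  proof (induction rule: int_le_induct)
    case (step i)
    then show ?case
      using cross_window[of m m "i - 1" "i - 1"] Suc.prems by (simp add: upto_rec1)
  qed simp
  then have "act (pr is) (int k + 1) = j - 1"
    by (simp add: j(4) act_mult act_pr fixed)
  then have "(j - 1) mod m = (int k + 1) mod m"
    using Suc.prems(3) by (auto simp: Pure_def dest: spec[of _ "int k + 1"])
  then have "j = int k + 2"
    using j(1,2) Suc.prems(2) by (subst (asm) mod_eq_iff_near) auto
  then have "pr is = pr js"
    by (simp add: j(4))
  then show ?case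
    using Suc.IH[OF j(3)] Suc.prems by simp
qed

text \<open>Since \<open>T\<close> is normal, its elements can be collected on the left; then only
  the letter \<open>s 1\<close> has to be rewritten.\<close>

lemma T_mult_finite_part:
  "\<exists>u\<in>T. \<exists>js. set js \<subseteq> {2..m} \<and> pr is = u \<otimes> pr js"
proof (induction "is")
  case Nil
  show ?case
    using subgroup.one_closed[OF normal_imp_subgroup[OF T_normal]]
    by (intro bexI[of _ \<one>] exI[of _ "[]"]) auto
next
  case (Cons i "is")
  note Tm = subgroup.m_closed[OF normal_imp_subgroup[OF T_normal]]
    and Tc = normal.inv_op_closed2[OF T_normal]
  obtain u js where u: "u \<in> T" "set js \<subseteq> {2..m}" "pr is = u \<otimes> pr js"
    using Cons by blast
  have s: "\<exists>v\<in>T. \<exists>ks. set ks \<subseteq> {2..m} \<and> s i = v \<otimes> pr ks"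
  proof -
    obtain b q where b: "i = b + m * q" "m - m < b" "b \<le> m"
      by (rule window_representative[of m i m]) (use n in auto)
    have i: "s i = s b"
      by (rule s_cong) (simp add: b)
    show ?thesis
    proof (cases "b = 1")
      case False
      then show ?thesis
        using b i subgroup.one_closed[OF normal_imp_subgroup[OF T_normal]]
        by (intro bexI[of _ \<one>] exI[of _ "[b]"]) (auto simp: pr_sing)
    next
      case True
      \<comment> \<open>\<open>D 0\<close> is s 2 ... s n and \<open>D 1\<close> is s 3 ... s n s 1.
        Hence s 1 is (s 3 ... s n)^-1 (s 2 ... s n) times \<open>t 0 1\<close>, and the two words in
        brackets make up \<open>?w\<close>. Conjugation then brings the translation to the
        left.\<close>
      let ?w = "pr (rev [3..m] @ [2..m])"
      have "D 1 = pr [3..m] \<otimes> s (m + 1)"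
        using n upto_rec2[of 3 "m + 1"] by (simp add: D_def pr_append pr_sing add.commute)
      also have "s (m + 1) = s 1"
        by (rule s_cong) simp
      finally have "s 1 = inv pr [3..m] \<otimes> D 1"
        by (simp add: mult_inv_cancel)
      also have "\<dots> = ?w \<otimes> t 0 1"
        by (simp add: t_def D_def pr_append pr_rev m_assoc mult_inv_cancel)
      also have "\<dots> = (?w \<otimes> t 0 1 \<otimes> inv ?w) \<otimes> ?w"
        by (simp add: m_assoc)
      finally show ?thesis
        using Tc[of ?w "t 0 1"] t_T[of 0 1] True i
        by (intro bexI[of _ "?w \<otimes> t 0 1 \<otimes> inv ?w"] exI[of _ "rev [3..m] @ [2..m]"]) auto
    qed
  qed
  then obtain v ks where v: "v \<in> T" "set ks \<subseteq> {2..m}" "s i = v \<otimes> pr ks"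
    by blast
  have "pr (i # is) = s i \<otimes> u \<otimes> (inv s i \<otimes> s i) \<otimes> pr js"
    using u T_carrier by (simp add: pr_Cons m_assoc)
  also have "\<dots> = (s i \<otimes> u \<otimes> inv s i) \<otimes> (s i \<otimes> pr js)"
    using T_carrier[OF u(1)] by (simp add: m_assoc mult_inv_cancel)
  also have "s i \<otimes> pr js = v \<otimes> pr (ks @ js)"
    using T_carrier[OF v(1)] by (simp add: v(3) pr_append m_assoc)
  finally have "pr (i # is) = (s i \<otimes> u \<otimes> inv s i \<otimes> v) \<otimes> pr (ks @ js)"
    using T_carrier u v by (simp add: m_assoc)
  moreover have "s i \<otimes> u \<otimes> inv s i \<otimes> v \<in> T"
    using u(1) v(1) by (intro Tm Tc) auto
  ultimately show ?case
    using u v by (intro bexI[of _ "s i \<otimes> u \<otimes> inv s i \<otimes> v"] exI[of _ "ks @ js"]) auto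
qed

text \<open>Dividing a pure element by its factor in \<open>T\<close> leaves a pure product of
  \<open>s 2\<close>, ..., \<open>s n\<close>, which is trivial by
  \<open>finite_part_faithful\<close>.\<close>

lemma Pure_eq_T: "Pure = T"
proof
  show "Pure \<subseteq> T"
  proof
    fix g assume g: "g \<in> Pure"
    then obtain u js where u: "u \<in> T" "set js \<subseteq> {2..m}" "g = u \<otimes> pr js"
      using T_mult_finite_part ex_pr by (metis (no_types, lifting) Pure_def mem_Collect_eq)
    then have "pr js = inv u \<otimes> g"
      using T_carrier by (simp add: u(3) mult_inv_cancel)
    then have "pr js \<in> Pure"
      using u g T_subset_Pure Pure_subgroup
      by (metis subgroup.m_closed subgroup.m_inv_closed subsetD)
    then have "pr js = \<one>"
      using u(2) finite_part_faithful[of js n] by simp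
    with u show "g \<in> T"
      using T_carrier by simp
  qed
qed (rule T_subset_Pure)

section \<open>Winding numbers and the isomorphism with the lattice\<close>

abbreviation PG :: "('a, 'b) monoid_scheme" where
  "PG \<equiv> G\<lparr>carrier := Pure\<rparr>"

lemma PG_comm_group: "comm_group PG"
proof -
  have "group PG"
    using Pure_subgroup subgroup_imp_group by blast
  then show ?thesis
    using T_commute_Pure by (intro group.group_comm_groupI) (auto simp: Pure_eq_T)
qed

lemma PG_generate: "generate PG (t 1 ` {2..m}) = carrier PG"
  using generate_consistent[OF _ Pure_subgroup, of "t 1 ` {2..m}"] t_Pure T_eq_generate Pure_eq_T
  by auto

definition wind :: "int \<Rightarrow> 'a \<Rightarrow> int" where
  "wind k g = (act g k - k) div m"

lemma act_wind: "g \<in> Pure \<Longrightarrow> act g k = k + m * wind k g"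
  by (simp add: Pure_def wind_def mod_eq_dvd_iff)

text \<open>A pure element adds a multiple of m to k and commutes with translations by m, so these
  multiples add up under composition.\<close>

lemma wind_hom: "wind k \<in> hom PG integer_group"
proof (rule homI)
  fix g h assume "g \<in> carrier PG" "h \<in> carrier PG"
  then have gh: "g \<in> Pure" "h \<in> Pure" "g \<in> carrier G" "h \<in> carrier G"
    by (auto simp: Pure_def)
  then have "act (g \<otimes> h) k = act g (k + m * wind k h)"
    by (simp only: act_mult act_wind[of h])
  also have "\<dots> = k + m * wind k g + m * wind k h"
    using gh by (simp only: act_add_period act_wind[of g])
  finally have "act (g \<otimes> h) k - k = m * (wind k g + wind k h)"
    by (simp add: algebra_simps)
  then show "wind k (g \<otimes>\<^bsub>PG\<^esub> h) = wind k g \<otimes>\<^bsub>integer_group\<^esub> wind k h"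
    using n by (simp add: wind_def[of k "g \<otimes> h"])
qed simp

lemma wind_t: "wind k (t a b) = of_bool (k mod m = a mod m) - of_bool (k mod m = b mod m)"
  using n by (simp add: wind_def act_t)

text \<open>Coordinate j belongs to strand j + 1; strand 1 is left out because its winding number is
  minus the sum of the others. On the generators \<open>t 1 i\<close> the remaining winding numbers
  form the negative of the identity matrix. As every element is a product \<open>E c\<close> of
  their powers, this gives injectivity as well as surjectivity.\<close>

theorem PG_iso:
  "(\<lambda>g. \<lambda>j\<in>{1..n - 1}. wind (int j + 1) g) \<in> iso PG (product_group {1..n - 1} (\<lambda>_. integer_group))"
  (is "?F \<in> iso PG ?P")
proof -
  interpret PG: comm_group PG
    by (rule PG_comm_group)
  have W: "group_hom PG integer_group (wind k)" for k
    using wind_hom by (simp add: group_hom_def group_hom_axioms_def)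
  define E where "E c = finprod PG (\<lambda>j. t 1 (int j + 1) [^]\<^bsub>PG\<^esub> c j) {1..n - 1}" for c :: "nat \<Rightarrow> int"
  have tP: "t 1 (int j + 1) [^]\<^bsub>PG\<^esub> (i :: int) \<in> carrier PG" for i j
    using t_Pure by (intro PG.int_pow_closed) simp
  have E_closed: "E c \<in> carrier PG" for c
    unfolding E_def using tP by (intro PG.finprod_closed) auto
  have wind_E: "wind (int k + 1) (E c) = - c k" if k: "k \<in> {1..n - 1}" for c k
  proof -
    have "wind (int k + 1) (finprod PG (\<lambda>j. t 1 (int j + 1) [^]\<^bsub>PG\<^esub> c j) A)
        = (\<Sum>j\<in>A. - (if j = k then c j else 0))" if "A \<subseteq> {1..n - 1}" for A
      using finite_subset[OF that finite_atLeastAtMost] that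
    proof (induction A rule: finite_induct)
      case empty
      then show ?case
        using group_hom.hom_one[OF W] by simp
    next
      case (insert j A)
      have "wind (int k + 1) (t 1 (int j + 1)) = - of_bool (j = k)"
      proof -
        have "(int k + 1) mod m \<noteq> 1 mod m" "(int k + 1) mod m = (int j + 1) mod m \<longleftrightarrow> j = k"
          using k insert.prems by (subst mod_eq_iff_near; auto)+
        then show ?thesis
          by (simp only: wind_t) simp
      qed
      then have "wind (int k + 1) (t 1 (int j + 1) [^]\<^bsub>PG\<^esub> c j) = - (if j = k then c j else 0)"
        using group_hom.hom_int_pow[OF W, of "t 1 (int j + 1)" "int k + 1" "c j"] t_Pure by simp
      moreover have "finprod PG (\<lambda>j. t 1 (int j + 1) [^]\<^bsub>PG\<^esub> c j) A \<in> carrier PG"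
        using tP by (intro PG.finprod_closed) auto
      ultimately show ?case
        using insert tP hom_mult[OF wind_hom] by (simp add: PG.finprod_insert)
    qed
    from this[of "{1..n - 1}"] show ?thesis
      using k by (simp add: E_def sum_negf sum.delta)
  qed
  have ex_E: "\<exists>c. g = E c" if "g \<in> carrier PG" for g
  proof -
    have E0: "E (\<lambda>_. 0) = \<one>\<^bsub>PG\<^esub>"
      unfolding E_def by (rule PG.finprod_one_eqI) (simp add: int_pow_0)
    have E_add: "E c \<otimes>\<^bsub>PG\<^esub> E d = E (\<lambda>j. c j + d j)" for c d
    proof -
      have "E (\<lambda>j. c j + d j) = finprod PG (\<lambda>j. (t 1 (int j + 1) [^]\<^bsub>PG\<^esub> c j) \<otimes>\<^bsub>PG\<^esub> (t 1 (int j + 1) [^]\<^bsub>PG\<^esub> d j)) {1..n - 1}"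
        unfolding E_def using t_Pure tP subgroup.m_closed[OF Pure_subgroup]
        by (intro PG.finprod_cong) (auto simp: PG.int_pow_mult simp_implies_def)
      also have "\<dots> = E c \<otimes>\<^bsub>PG\<^esub> E d"
        unfolding E_def by (rule PG.finprod_multf) (use tP in blast)+
      finally show ?thesis
        by (rule sym)
    qed
    have inc: "t 1 i = E (\<lambda>j. of_bool (int j + 1 = i))" if "i \<in> {2..m}" for i
    proof -
      have j: "nat (i - 1) \<in> {1..n - 1}" "int (nat (i - 1)) + 1 = i"
        using that by auto
      have "E (\<lambda>j. of_bool (int j + 1 = i))
          = finprod PG (\<lambda>j. if nat (i - 1) = j then t 1 (int j + 1) else \<one>\<^bsub>PG\<^esub>) {1..n - 1}"
        unfolding E_def using t_Pure tP j
        by (intro PG.finprod_cong) (auto simp: simp_implies_def int_pow_0 PG.int_pow_1)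
      also have "\<dots> = t 1 i"
        using j t_Pure by (subst PG.finprod_singleton) auto
      finally show ?thesis
        by simp
    qed
    from that have "g \<in> generate PG (t 1 ` {2..m})"
      using PG_generate by simp
    then show ?thesis
    proof induction
      case one
      then show ?case
        using E0 by metis
    next
      case (incl h)
      then show ?case
        using inc by auto
    next
      case (inv h)
      then obtain c where h: "h = E c"
        using inc by auto
      have "E (\<lambda>j. - c j) \<otimes>\<^bsub>PG\<^esub> E c = \<one>\<^bsub>PG\<^esub>"
        by (simp only: E_add add.left_inverse E0)
      then have "inv\<^bsub>PG\<^esub> h = E (\<lambda>j. - c j)"
        unfolding h by (rule PG.inv_equality) (rule E_closed)+
      then show ?case
        by blast
    next
      case (eng h1 h2)
      then show ?case
        using E_add by metis
    qed
  qed
  have hom: "?F \<in> hom PG ?P"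
    using hom_mult[OF wind_hom] by (intro homI) (auto simp: fun_eq_iff)
  have P: "group ?P"
    by (rule product_group) simp
  interpret F: group_hom PG ?P ?F
    using hom P by (simp add: group_hom_def group_hom_axioms_def)
  show ?thesis
    unfolding F.iso_iff
  proof (intro conjI subsetI ballI impI)
    fix v assume v: "v \<in> carrier ?P"
    \<comment> \<open>The minus sign compensates the one in \<open>wind_E\<close>.\<close>
    then have "v = ?F (E (\<lambda>j. - v j))"
      by (auto simp: wind_E fun_eq_iff PiE_def extensional_def)
    then show "v \<in> ?F ` carrier PG"
      using E_closed by blast
  next
    fix g assume g: "g \<in> carrier PG" "?F g = \<one>\<^bsub>?P\<^esub>"
    then obtain c where c: "g = E c"
      using ex_E by blast
    have "c j = 0" if "j \<in> {1..n - 1}" for j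
      using fun_cong[OF g(2), of j] that wind_E[OF that, of c] by (simp add: c)
    then show "g = \<one>\<^bsub>PG\<^esub>"
      unfolding c E_def by (intro PG.finprod_one_eqI) (simp add: int_pow_0)
  qed
qed

end

section \<open>Recutting of polygons\<close>

text \<open>The coefficient depends on distances alone. So mirroring commutes with affine isometries
  and, in \<open>mirror_braid_2\<close>, with the embedding of the plane into space.\<close>

lemma bisector_mirror_expand:
  "bisector_mirror a b x = x - (((dist x a)\<^sup>2 - (dist x b)\<^sup>2) / (norm (b - a))\<^sup>2) *\<^sub>R (b - a)"
proof -
  have "2 * ((x - midpoint a b) \<bullet> (b - a)) = (dist x a)\<^sup>2 - (dist x b)\<^sup>2"
    by (simp add: midpoint_def dist_norm power2_norm_eq_inner inner_simps inner_commute algebra_simps)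
  then show ?thesis
    by (simp add: bisector_mirror_def power2_norm_eq_inner)
qed

lemma dist_bisector_mirror:
  assumes "a \<noteq> b"
  shows "dist (bisector_mirror a b x) a = dist x b" "dist (bisector_mirror a b x) b = dist x a"
proof -
  define k where "k = ((dist x a)\<^sup>2 - (dist x b)\<^sup>2) / (norm (b - a))\<^sup>2"
  have k: "k * (norm (b - a))\<^sup>2 = (dist x a)\<^sup>2 - (dist x b)\<^sup>2"
    using assms by (simp add: k_def)
  have q: "bisector_mirror a b x - c = (x - c) - k *\<^sub>R (b - a)" for c
    by (simp add: bisector_mirror_expand k_def)
  have n: "(norm (v - k *\<^sub>R (b - a)))\<^sup>2
      = (norm v)\<^sup>2 - k * (2 * (v \<bullet> (b - a))) + k * (k * (norm (b - a))\<^sup>2)" for v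
    by (simp add: power2_norm_eq_inner inner_simps inner_commute algebra_simps)
  have "2 * ((x - a) \<bullet> (b - a)) = (norm (b - a))\<^sup>2 + ((dist x a)\<^sup>2 - (dist x b)\<^sup>2)"
    by (simp add: dist_norm power2_norm_eq_inner inner_simps inner_commute algebra_simps)
  with n[of "x - a"] have "(norm (bisector_mirror a b x - a))\<^sup>2
      = (dist x a)\<^sup>2 - k * ((norm (b - a))\<^sup>2 + ((dist x a)\<^sup>2 - (dist x b)\<^sup>2)) + k * ((dist x a)\<^sup>2 - (dist x b)\<^sup>2)"
    by (simp only: q k dist_norm)
  also have "\<dots> = (dist x b)\<^sup>2"
    using k by (simp only: distrib_left)
  finally show "dist (bisector_mirror a b x) a = dist x b"
    by (simp add: dist_norm)
  have "2 * ((x - b) \<bullet> (b - a)) = ((dist x a)\<^sup>2 - (dist x b)\<^sup>2) - (norm (b - a))\<^sup>2"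
    by (simp add: dist_norm power2_norm_eq_inner inner_simps inner_commute algebra_simps)
  with n[of "x - b"] have "(norm (bisector_mirror a b x - b))\<^sup>2
      = (dist x b)\<^sup>2 - k * (((dist x a)\<^sup>2 - (dist x b)\<^sup>2) - (norm (b - a))\<^sup>2) + k * ((dist x a)\<^sup>2 - (dist x b)\<^sup>2)"
    by (simp only: q k dist_norm)
  also have "\<dots> = (dist x a)\<^sup>2"
    using k by (simp only: right_diff_distrib)
  finally show "dist (bisector_mirror a b x) b = dist x a"
    by (simp add: dist_norm)
qed

lemma bisector_mirror_mirror: "bisector_mirror a b (bisector_mirror a b x) = x"
proof (cases "a = b")
  case False
  then show ?thesis
    by (simp add: bisector_mirror_expand[of a b "bisector_mirror a b x"] dist_bisector_mirror)
      (simp add: bisector_mirror_expand diff_divide_distrib scaleR_left_diff_distrib)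
qed (simp add: bisector_mirror_def)

lemma orientation_preserving_isometry_bisector_mirror:
  assumes "orientation_preserving_isometry g"
  shows "bisector_mirror (g a) (g b) (g x) = g (bisector_mirror a b x)"
proof -
  obtain A c where A: "rotation_matrix A" "g = (\<lambda>x. A *v x + c)"
    using assms by (auto simp: orientation_preserving_isometry_def)
  then have "orthogonal_transformation ((*v) A)"
    by (auto simp: rotation_matrix_def orthogonal_transformation_matrix)
  then have n: "norm (A *v v) = norm v" for v
    by (rule orthogonal_transformation_norm)
  have d: "A *v (x - y) = A *v x - A *v y" for x y
    by (rule matrix_vector_mult_diff_distrib)
  have "g x - g y = A *v (x - y)" for x y
    by (simp add: A d)
  then have g: "dist (g x) (g y) = dist x y" for x y
    by (simp add: dist_norm n)
  show ?thesis
    unfolding bisector_mirror_expand g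
    by (simp add: A(2) d n flip: d) (simp add: d scaleR_matrix_vector_assoc[symmetric] matrix_vector_mult_scaleR)
qed

lemma continuous_on_bisector_mirror:
  "continuous_on {(a, b, x). a \<noteq> b} (\<lambda>(a, b, x). bisector_mirror a b x)"
  unfolding bisector_mirror_def case_prod_beta midpoint_def
  by (intro continuous_intros) auto

subsection \<open>The braid relation for recutting\<close>

text \<open>The coefficients of \<open>(\<lambda> + x) (\<lambda> + y) (\<lambda> + z)\<close> for imaginary quaternions \<open>x, y, z\<close>: the
  coefficient of \<open>\<lambda>\<close> is \<open>- quat_lin\<close> plus \<open>quat_lin_vec\<close>, the constant one is \<open>- quat_prod\<close> plus
  \<open>quat_prod_vec\<close>. That \<open>- z\<close> is a root of this polynomial is \<open>quat_root\<close> below.\<close>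

unbundle cross3_syntax

definition quat_lin :: "real^3 \<Rightarrow> real^3 \<Rightarrow> real^3 \<Rightarrow> real" where
  "quat_lin x y z = x \<bullet> y + x \<bullet> z + y \<bullet> z"

definition quat_lin_vec :: "real^3 \<Rightarrow> real^3 \<Rightarrow> real^3 \<Rightarrow> real^3" where
  "quat_lin_vec x y z = x \<times> y + x \<times> z + y \<times> z"

definition quat_prod :: "real^3 \<Rightarrow> real^3 \<Rightarrow> real^3 \<Rightarrow> real" where
  "quat_prod x y z = x \<bullet> (y \<times> z)"

definition quat_prod_vec :: "real^3 \<Rightarrow> real^3 \<Rightarrow> real^3 \<Rightarrow> real^3" where
  "quat_prod_vec x y z = (x \<bullet> z) *\<^sub>R y - (y \<bullet> z) *\<^sub>R x - (x \<bullet> y) *\<^sub>R z"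

text \<open>Scalar and vector part of the value at - z, with the powers of \<lambda> to the right of
  the coefficients. Because the square of z is - |z|^2, these equations are linear in z once |z| is
  known.\<close>

lemma quat_root:
  "quat_lin_vec x y z \<bullet> z = quat_prod x y z"
  "quat_lin_vec x y z \<times> z - (quat_lin x y z + z \<bullet> z) *\<^sub>R z = quat_prod_vec x y z - (z \<bullet> z) *\<^sub>R (x + y + z)"
  unfolding quat_lin_def quat_lin_vec_def quat_prod_def quat_prod_vec_def
  by (simp_all add: cross3_simps forall_3)

text \<open>If z and z' differ, then d solves the homogeneous version of the linear system in
  \<open>quat_root\<close>. Pairing it with d gives c = 0; then both products of \<open>?P\<close>
  with d vanish, so \<open>?P\<close> is zero. In quaternions this reads x y + x z + y z = |z|^2 = -
  z z, or x w = - w z with w = y + z. As w is nonzero, x and z would have the same norm.\<close>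

lemma quat_last_factor_unique:
  fixes x y z x' y' z' :: "real^3"
  assumes sum: "x + y + z = x' + y' + z'"
    and lin: "quat_lin x y z = quat_lin x' y' z'" "quat_lin_vec x y z = quat_lin_vec x' y' z'"
    and prod: "quat_prod x y z = quat_prod x' y' z'" "quat_prod_vec x y z = quat_prod_vec x' y' z'"
    and norm: "norm z = norm z'" "norm x \<noteq> norm z" "norm y \<noteq> norm z"
  shows "z = z'"
proof (rule ccontr)
  assume "z \<noteq> z'"
  define d where "d = z - z'"
  define c where "c = quat_lin x y z + z \<bullet> z"
  let ?P = "quat_lin_vec x y z"
  have d: "d \<noteq> 0"
    using \<open>z \<noteq> z'\<close> by (simp add: d_def)
  have zz: "z' \<bullet> z' = z \<bullet> z"
    using norm(1) by (simp add: norm_eq)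
  have "?P \<times> z - c *\<^sub>R z = ?P \<times> z' - c *\<^sub>R z'"
    using quat_root(2)[of x y z] quat_root(2)[of x' y' z'] by (simp add: sum lin prod zz c_def)
  then have 1: "?P \<times> d = c *\<^sub>R d"
    by (simp add: d_def Cross3.right_diff_distrib scaleR_right_diff_distrib algebra_simps)
  have 2: "?P \<bullet> d = 0"
    using quat_root(1)[of x y z] quat_root(1)[of x' y' z'] by (simp add: lin prod d_def inner_diff_right)
  have "c * (d \<bullet> d) = 0"
    using arg_cong[OF 1, of "\<lambda>v. v \<bullet> d"] by (simp add: dot_cross_self)
  then have c: "c = 0"
    using d by simp
  have "?P = 0"
    using norm_cross_dot[of ?P d] 1 2 c d by simp
  define w where "w = y + z"
  have w: "w \<noteq> 0"
    using norm(3) by (metis add_eq_0_iff norm_minus_cancel w_def)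
  have "(x - z) \<times> w = 0"
    using \<open>?P = 0\<close> by (simp add: quat_lin_vec_def w_def cross3_simps forall_3)
  moreover have *: "(x + z) \<bullet> w = 0"
    using c by (simp add: c_def quat_lin_def w_def inner_simps inner_commute)
  \<comment> \<open>The Binet-Cauchy identity replaces taking norms in x w = - w z.\<close>
  moreover have "((x - z) \<bullet> (x + z)) * (w \<bullet> w)
      = ((x - z) \<bullet> w) * ((x + z) \<bullet> w) + ((x - z) \<times> w) \<bullet> ((x + z) \<times> w)"
    by (simp add: cross3_simps)
  ultimately have "(x - z) \<bullet> (x + z) = 0"
    using w by simp
  then have "x \<bullet> x = z \<bullet> z"
    by (simp add: inner_simps inner_commute)
  then show False
    using norm(2) by (simp add: norm_eq)
qed

text \<open>The sum w of the factors is nonzero because their norms differ. Equal cross products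
  make the difference d parallel to w, and equal norms make it orthogonal to w.\<close>

lemma quat_factors_unique:
  fixes x y x' y' :: "real^3"
  assumes "x + y = x' + y'" "x \<times> y = x' \<times> y'" "norm x = norm x'" "norm y = norm y'"
    and "norm x \<noteq> norm y"
  shows "x = x' \<and> y = y'"
proof -
  define w d where "w = x + y" and "d = y' - y"
  have x: "x = w - y" "x' = w - y'" and y': "y' = y + d"
    using assms(1) by (simp_all add: w_def d_def algebra_simps)
  have "w \<noteq> 0"
    using assms(5) by (metis add_eq_0_iff norm_minus_cancel w_def)
  have "w \<times> d = 0"
    using assms(2) unfolding x d_def by (simp add: Cross3.left_diff_distrib Cross3.right_diff_distrib)
  moreover have "(w - y) \<bullet> (w - y) = (w - y') \<bullet> (w - y')" "y \<bullet> y = y' \<bullet> y'"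
    using assms(3,4) unfolding x by (simp_all only: norm_eq)
  then have "w \<bullet> d = 0"
    by (simp add: d_def inner_simps inner_commute)
  ultimately have "d = 0"
    using norm_cross_dot[of w d] \<open>w \<noteq> 0\<close> by simp
  then show ?thesis
    using x by (simp add: d_def)
qed

text \<open>The vertex moves by a multiple of b - a, the sum of the two edges, which leaves their
  cross product unchanged. Their inner product is determined by the sum and the two norms, and the
  norms only trade places. Together the two products are the quaternion product of the
  edges.\<close>

lemma bisector_mirror_cross:
  fixes a b p :: "real^3"
  defines "q \<equiv> bisector_mirror a b p"
  assumes ne: "norm (p - a) \<noteq> norm (b - p)"
  shows "(q - a) \<times> (b - q) = (p - a) \<times> (b - p)" "(q - a) \<bullet> (b - q) = (p - a) \<bullet> (b - p)"
    "norm (q - a) = norm (b - p)" "norm (b - q) = norm (p - a)"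
proof -
  obtain k where q: "q = p - k *\<^sub>R (b - a)"
    using that unfolding q_def bisector_mirror_def by blast
  have "a \<noteq> b"
    using ne by (auto simp: norm_minus_commute)
  show "(q - a) \<times> (b - q) = (p - a) \<times> (b - p)"
    unfolding q by (simp add: cross3_simps forall_3)
  show n: "norm (q - a) = norm (b - p)" "norm (b - q) = norm (p - a)"
    using dist_bisector_mirror[OF \<open>a \<noteq> b\<close>, of p] by (simp_all add: q_def dist_norm norm_minus_commute)
  have "2 * ((r - a) \<bullet> (b - r)) = (norm (b - a))\<^sup>2 - (norm (r - a))\<^sup>2 - (norm (b - r))\<^sup>2" for r
    by (simp add: power2_norm_eq_inner inner_simps inner_commute algebra_simps)
  from this[of q] this[of p] show "(q - a) \<bullet> (b - q) = (p - a) \<bullet> (b - p)"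
    using n by simp
qed

text \<open>A predicate on the dimension, so that linkages in the plane and in space can share one
  locale. The points q arise from swaps at the second, third and second vertex, the points r from
  swaps at the third, second and third one.\<close>

definition mirror_braid :: "'d::finite itself \<Rightarrow> bool" where
  "mirror_braid _ \<longleftrightarrow> (\<forall>p0 p1 p2 p3 :: real^'d.
     dist p0 p1 \<noteq> dist p1 p2 \<longrightarrow> dist p1 p2 \<noteq> dist p2 p3 \<longrightarrow> dist p0 p1 \<noteq> dist p2 p3 \<longrightarrow>
     (let q1 = bisector_mirror p0 p2 p1; q2 = bisector_mirror q1 p3 p2; q3 = bisector_mirror p0 q2 q1;
          r2 = bisector_mirror p1 p3 p2; r1 = bisector_mirror p0 r2 p1; r3 = bisector_mirror r1 p3 r2
      in q3 = r1 \<and> q2 = r3))"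

lemma mirror_braid_3: "mirror_braid TYPE(3)"
  unfolding mirror_braid_def Let_def
proof (intro allI impI)
  fix p0 p1 p2 p3 :: "real^3"
  assume ne: "dist p0 p1 \<noteq> dist p1 p2" "dist p1 p2 \<noteq> dist p2 p3" "dist p0 p1 \<noteq> dist p2 p3"
  define q1 where "q1 = bisector_mirror p0 p2 p1"
  define q2 where "q2 = bisector_mirror q1 p3 p2"
  define q3 where "q3 = bisector_mirror p0 q2 q1"
  define r2 where "r2 = bisector_mirror p1 p3 p2"
  define r1 where "r1 = bisector_mirror p0 r2 p1"
  define r3 where "r3 = bisector_mirror r1 p3 r2"
  define \<alpha> \<beta> \<gamma> where "\<alpha> = norm (p1 - p0)" and "\<beta> = norm (p2 - p1)" and "\<gamma> = norm (p3 - p2)"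
  have abc: "\<alpha> \<noteq> \<beta>" "\<beta> \<noteq> \<gamma>" "\<alpha> \<noteq> \<gamma>"
    using ne by (simp_all add: \<alpha>_def \<beta>_def \<gamma>_def dist_norm norm_minus_commute)
  note mir = bisector_mirror_cross
  note q1 = mir[where p = p1 and a = p0 and b = p2, OF abc(1)[unfolded \<alpha>_def \<beta>_def], folded q1_def]
  note r2 = mir[where p = p2 and a = p1 and b = p3, OF abc(2)[unfolded \<beta>_def \<gamma>_def], folded r2_def]
  have "norm (p2 - q1) \<noteq> norm (p3 - p2)" "norm (p1 - p0) \<noteq> norm (r2 - p1)"
    using abc(3) by (simp_all add: q1 r2 \<alpha>_def \<gamma>_def)
  note q2 = mir[where p = p2 and a = q1 and b = p3, OF this(1), folded q2_def]
    and r1 = mir[where p = p1 and a = p0 and b = r2, OF this(2), folded r1_def]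
  have "norm (q1 - p0) \<noteq> norm (q2 - q1)" "norm (r2 - r1) \<noteq> norm (p3 - r2)"
    using abc(1,2) by (simp_all add: q1 q2 r1 r2 \<alpha>_def \<beta>_def \<gamma>_def)
  note q3 = mir[where p = q1 and a = p0 and b = q2, OF this(1), folded q3_def]
    and r3 = mir[where p = r2 and a = r1 and b = p3, OF this(2), folded r3_def]
  have n: "norm (q3 - p0) = \<gamma>" "norm (q2 - q3) = \<beta>" "norm (p3 - q2) = \<alpha>"
    "norm (r1 - p0) = \<gamma>" "norm (r3 - r1) = \<beta>" "norm (p3 - r3) = \<alpha>"
    by (simp_all add: q1 q2 q3 r1 r2 r3 \<alpha>_def \<beta>_def \<gamma>_def)
  \<comment> \<open>The coefficients of the polynomial. By \<open>L\<close> and \<open>R\<close>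
    they depend on two neighbouring factors only through the sum and the product of these, so they
    survive each of the six swaps.\<close>
  define fac where "fac x y z = (x + y + z, quat_lin x y z, quat_lin_vec x y z, quat_prod x y z, quat_prod_vec x y z)"
    for x y z
  have L: "fac x y z = fac x' y' z" if "x + y = x' + y'" "x \<bullet> y = x' \<bullet> y'" "x \<times> y = x' \<times> y'" for x y x' y' z
  proof -
    have "fac x y z = (x + y + z, x \<bullet> y + (x + y) \<bullet> z, x \<times> y + (x + y) \<times> z, (x \<times> y) \<bullet> z,
        (x \<times> y) \<times> z - (x \<bullet> y) *\<^sub>R z)" for x y
      unfolding fac_def quat_lin_def quat_lin_vec_def quat_prod_def quat_prod_vec_def
      by (simp add: cross3_simps forall_3)
    then show ?thesis
      using that by simp
  qed
  have R: "fac x y z = fac x y' z'" if "y + z = y' + z'" "y \<bullet> z = y' \<bullet> z'" "y \<times> z = y' \<times> z'" for x y z y' z'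
  proof -
    have "fac x y z = (x + (y + z), y \<bullet> z + x \<bullet> (y + z), y \<times> z + x \<times> (y + z), x \<bullet> (y \<times> z),
        x \<times> (y \<times> z) - (y \<bullet> z) *\<^sub>R x)" for y z
      unfolding fac_def quat_lin_def quat_lin_vec_def quat_prod_def quat_prod_vec_def
      by (simp add: cross3_simps forall_3)
    then show ?thesis
      using that by simp
  qed
  have "fac (q3 - p0) (q2 - q3) (p3 - q2) = fac (q1 - p0) (q2 - q1) (p3 - q2)"
    by (intro L q3) simp
  also have "\<dots> = fac (q1 - p0) (p2 - q1) (p3 - p2)"
    by (intro R q2) simp
  also have "\<dots> = fac (p1 - p0) (p2 - p1) (p3 - p2)"
    by (intro L q1) simp
  also have "\<dots> = fac (p1 - p0) (r2 - p1) (p3 - r2)"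
    by (intro R r2[symmetric]) simp
  also have "\<dots> = fac (r1 - p0) (r2 - r1) (p3 - r2)"
    by (intro L r1[symmetric]) simp
  also have "\<dots> = fac (r1 - p0) (r3 - r1) (p3 - r3)"
    by (intro R r3[symmetric]) simp
  finally have *: "fac (q3 - p0) (q2 - q3) (p3 - q2) = fac (r1 - p0) (r3 - r1) (p3 - r3)" .
  note e = *[unfolded fac_def prod.inject]
  have z: "p3 - q2 = p3 - r3"
    by (rule quat_last_factor_unique[OF e[THEN conjunct1] e[THEN conjunct2, THEN conjunct1]
          e[THEN conjunct2, THEN conjunct2, THEN conjunct1]
          e[THEN conjunct2, THEN conjunct2, THEN conjunct2, THEN conjunct1]
          e[THEN conjunct2, THEN conjunct2, THEN conjunct2, THEN conjunct2]])
      (use abc in \<open>simp_all only: n not_False_eq_True\<close>)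
  have "q3 - p0 = r1 - p0 \<and> q2 - q3 = r3 - r1"
  proof (rule quat_factors_unique)
    \<comment> \<open>Once the last factors agree, the vector part of the linear coefficient yields
      the cross product of the first two.\<close>
    have *: "quat_lin_vec x y z = x \<times> y + (x + y) \<times> z" for x y z
      by (simp add: quat_lin_vec_def cross_add_left)
    show "(q3 - p0) \<times> (q2 - q3) = (r1 - p0) \<times> (r3 - r1)"
      using e[THEN conjunct2, THEN conjunct2, THEN conjunct1] z unfolding * by simp
  qed (use z n abc in auto)
  with z show "q3 = r1 \<and> q2 = r3"
    by simp
qed

text \<open>Mirroring points of a coordinate plane of space stays in that plane and agrees with
  planar mirroring (\<open>mir\<close>), so the planar case is contained in the spatial one.\<close>

lemma mirror_braid_2: "mirror_braid TYPE(2)"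
proof -
  define E :: "real^2 \<Rightarrow> real^3" where "E x = vector [x $ 1, x $ 2, 0]" for x
  have diff: "E x - E y = E (x - y)" and scale: "c *\<^sub>R E x = E (c *\<^sub>R x)" for x y c
    by (simp_all add: E_def vec_eq_iff forall_3)
  have norm: "norm (E x) = norm x" for x
    by (simp add: E_def norm_vec_def L2_set_def sum_2 sum_3)
  have dist: "dist (E x) (E y) = dist x y" for x y
    by (simp add: dist_norm diff norm)
  have mir: "bisector_mirror (E a) (E b) (E x) = E (bisector_mirror a b x)" for a b x
    by (simp add: bisector_mirror_expand dist diff norm scale)
  have inj: "E x = E y \<longleftrightarrow> x = y" for x y
    using dist[of x y] by (metis dist_eq_0_iff)
  show ?thesis
    unfolding mirror_braid_def
  proof (intro allI impI)
    fix p0 p1 p2 p3 :: "real^2"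
    assume "dist p0 p1 \<noteq> dist p1 p2" "dist p1 p2 \<noteq> dist p2 p3" "dist p0 p1 \<noteq> dist p2 p3"
    then have "dist (E p0) (E p1) \<noteq> dist (E p1) (E p2)" "dist (E p1) (E p2) \<noteq> dist (E p2) (E p3)"
      "dist (E p0) (E p1) \<noteq> dist (E p2) (E p3)"
      by (simp_all only: dist not_False_eq_True)
    from mirror_braid_3[unfolded mirror_braid_def, rule_format, OF this]
    show "let q1 = bisector_mirror p0 p2 p1; q2 = bisector_mirror q1 p3 p2; q3 = bisector_mirror p0 q2 q1;
          r2 = bisector_mirror p1 p3 p2; r1 = bisector_mirror p0 r2 p1; r3 = bisector_mirror r1 p3 r2
      in q3 = r1 \<and> q2 = r3"
      unfolding mir inj Let_def .
  qed
qed

unbundle no cross3_syntax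

section \<open>The group of relations\<close>

declare One_nat_def [simp del]

lemma cyc_succ_in: "n \<ge> 1 \<Longrightarrow> i \<in> {1..n} \<Longrightarrow> cyc_succ n i \<in> {1..n}"
  and cyc_pred_in: "n \<ge> 1 \<Longrightarrow> i \<in> {1..n} \<Longrightarrow> cyc_pred n i \<in> {1..n}"
  and cyc_pred_succ: "i \<in> {1..n} \<Longrightarrow> cyc_pred n (cyc_succ n i) = i"
  and cyc_succ_pred: "i \<in> {1..n} \<Longrightarrow> cyc_succ n (cyc_pred n i) = i"
  by (auto simp: cyc_succ_def cyc_pred_def)

lemma edge_transposition_in_sym_group:
  assumes "i \<in> {1..n}"
  shows "edge_transposition n i \<in> carrier (sym_group n)"
  using assms cyc_pred_in[of n i]
  by (auto simp: edge_transposition_def sym_group_carrier intro!: permutes_swap_id)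

lemma edge_transposition_twice: "edge_transposition n i \<circ> edge_transposition n i = id"
  by (simp add: edge_transposition_def)

lemma inv_edge_transposition:
  assumes "i \<in> {1..n}"
  shows "inv\<^bsub>sym_group n\<^esub> edge_transposition n i = edge_transposition n i"
  using edge_transposition_in_sym_group[OF assms] edge_transposition_twice[of n i]
  by (intro group.inv_equality[OF sym_group_is_group]) (simp_all add: sym_group_mult sym_group_one)

lemma edge_transposition_commute:
  assumes "i \<in> {1..n}" "j \<in> {1..n}" "\<not> cyc_adjacent n i j"
  shows "edge_transposition n i \<circ> edge_transposition n j = edge_transposition n j \<circ> edge_transposition n i"
proof (cases "i = j")
  case False
  then have "cyc_pred n i \<noteq> j" "cyc_pred n j \<noteq> i" "cyc_pred n i \<noteq> cyc_pred n j"
    using assms cyc_succ_pred[OF assms(1)] cyc_succ_pred[OF assms(2)]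
    by (auto simp: cyc_adjacent_def)
  with False show ?thesis
    by (auto simp: edge_transposition_def fun_eq_iff Transposition.transpose_def)
qed simp

lemma edge_transposition_braid:
  assumes "n \<ge> 3" "i \<in> {1..n}"
  shows "edge_transposition n i \<circ> edge_transposition n (cyc_succ n i) \<circ> edge_transposition n i
    = edge_transposition n (cyc_succ n i) \<circ> edge_transposition n i \<circ> edge_transposition n (cyc_succ n i)"
proof -
  have "cyc_pred n i \<noteq> i" "cyc_succ n i \<noteq> i" "cyc_pred n i \<noteq> cyc_succ n i"
    using assms by (auto simp: cyc_pred_def cyc_succ_def)
  then show ?thesis
    by (auto simp: edge_transposition_def cyc_pred_succ[OF assms(2)] fun_eq_iff Transposition.transpose_def)
qed

lemma perm_of_hom: "perm_of n \<in> hom (FG n) (sym_group n)"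
  unfolding perm_of_def
  by (rule free_lift_hom[OF sym_group_is_group]) (auto simp: edge_transposition_in_sym_group)

lemma group_hom_perm_of: "group_hom (FG n) (sym_group n) (perm_of n)"
  by (simp add: group_hom_def group_hom_axioms_def group_free_group sym_group_is_group perm_of_hom)

lemma FG0_normal: "carrier (FG0 n) \<lhd> FG n"
  unfolding FG0_def using group_hom.normal_kernel[OF group_hom_perm_of] by simp

lemma FG0_carrier: "w \<in> carrier (FG0 n) \<longleftrightarrow> w \<in> carrier (FG n) \<and> perm_of n w = id"
  by (simp add: FG0_def kernel_def sym_group_one)

definition swap_relators :: "nat \<Rightarrow> nat word set" where
  "swap_relators n =
     {gen i \<otimes>\<^bsub>FG n\<^esub> gen i | i. i \<in> {1..n}}
      \<union> {gen i \<otimes>\<^bsub>FG n\<^esub> gen j \<otimes>\<^bsub>FG n\<^esub> inv\<^bsub>FG n\<^esub> gen i \<otimes>\<^bsub>FG n\<^esub> inv\<^bsub>FG n\<^esub> gen j | i j.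
           i \<in> {1..n} \<and> j \<in> {1..n} \<and> i \<noteq> j \<and> \<not> cyc_adjacent n i j}
      \<union> {gen i \<otimes>\<^bsub>FG n\<^esub> gen (cyc_succ n i) \<otimes>\<^bsub>FG n\<^esub> gen i
           \<otimes>\<^bsub>FG n\<^esub> inv\<^bsub>FG n\<^esub> gen (cyc_succ n i) \<otimes>\<^bsub>FG n\<^esub> inv\<^bsub>FG n\<^esub> gen i
           \<otimes>\<^bsub>FG n\<^esub> inv\<^bsub>FG n\<^esub> gen (cyc_succ n i) | i. i \<in> {1..n}}"

lemma swap_relations_eq: "swap_relations n = normal_closure (FG n) (swap_relators n)"
  by (simp add: swap_relations_def swap_relators_def)

lemma swap_relators_carrier: "swap_relators n \<subseteq> carrier (FG n)"
proof -
  interpret F: group "FG n" by (rule group_free_group)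
  have "gen i \<in> carrier (FG n)" if "i \<in> {1..n}" for i
    using that by (rule gen_in_free_group)
  moreover have "cyc_succ n i \<in> {1..n}" if "i \<in> {1..n}" for i
    using that cyc_succ_in[of n i] by auto
  ultimately show ?thesis
    unfolding swap_relators_def by (auto intro!: F.m_closed F.inv_closed simp del: atLeastAtMost_iff)
qed

lemma swap_relations_normal: "swap_relations n \<lhd> FG n"
  unfolding swap_relations_eq using group.normal_closure_normal[OF group_free_group swap_relators_carrier] .

lemma (in group) relator_eq_one_iff:
  assumes "x \<in> carrier G" "y \<in> carrier G"
  shows "x \<otimes> y \<otimes> inv x \<otimes> inv y = \<one> \<longleftrightarrow> x \<otimes> y = y \<otimes> x"
    "x \<otimes> y \<otimes> x \<otimes> inv y \<otimes> inv x \<otimes> inv y = \<one> \<longleftrightarrow> x \<otimes> y \<otimes> x = y \<otimes> x \<otimes> y"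
proof -
  have "x \<otimes> y \<otimes> inv x \<otimes> inv y = (x \<otimes> y) \<otimes> inv (y \<otimes> x)"
    "x \<otimes> y \<otimes> x \<otimes> inv y \<otimes> inv x \<otimes> inv y = (x \<otimes> y \<otimes> x) \<otimes> inv (y \<otimes> x \<otimes> y)"
    using assms by (simp_all add: inv_mult_group m_assoc)
  moreover have "a \<otimes> inv b = \<one> \<longleftrightarrow> a = b" if "a \<in> carrier G" "b \<in> carrier G" for a b
    using that by (metis inv_solve_right l_one one_closed)
  ultimately show "x \<otimes> y \<otimes> inv x \<otimes> inv y = \<one> \<longleftrightarrow> x \<otimes> y = y \<otimes> x"
    "x \<otimes> y \<otimes> x \<otimes> inv y \<otimes> inv x \<otimes> inv y = \<one> \<longleftrightarrow> x \<otimes> y \<otimes> x = y \<otimes> x \<otimes> y"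
    using assms by simp_all
qed

text \<open>The universal property of the quotient by R, in the form in which everything is checked
  on generators. It serves for the edge permutations, the swaps, the strand ends and the quotient of
  the braid group by the squares.\<close>

lemma swap_relations_subset_kernel:
  assumes h: "group_hom (FG n) H h" and n: "n \<ge> 1"
    and square: "\<And>i. i \<in> {1..n} \<Longrightarrow> h (gen i) \<otimes>\<^bsub>H\<^esub> h (gen i) = \<one>\<^bsub>H\<^esub>"
    and commute: "\<And>i j. i \<in> {1..n} \<Longrightarrow> j \<in> {1..n} \<Longrightarrow> \<not> cyc_adjacent n i j \<Longrightarrow>
      h (gen i) \<otimes>\<^bsub>H\<^esub> h (gen j) = h (gen j) \<otimes>\<^bsub>H\<^esub> h (gen i)"
    and braid: "\<And>i. i \<in> {1..n} \<Longrightarrow>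
      h (gen i) \<otimes>\<^bsub>H\<^esub> h (gen (cyc_succ n i)) \<otimes>\<^bsub>H\<^esub> h (gen i)
        = h (gen (cyc_succ n i)) \<otimes>\<^bsub>H\<^esub> h (gen i) \<otimes>\<^bsub>H\<^esub> h (gen (cyc_succ n i))"
  shows "swap_relations n \<subseteq> kernel (FG n) H h"
  unfolding swap_relations_eq
proof (rule group.normal_closure_minimal[OF group_free_group])
  interpret group_hom "FG n" H h by fact
  note g = gen_in_free_group
  have m: "gen i \<otimes>\<^bsub>FG n\<^esub> gen i \<in> kernel (FG n) H h" if "i \<in> {1..n}" for i
    using that square[OF that] g[OF that] by (simp add: kernel_def)
  have c: "gen i \<otimes>\<^bsub>FG n\<^esub> gen j \<otimes>\<^bsub>FG n\<^esub> inv\<^bsub>FG n\<^esub> gen i \<otimes>\<^bsub>FG n\<^esub> inv\<^bsub>FG n\<^esub> gen j \<in> kernel (FG n) H h"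
    if "i \<in> {1..n}" "j \<in> {1..n}" "\<not> cyc_adjacent n i j" for i j
    using H.relator_eq_one_iff(1)[THEN iffD2, OF _ _ commute[OF that]] g[OF that(1)] g[OF that(2)]
    by (simp add: kernel_def)
  have b: "gen i \<otimes>\<^bsub>FG n\<^esub> gen j \<otimes>\<^bsub>FG n\<^esub> gen i
           \<otimes>\<^bsub>FG n\<^esub> inv\<^bsub>FG n\<^esub> gen j \<otimes>\<^bsub>FG n\<^esub> inv\<^bsub>FG n\<^esub> gen i
           \<otimes>\<^bsub>FG n\<^esub> inv\<^bsub>FG n\<^esub> gen j \<in> kernel (FG n) H h"
    if i: "i \<in> {1..n}" "j = cyc_succ n i" for i j
    using H.relator_eq_one_iff(2)[THEN iffD2, OF _ _ braid[OF i(1)]] g[OF i(1)]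
      g[OF cyc_succ_in[OF n i(1)]] i(2)
    by (simp add: kernel_def)
  show "swap_relators n \<subseteq> kernel (FG n) H h"
    using m c b unfolding swap_relators_def by blast
  show "kernel (FG n) H h \<lhd> FG n"
    by (rule normal_kernel)
qed

lemma relation_in_swap_relations:
  shows "i \<in> {1..n} \<Longrightarrow> gen i \<otimes>\<^bsub>FG n\<^esub> gen i \<in> swap_relations n"
    and "i \<in> {1..n} \<Longrightarrow> j \<in> {1..n} \<Longrightarrow> i \<noteq> j \<Longrightarrow> \<not> cyc_adjacent n i j \<Longrightarrow>
      gen i \<otimes>\<^bsub>FG n\<^esub> gen j \<otimes>\<^bsub>FG n\<^esub> inv\<^bsub>FG n\<^esub> gen i \<otimes>\<^bsub>FG n\<^esub> inv\<^bsub>FG n\<^esub> gen j \<in> swap_relations n"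
    and "i \<in> {1..n} \<Longrightarrow> gen i \<otimes>\<^bsub>FG n\<^esub> gen (cyc_succ n i) \<otimes>\<^bsub>FG n\<^esub> gen i
           \<otimes>\<^bsub>FG n\<^esub> inv\<^bsub>FG n\<^esub> gen (cyc_succ n i) \<otimes>\<^bsub>FG n\<^esub> inv\<^bsub>FG n\<^esub> gen i
           \<otimes>\<^bsub>FG n\<^esub> inv\<^bsub>FG n\<^esub> gen (cyc_succ n i) \<in> swap_relations n"
  unfolding swap_relations_eq
  by (rule subsetD[OF group.normal_closure_incl[OF group_free_group swap_relators_carrier]];
      unfold swap_relators_def; blast)+

lemma swap_relations_subset_FG0:
  assumes "n \<ge> 3"
  shows "swap_relations n \<subseteq> carrier (FG0 n)"
proof -
  have p: "perm_of n (gen i) = edge_transposition n i" if "i \<in> {1..n}" for i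
    unfolding perm_of_def using that
    by (intro free_lift_gen sym_group_is_group edge_transposition_in_sym_group)
  have c: "cyc_succ n i \<in> {1..n}" if "i \<in> {1..n}" for i
    using that cyc_succ_in[of n i] by auto
  have "swap_relations n \<subseteq> kernel (FG n) (sym_group n) (perm_of n)"
  proof (rule swap_relations_subset_kernel[OF group_hom_perm_of])
    show "n \<ge> 1"
      using assms by simp
  qed (simp_all only: p c sym_group_mult sym_group_one edge_transposition_twice
      edge_transposition_braid[OF assms], rule edge_transposition_commute)
  then show ?thesis
    by (simp add: FG0_def)
qed

section \<open>Swaps on moduli spaces\<close>

lemma orientation_preserving_isometry_dist:
  assumes "orientation_preserving_isometry g"
  shows "dist (g x) (g y) = dist x y"
proof -
  obtain A c where A: "rotation_matrix A" "g = (\<lambda>x. A *v x + c)"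
    using assms by (auto simp: orientation_preserving_isometry_def)
  then have "orthogonal_transformation ((*v) A)"
    by (auto simp: rotation_matrix_def orthogonal_transformation_matrix)
  then have "norm (A *v (x - y)) = norm (x - y)"
    by (rule orthogonal_transformation_norm)
  then show ?thesis
    by (simp add: A dist_norm matrix_vector_mult_diff_distrib)
qed

text \<open>In contrast to \<open>congruence\<close> this does not mention the lengths, so a class
  and its image under a swap, which belong to different lengths, have the same description.\<close>

definition isometry_orbit :: "nat \<Rightarrow> (nat \<Rightarrow> real ^ 'd) \<Rightarrow> (nat \<Rightarrow> real ^ 'd) set" where
  "isometry_orbit n P = (\<lambda>g. restrict (g \<circ> P) {1..n}) ` {g. orientation_preserving_isometry g}"

lemma congruence_class:
  assumes "n \<ge> 1" "P \<in> configurations n M"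
  shows "congruence n M `` {P} = isometry_orbit n P"
proof -
  have "restrict (g \<circ> P) {1..n} \<in> configurations n M" if "orientation_preserving_isometry g" for g
    using assms(2) cyc_succ_in[OF assms(1)] orientation_preserving_isometry_dist[OF that]
    by (auto simp: configurations_def)
  then show ?thesis
    using assms(2) by (auto simp: congruence_def isometry_orbit_def)
qed

lemma moduli_space_orbit:
  assumes "n \<ge> 1"
  shows "moduli_space n M = isometry_orbit n ` configurations n M"
  using congruence_class[OF assms] by (auto simp: moduli_space_def quotient_def image_iff)

lemma quotient_map_orbit:
  assumes "n \<ge> 1"
  shows "quotient_map (subtopology (product_topology (\<lambda>_. euclidean) {1..n}) (configurations n M))
    (moduli_topology n M) (isometry_orbit n :: (nat \<Rightarrow> real ^ 'd) \<Rightarrow> _)"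
proof -
  let ?Y = "subtopology (product_topology (\<lambda>_. euclidean) {1..n}) (configurations n M)
    :: (nat \<Rightarrow> real ^ 'd) topology"
  have Y: "topspace ?Y = configurations n M"
    by (auto simp: configurations_def)
  have "{x \<in> configurations n M. congruence n M `` {x} \<in> U} = {x \<in> configurations n M. isometry_orbit n x \<in> U}"
    for U :: "(nat \<Rightarrow> real ^ 'd) set set"
    by (rule Collect_cong) (simp add: congruence_class[OF assms] cong: conj_cong)
  then show ?thesis
    unfolding quotient_map_def topspace_moduli_topology moduli_space_orbit[OF assms] Y
    unfolding moduli_topology_def openin_quotient_topology Y
    by (simp only: congruence_class[OF assms] cong: image_cong) blast
qed

text \<open>\<open>d\<close> carries the dimension as a type. The dimension matters only through
  \<open>mirror_braid\<close>.\<close>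

locale linkage =
  fixes n :: nat and L :: "nat \<Rightarrow> real" and d :: "'d::finite itself"
  assumes n: "n \<ge> 3" and inj: "inj_on L {1..n}" and braid: "mirror_braid TYPE('d)"
begin

lemma n1: "n \<ge> 1"
  using n by simp

lemma neighbours:
  assumes "i \<in> {1..n}"
  shows "cyc_pred n i \<in> {1..n}" "cyc_succ n i \<in> {1..n}" "cyc_pred n i \<noteq> i" "cyc_succ n i \<noteq> i"
    "cyc_pred n i \<noteq> cyc_succ n i"
  using assms n by (auto simp: cyc_pred_def cyc_succ_def)

lemma cyc_pred_eq_iff: "i \<in> {1..n} \<Longrightarrow> j \<in> {1..n} \<Longrightarrow> cyc_pred n i = j \<longleftrightarrow> i = cyc_succ n j"
  using cyc_succ_pred cyc_pred_succ by metis

lemma configuration_dist: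
  "P \<in> configurations n M \<Longrightarrow> i \<in> {1..n} \<Longrightarrow> dist (P i) (P (cyc_succ n i)) = M i"
  by (simp add: configurations_def)

lemma configuration_dist_pred:
  "P \<in> configurations n M \<Longrightarrow> i \<in> {1..n} \<Longrightarrow> dist (P (cyc_pred n i)) (P i) = M (cyc_pred n i)"
  using configuration_dist[of P M "cyc_pred n i"] neighbours cyc_succ_pred[of i n] by simp

text \<open>Otherwise the two edges at the vertex would have equal lengths. So the mirror is always
  a genuine reflection that depends continuously on the configuration.\<close>

lemma neighbours_distinct:
  assumes "P \<in> configurations n M" "inj_on M {1..n}" "i \<in> {1..n}"
  shows "P (cyc_pred n i) \<noteq> P (cyc_succ n i)"
proof
  assume eq: "P (cyc_pred n i) = P (cyc_succ n i)"
  have "M (cyc_pred n i) = M i"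
    using configuration_dist[OF assms(1,3)] configuration_dist_pred[OF assms(1,3)]
    by (simp add: eq dist_commute)
  then show False
    using neighbours[OF assms(3)] assms(2,3) by (metis inj_onD)
qed

lemma swap_configuration:
  assumes P: "P \<in> configurations n M" and M: "inj_on M {1..n}" and i: "i \<in> {1..n}"
  shows "swap n i P \<in> configurations n (M \<circ> edge_transposition n i)"
proof -
  note ne = neighbours[OF i]
  note mir = dist_bisector_mirror[OF neighbours_distinct[OF assms], of "P i"]
  have "dist (swap n i P k) (swap n i P (cyc_succ n k)) = M (edge_transposition n i k)"
    if k: "k \<in> {1..n}" for k
  proof -
    consider "k = i" | "k = cyc_pred n i" | "k \<noteq> i" "k \<noteq> cyc_pred n i"
      by blast
    then show ?thesis
    proof cases
      case 1
      then show ?thesis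
        using ne mir(2) configuration_dist_pred[OF P i]
        by (simp add: swap_def edge_transposition_def dist_commute)
    next
      case 2
      then show ?thesis
        using ne mir(1) configuration_dist[OF P i] cyc_succ_pred[OF i]
        by (simp add: swap_def edge_transposition_def dist_commute)
    next
      case 3
      then have "cyc_succ n k \<noteq> i"
        using k cyc_pred_succ by metis
      then show ?thesis
        using 3 configuration_dist[OF P k] by (simp add: swap_def edge_transposition_def)
    qed
  qed
  moreover have "swap n i P \<in> {1..n} \<rightarrow>\<^sub>E UNIV"
    using P i by (auto simp: configurations_def swap_def PiE_def extensional_def)
  ultimately show ?thesis
    by (simp add: configurations_def)
qed

lemma swap_swap: "i \<in> {1..n} \<Longrightarrow> swap n i (swap n i P) = P"
  using neighbours[of i] by (simp add: swap_def bisector_mirror_mirror)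

lemma swap_commute:
  assumes "i \<in> {1..n}" "j \<in> {1..n}" "\<not> cyc_adjacent n i j"
  shows "swap n i (swap n j P) = swap n j (swap n i P)"
proof (cases "i = j")
  case False
  have "cyc_pred n i \<noteq> j" "cyc_succ n i \<noteq> j" "cyc_pred n j \<noteq> i" "cyc_succ n j \<noteq> i"
    using assms by (auto simp: cyc_adjacent_def cyc_pred_eq_iff)
  with False show ?thesis
    by (simp add: swap_def fun_upd_twist)
qed simp

text \<open>Of four consecutive vertices only the middle two move. For n = 3 the outer two are the
  same vertex, which \<open>mirror_braid\<close> permits.\<close>

lemma swap_braid:
  fixes P :: "nat \<Rightarrow> real ^ 'd"
  assumes P: "P \<in> configurations n M" and M: "inj_on M {1..n}" and i: "i \<in> {1..n}"
  defines "j \<equiv> cyc_succ n i"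
  shows "swap n i (swap n j (swap n i P)) = swap n j (swap n i (swap n j P))"
proof -
  have j: "j \<in> {1..n}" "cyc_pred n j = i" "cyc_succ n j \<noteq> i" "cyc_pred n i \<noteq> j"
    using neighbours(2,5)[OF i] cyc_pred_succ[OF i] i n by (simp_all add: j_def) (simp add: cyc_succ_def)
  note ne = neighbours[OF i] neighbours[OF j(1)]
  have "dist (P (cyc_pred n i)) (P i) \<noteq> dist (P i) (P j)" "dist (P i) (P j) \<noteq> dist (P j) (P (cyc_succ n j))"
      "dist (P (cyc_pred n i)) (P i) \<noteq> dist (P j) (P (cyc_succ n j))"
    using inj_on_eq_iff[OF M] configuration_dist[OF P i, folded j_def] configuration_dist_pred[OF P i]
      configuration_dist[OF P j(1)] i j ne by (simp_all flip: j_def)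
  note B = braid[unfolded mirror_braid_def Let_def, rule_format, OF this]
  have v: "swap n i P i = bisector_mirror (P (cyc_pred n i)) (P j) (P i)"
    "swap n j (swap n i P) j = bisector_mirror (swap n i P i) (P (cyc_succ n j)) (P j)"
    "swap n j P j = bisector_mirror (P i) (P (cyc_succ n j)) (P j)"
    "swap n i (swap n j P) i = bisector_mirror (P (cyc_pred n i)) (swap n j P j) (P i)"
    "swap n j (swap n i (swap n j P)) j = bisector_mirror (swap n i (swap n j P) i) (P (cyc_succ n j)) (swap n j P j)"
    using j ne by (simp_all add: swap_def flip: j_def)
  have "bisector_mirror (P (cyc_pred n i)) (swap n j (swap n i P) j) (swap n i P i) = swap n i (swap n j P) i"
    unfolding v by (rule B[THEN conjunct1])
  moreover have "swap n j (swap n i P) j = swap n j (swap n i (swap n j P)) j"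
    unfolding v by (rule B[THEN conjunct2])
  moreover have "swap n i (swap n j (swap n i P))
      = P(i := bisector_mirror (P (cyc_pred n i)) (swap n j (swap n i P) j) (swap n i P i),
          j := swap n j (swap n i P) j)"
    using j ne by (auto simp: swap_def fun_eq_iff simp flip: j_def)
  moreover have "swap n j (swap n i (swap n j P))
      = P(i := swap n i (swap n j P) i, j := swap n j (swap n i (swap n j P)) j)"
    using j ne by (auto simp: swap_def fun_eq_iff simp flip: j_def)
  ultimately show ?thesis
    by (simp only:)
qed

lemma swap_orbit:
  assumes "i \<in> {1..n}"
  shows "swap n i ` isometry_orbit n P = isometry_orbit n (swap n i P)"
proof -
  have "swap n i (restrict (g \<circ> P) {1..n}) = restrict (g \<circ> swap n i P) {1..n}"
    if "orientation_preserving_isometry g" for g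
    using assms neighbours[OF assms] orientation_preserving_isometry_bisector_mirror[OF that]
    by (auto simp: swap_def fun_eq_iff)
  then show ?thesis
    by (force simp: isometry_orbit_def image_image)
qed

lemma swap_moduli_space:
  fixes c :: "(nat \<Rightarrow> real ^ 'd) set"
  assumes "c \<in> moduli_space n M" "inj_on M {1..n}" "i \<in> {1..n}"
  shows "swap n i ` c \<in> moduli_space n (M \<circ> edge_transposition n i)"
proof -
  obtain P where P: "P \<in> configurations n M" "c = isometry_orbit n P"
    using assms(1) by (auto simp: moduli_space_orbit[OF n1])
  show ?thesis
    unfolding P(2) moduli_space_orbit[OF n1] swap_orbit[OF assms(3)]
    by (rule imageI) (rule swap_configuration[OF P(1) assms(2,3)])
qed

lemma continuous_map_swap:
  assumes M: "inj_on M {1..n}" and i: "i \<in> {1..n}"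
  shows "continuous_map
    (subtopology (product_topology (\<lambda>_. euclidean) {1..n}) (configurations n M))
    (subtopology (product_topology (\<lambda>_. euclidean) {1..n}) (configurations n (M \<circ> edge_transposition n i)))
    (swap n i :: (nat \<Rightarrow> real ^ 'd) \<Rightarrow> _)"
proof -
  let ?Y = "subtopology (product_topology (\<lambda>_. euclidean) {1..n}) (configurations n M)
    :: (nat \<Rightarrow> real ^ 'd) topology"
  have proj: "continuous_map ?Y euclidean (\<lambda>P. P k)" if "k \<in> {1..n}" for k
    using that by (intro continuous_map_from_subtopology continuous_map_product_projection)
  note ne = neighbours[OF i]
  have "continuous_map ?Y (top_of_set {(a, b, x). a \<noteq> b}) (\<lambda>P. (P (cyc_pred n i), P (cyc_succ n i), P i))"
    unfolding continuous_map_in_subtopology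
  proof
    show "continuous_map ?Y euclidean (\<lambda>P. (P (cyc_pred n i), P (cyc_succ n i), P i))"
      unfolding prod_topology_euclidean[symmetric]
      using proj ne i by (intro continuous_map_pairedI) auto
    show "(\<lambda>P. (P (cyc_pred n i), P (cyc_succ n i), P i)) \<in> topspace ?Y \<rightarrow> {(a, b, x). a \<noteq> b}"
      using neighbours_distinct[OF _ M i] by auto
  qed
  moreover have "continuous_map (top_of_set {(a, b, x). a \<noteq> b}) euclidean (\<lambda>(a, b, x :: real ^ 'd). bisector_mirror a b x)"
    using continuous_on_bisector_mirror by (simp add: continuous_map_iff_continuous)
  ultimately have mir: "continuous_map ?Y euclidean
      ((\<lambda>(a, b, x). bisector_mirror a b x) \<circ> (\<lambda>P. (P (cyc_pred n i), P (cyc_succ n i), P i)))"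
    by (rule continuous_map_compose)
  show ?thesis
    unfolding continuous_map_in_subtopology
  proof
    have "swap n i ` topspace ?Y \<subseteq> extensional {1..n}"
      using swap_configuration[OF _ M i] by (fastforce simp: configurations_def PiE_def)
    moreover have "continuous_map ?Y euclidean (\<lambda>P. swap n i P k)" if "k \<in> {1..n}" for k
      using mir proj[OF that] by (cases "k = i") (simp_all add: swap_def o_def)
    ultimately show "continuous_map ?Y (product_topology (\<lambda>_. euclidean) {1..n}) (swap n i)"
      by (auto simp: continuous_map_componentwise)
    show "swap n i \<in> topspace ?Y \<rightarrow> configurations n (M \<circ> edge_transposition n i)"
      using swap_configuration[OF _ M i] by auto
  qed
qed

lemma continuous_map_swap_moduli:
  assumes M: "inj_on M {1..n}" and i: "i \<in> {1..n}"
  shows "continuous_map (moduli_topology n M) (moduli_topology n (M \<circ> edge_transposition n i))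
    ((`) (swap n i) :: (nat \<Rightarrow> real ^ 'd) set \<Rightarrow> _)"
proof (rule continuous_compose_quotient_map[OF quotient_map_orbit[OF n1]])
  let ?Y = "\<lambda>M. subtopology (product_topology (\<lambda>_. euclidean) {1..n}) (configurations n M)
    :: (nat \<Rightarrow> real ^ 'd) topology"
  have "continuous_map (?Y M) (moduli_topology n (M \<circ> edge_transposition n i)) (isometry_orbit n \<circ> swap n i)"
    by (rule continuous_map_compose[OF continuous_map_swap[OF assms]
          quotient_imp_continuous_map[OF quotient_map_orbit[OF n1]]])
  then show "continuous_map (?Y M) (moduli_topology n (M \<circ> edge_transposition n i)) ((`) (swap n i) \<circ> isometry_orbit n)"
    by (rule continuous_map_eq) (simp add: swap_orbit[OF i])
qed

text \<open>Bookkeeping for the components of the union: a swap multiplies the index \<sigma> of the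
  component by its transposition on the left, and no inverse remains because a transposition is its
  own inverse.\<close>

lemma length_perm:
  assumes "\<sigma> \<in> carrier (sym_group n)"
  shows "inj_on (L \<circ> inv\<^bsub>sym_group n\<^esub> \<sigma>) {1..n}"
    and "i \<in> {1..n} \<Longrightarrow> (L \<circ> inv\<^bsub>sym_group n\<^esub> \<sigma>) \<circ> edge_transposition n i
      = L \<circ> inv\<^bsub>sym_group n\<^esub> (edge_transposition n i \<circ> \<sigma>)"
proof -
  interpret S: group "sym_group n"
    by (rule sym_group_is_group)
  have "inv\<^bsub>sym_group n\<^esub> \<sigma> permutes {1..n}"
    using S.inv_closed[OF assms] by (simp only: sym_group_carrier)
  then show "inj_on (L \<circ> inv\<^bsub>sym_group n\<^esub> \<sigma>) {1..n}"
    using inj by (intro comp_inj_on) (auto simp: permutes_inj_on permutes_image)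
  assume i: "i \<in> {1..n}"
  let ?t = "edge_transposition n i"
  have t: "?t \<in> carrier (sym_group n)"
    using i by (rule edge_transposition_in_sym_group)
  have "inv\<^bsub>sym_group n\<^esub> (?t \<circ> \<sigma>) = inv\<^bsub>sym_group n\<^esub> \<sigma> \<circ> ?t"
    using S.inv_mult_group[OF t assms] by (simp only: sym_group_mult inv_edge_transposition[OF i])
  then show "(L \<circ> inv\<^bsub>sym_group n\<^esub> \<sigma>) \<circ> ?t = L \<circ> inv\<^bsub>sym_group n\<^esub> (?t \<circ> \<sigma>)"
    by (simp only: o_assoc)
qed

section \<open>The action on the union of the moduli spaces\<close>

abbreviation all :: "(nat \<Rightarrow> real ^ 'd) set set" where
  "all \<equiv> all_moduli n L"

definition swap_gen :: "nat \<Rightarrow> (nat \<Rightarrow> real ^ 'd) set \<Rightarrow> (nat \<Rightarrow> real ^ 'd) set" where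
  "swap_gen i = (\<lambda>c\<in>all. swap n i ` c)"

lemma all_cases:
  assumes "c \<in> all"
  obtains M P where "inj_on M {1..n}" "P \<in> configurations n M" "c = isometry_orbit n P"
proof -
  obtain \<sigma> where "\<sigma> \<in> carrier (sym_group n)" "c \<in> moduli_space n (L \<circ> inv\<^bsub>sym_group n\<^esub> \<sigma>)"
    using assms by (auto simp only: all_moduli_def)
  then show ?thesis
    using that length_perm(1) by (auto simp only: moduli_space_orbit[OF n1])
qed

lemma swap_all:
  assumes "i \<in> {1..n}" "c \<in> all"
  shows "swap n i ` c \<in> all"
proof -
  obtain \<sigma> where s: "\<sigma> \<in> carrier (sym_group n)" "c \<in> moduli_space n (L \<circ> inv\<^bsub>sym_group n\<^esub> \<sigma>)"
    using assms(2) by (auto simp only: all_moduli_def)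
  have "edge_transposition n i \<circ> \<sigma> \<in> carrier (sym_group n)"
    using monoid.m_closed[OF group.is_monoid[OF sym_group_is_group]
        edge_transposition_in_sym_group[OF assms(1)] s(1)] by (simp only: sym_group_mult)
  moreover have "swap n i ` c \<in> moduli_space n (L \<circ> inv\<^bsub>sym_group n\<^esub> (edge_transposition n i \<circ> \<sigma>))"
    using swap_moduli_space[OF s(2) length_perm(1)[OF s(1)] assms(1)]
    unfolding length_perm(2)[OF s(1) assms(1)] .
  ultimately show ?thesis
    unfolding all_moduli_def by blast
qed

lemma swap_swap_image: "i \<in> {1..n} \<Longrightarrow> swap n i ` swap n i ` c = c"
  by (simp add: image_image swap_swap)

lemma swap_gen_closed:
  assumes "i \<in> {1..n}"
  shows "swap_gen i \<in> carrier (BijGroup all)"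
proof -
  have "bij_betw (swap_gen i) all all"
    using swap_all[OF assms] swap_swap_image[OF assms]
    by (intro bij_betwI[where g = "swap_gen i"]) (simp_all add: swap_gen_def)
  then show ?thesis
    by (simp add: BijGroup_def Bij_def swap_gen_def)
qed

lemma BijGroup_mult:
  assumes "f \<in> carrier (BijGroup E)" "g \<in> carrier (BijGroup E)"
  shows "f \<otimes>\<^bsub>BijGroup E\<^esub> g = compose E f g"
  using assms by (simp add: BijGroup_def)

lemma swap_gen_relations:
  assumes i: "i \<in> {1..n}"
  shows "swap_gen i \<otimes>\<^bsub>BijGroup all\<^esub> swap_gen i = \<one>\<^bsub>BijGroup all\<^esub>"
    and "j \<in> {1..n} \<Longrightarrow> \<not> cyc_adjacent n i j \<Longrightarrow>
      swap_gen i \<otimes>\<^bsub>BijGroup all\<^esub> swap_gen j = swap_gen j \<otimes>\<^bsub>BijGroup all\<^esub> swap_gen i"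
    and "swap_gen i \<otimes>\<^bsub>BijGroup all\<^esub> swap_gen (cyc_succ n i) \<otimes>\<^bsub>BijGroup all\<^esub> swap_gen i
      = swap_gen (cyc_succ n i) \<otimes>\<^bsub>BijGroup all\<^esub> swap_gen i \<otimes>\<^bsub>BijGroup all\<^esub> swap_gen (cyc_succ n i)"
proof -
  interpret B: group "BijGroup all"
    by (rule group_BijGroup)
  have app: "swap_gen i c = swap n i ` c" if "c \<in> all" for i c
    using that by (simp add: swap_gen_def)
  note closed = swap_gen_closed and image = swap_all
  show "swap_gen i \<otimes>\<^bsub>BijGroup all\<^esub> swap_gen i = \<one>\<^bsub>BijGroup all\<^esub>"
    using closed[OF i] image[OF i]
    by (auto simp: swap_swap_image[OF i] BijGroup_mult BijGroup_def[of all, THEN arg_cong[where f = one]] compose_def app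
        intro!: restrict_ext)
  show "swap_gen i \<otimes>\<^bsub>BijGroup all\<^esub> swap_gen j = swap_gen j \<otimes>\<^bsub>BijGroup all\<^esub> swap_gen i"
    if j: "j \<in> {1..n}" "\<not> cyc_adjacent n i j"
  proof -
    have "swap n i ` swap n j ` c = swap n j ` swap n i ` c" for c :: "(nat \<Rightarrow> real ^ 'd) set"
      by (simp add: image_image swap_commute[OF i j])
    then show ?thesis
      using closed[OF i] image[OF i] closed[OF j(1)] image[OF j(1)]
      by (auto simp: BijGroup_mult compose_def app intro!: restrict_ext)
  qed
  let ?j = "cyc_succ n i"
  have j: "?j \<in> {1..n}"
    using neighbours[OF i] by blast
  \<comment> \<open>Whatever component c lies in, its lengths permute those of \<open>L\<close> and
    are therefore distinct, as \<open>swap_braid\<close> demands.\<close>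
  have "swap n i ` swap n ?j ` swap n i ` c = swap n ?j ` swap n i ` swap n ?j ` c" if c: "c \<in> all" for c
  proof -
    obtain M P where "inj_on M {1..n}" "P \<in> configurations n M" "c = isometry_orbit n P"
      using c by (rule all_cases)
    then show ?thesis
      using swap_braid[OF _ _ i, of P M] by (simp only: swap_orbit[OF i] swap_orbit[OF j])
  qed
  then have "compose all (compose all (swap_gen i) (swap_gen ?j)) (swap_gen i)
      = compose all (compose all (swap_gen ?j) (swap_gen i)) (swap_gen ?j)"
    using image[OF i] image[OF j] by (auto simp: compose_def app intro!: restrict_ext)
  moreover have "swap_gen a \<otimes>\<^bsub>BijGroup all\<^esub> swap_gen b \<otimes>\<^bsub>BijGroup all\<^esub> swap_gen c
      = compose all (compose all (swap_gen a) (swap_gen b)) (swap_gen c)"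
    if "a \<in> {1..n}" "b \<in> {1..n}" "c \<in> {1..n}" for a b c
    using BijGroup_mult[OF closed[OF that(1)] closed[OF that(2)]]
      BijGroup_mult[OF B.m_closed[OF closed[OF that(1)] closed[OF that(2)]] closed[OF that(3)]] by simp
  ultimately show "swap_gen i \<otimes>\<^bsub>BijGroup all\<^esub> swap_gen ?j \<otimes>\<^bsub>BijGroup all\<^esub> swap_gen i
      = swap_gen ?j \<otimes>\<^bsub>BijGroup all\<^esub> swap_gen i \<otimes>\<^bsub>BijGroup all\<^esub> swap_gen ?j"
    using i j by (simp only:)
qed

abbreviation act :: "nat word \<Rightarrow> (nat \<Rightarrow> real ^ 'd) set \<Rightarrow> (nat \<Rightarrow> real ^ 'd) set" where
  "act \<equiv> swap_action n L"

lemma act_eq: "act = free_lift (BijGroup all) swap_gen"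
  by (simp add: swap_action_def swap_gen_def[abs_def])

lemma group_hom_act: "group_hom (FG n) (BijGroup all) act"
  unfolding act_eq group_hom_def group_hom_axioms_def
  by (intro conjI group_free_group group_BijGroup free_lift_hom Pi_I swap_gen_closed)

lemma swap_relations_act: "swap_relations n \<subseteq> kernel (FG n) (BijGroup all) act"
proof -
  have g: "act (gen i) = swap_gen i" if "i \<in> {1..n}" for i
    unfolding act_eq using that by (intro free_lift_gen group_BijGroup swap_gen_closed)
  have j: "cyc_succ n i \<in> {1..n}" if "i \<in> {1..n}" for i
    using neighbours[OF that] by blast
  show ?thesis
  proof (rule swap_relations_subset_kernel[OF group_hom_act n1])
    fix i j assume "i \<in> {1..n}" "j \<in> {1..n}" "\<not> cyc_adjacent n i j"
    then show "act (gen i) \<otimes>\<^bsub>BijGroup all\<^esub> act (gen j) = act (gen j) \<otimes>\<^bsub>BijGroup all\<^esub> act (gen i)"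
      using swap_gen_relations(2) by (simp only: g)
  qed (simp_all only: g j swap_gen_relations(1,3))
qed

text \<open>A word of the kernel returns to the component of \<open>L\<close>, but its final
  segments need not do so; hence the induction follows maps between different components. Inverse
  letters act like the letters themselves because swaps are involutions.\<close>

lemma continuous_map_act:
  assumes "w \<in> carrier (FG n)" "\<sigma> \<in> carrier (sym_group n)"
  shows "perm_of n w \<circ> \<sigma> \<in> carrier (sym_group n) \<and>
    continuous_map (moduli_topology n (L \<circ> inv\<^bsub>sym_group n\<^esub> \<sigma>))
      (moduli_topology n (L \<circ> inv\<^bsub>sym_group n\<^esub> (perm_of n w \<circ> \<sigma>))) (act w)"
  using assms(1)
proof (induction w)
  interpret B: group "BijGroup all"
    by (rule group_BijGroup)
  interpret S: group "sym_group n"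
    by (rule sym_group_is_group)
  have sub: "moduli_space n (L \<circ> inv\<^bsub>sym_group n\<^esub> \<sigma>) \<subseteq> all"
    using assms(2) unfolding all_moduli_def by blast
  {
    case Nil
    have "continuous_map (moduli_topology n (L \<circ> inv\<^bsub>sym_group n\<^esub> \<sigma>))
        (moduli_topology n (L \<circ> inv\<^bsub>sym_group n\<^esub> \<sigma>)) (act [])"
      by (rule continuous_map_eq[OF continuous_map_id])
        (use sub in \<open>auto simp: act_eq BijGroup_def topspace_moduli_topology\<close>)
    moreover have "perm_of n [] \<circ> \<sigma> = \<sigma>"
      by (simp add: perm_of_def sym_group_one)
    ultimately show ?case
      using assms(2) by (simp only:)
  next
    case (Cons x w)
    obtain i b where x: "x = (i, b)"
      by fastforce
    note F = free_group_Cons[OF Cons.prems[unfolded x]]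
    note t = edge_transposition_in_sym_group[OF F(1)]
    define \<rho> where "\<rho> = perm_of n w \<circ> \<sigma>"
    note IH = Cons.IH[OF F(2), folded \<rho>_def, THEN conjunct1] Cons.IH[OF F(2), folded \<rho>_def, THEN conjunct2]
    have perm: "perm_of n (x # w) \<circ> \<sigma> = edge_transposition n i \<circ> \<rho>"
      by (simp del: sym_group_inv_equality add: inv_edge_transposition[OF F(1)] perm_of_def free_lift_Cons x \<rho>_def sym_group_mult o_assoc)
    have "inv\<^bsub>BijGroup all\<^esub> swap_gen i = swap_gen i"
      using swap_gen_closed[OF F(1)] swap_gen_relations(1)[OF F(1)] by (intro B.inv_equality)
    then have "act (x # w) = compose all (swap_gen i) (act w)"
      using BijGroup_mult[OF swap_gen_closed[OF F(1)] group_hom.hom_closed[OF group_hom_act F(2)]]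
      by (simp add: act_eq free_lift_Cons x)
    moreover have "act w c \<in> all" if "c \<in> all" for c
      using group_hom.hom_closed[OF group_hom_act F(2)] that Bij_imp_funcset
      by (fastforce simp: BijGroup_def)
    ultimately have act: "act (x # w) c = ((`) (swap n i) \<circ> act w) c" if "c \<in> all" for c
      using that by (simp add: compose_def swap_gen_def)
    have "continuous_map (moduli_topology n (L \<circ> inv\<^bsub>sym_group n\<^esub> \<sigma>))
        (moduli_topology n (L \<circ> inv\<^bsub>sym_group n\<^esub> (edge_transposition n i \<circ> \<rho>))) ((`) (swap n i) \<circ> act w)"
      using continuous_map_swap_moduli[OF length_perm(1)[OF IH(1)] F(1)]
      unfolding length_perm(2)[OF IH(1) F(1)] by (rule continuous_map_compose[OF IH(2)])
    then have "continuous_map (moduli_topology n (L \<circ> inv\<^bsub>sym_group n\<^esub> \<sigma>))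
        (moduli_topology n (L \<circ> inv\<^bsub>sym_group n\<^esub> (edge_transposition n i \<circ> \<rho>))) (act (x # w))"
      by (rule continuous_map_eq) (use sub act in \<open>auto simp: topspace_moduli_topology\<close>)
    then show ?case
      unfolding perm using S.m_closed[OF t IH(1)] by (simp only: sym_group_mult)
  }
qed

lemma continuous_map_act_FG0:
  assumes "w \<in> carrier (FG0 n)"
  shows "continuous_map (moduli_topology n L) (moduli_topology n L) (act w)"
proof -
  interpret S: group "sym_group n"
    by (rule sym_group_is_group)
  have "inv\<^bsub>sym_group n\<^esub> id = id"
    using S.inv_one by (simp only: sym_group_one)
  moreover have "id \<in> carrier (sym_group n)"
    using S.one_closed by (simp only: sym_group_one)
  ultimately show ?thesis
    using continuous_map_act[of w id] assms by (simp add: FG0_carrier)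
qed

theorem moduli_action:
  "\<exists>\<phi>. group_action (FG0 n Mod swap_relations n) (moduli_space n L :: (nat \<Rightarrow> real ^ 'd) set set) \<phi>
        \<and> (\<forall>w\<in>carrier (FG0 n). \<forall>c\<in>moduli_space n L.
              \<phi> (swap_relations n #>\<^bsub>FG0 n\<^esub> w) c = swap_action n L w c)
        \<and> (\<forall>x\<in>carrier (FG0 n Mod swap_relations n).
              homeomorphic_map (moduli_topology n L) (moduli_topology n L) (\<phi> x))"
proof -
  let ?X = "moduli_space n L :: (nat \<Rightarrow> real ^ 'd) set set" and ?R = "swap_relations n"
  interpret F: group "FG n"
    by (rule group_free_group)
  interpret A: group_hom "FG n" "BijGroup all" act
    by (rule group_hom_act)
  have F0: "subgroup (carrier (FG0 n)) (FG n)"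
    using FG0_normal by (rule normal_imp_subgroup)
  have F0G: "FG0 n = (FG n)\<lparr>carrier := carrier (FG0 n)\<rparr>"
    by (simp add: FG0_def)
  have normal: "?R \<lhd> FG0 n"
    using F.normal_restrict_supergroup[OF F0 swap_relations_normal swap_relations_subset_FG0[OF n]]
    by (simp only: F0G[symmetric])
  have coset: "?R #>\<^bsub>FG0 n\<^esub> w = ?R #>\<^bsub>FG n\<^esub> w" for w
    by (subst F0G) (rule r_coset_consistent)
  interpret S: group "sym_group n"
    by (rule sym_group_is_group)
  have "inv\<^bsub>sym_group n\<^esub> id = id" "id \<in> carrier (sym_group n)"
    using S.inv_one S.one_closed by (simp_all only: sym_group_one)
  then have "moduli_space n (L \<circ> inv\<^bsub>sym_group n\<^esub> id) = ?X"
    by simp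
  then have sub: "?X \<subseteq> all"
    using \<open>id \<in> carrier (sym_group n)\<close> unfolding all_moduli_def by blast
  have maps: "act w c \<in> ?X" if "w \<in> carrier (FG0 n)" "c \<in> ?X" for w c
    using continuous_map_funspace[OF continuous_map_act_FG0[OF that(1)]] that(2)
    by (auto simp: topspace_moduli_topology)
  have mem: "w \<in> carrier (FG n)" if "w \<in> carrier (FG0 n)" for w
    using that by (simp add: FG0_carrier)
  have mult: "act (v \<otimes>\<^bsub>FG n\<^esub> w) c = act v (act w c)"
    if "v \<in> carrier (FG n)" "w \<in> carrier (FG n)" "c \<in> all" for v w c
    using A.hom_mult[OF that(1,2)] BijGroup_mult[OF A.hom_closed[OF that(1)] A.hom_closed[OF that(2)]] that(3)
    by (simp add: compose_def)
  have inv: "inv\<^bsub>FG n\<^esub> w \<in> carrier (FG0 n)" if "w \<in> carrier (FG0 n)" for w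
    using subgroup.m_inv_closed[OF F0 that] .
  have one: "act \<one>\<^bsub>FG n\<^esub> c = c" if "c \<in> all" for c
    using A.hom_one that by (simp add: BijGroup_def)
  have cancel: "act (inv\<^bsub>FG n\<^esub> w) (act w c) = c" "act w (act (inv\<^bsub>FG n\<^esub> w) c) = c"
    if "w \<in> carrier (FG0 n)" "c \<in> ?X" for w c
    using that sub mem[OF that(1)] mult[of w "inv\<^bsub>FG n\<^esub> w" c] mult[of "inv\<^bsub>FG n\<^esub> w" w c] one
    by (simp_all add: subset_iff)
  have homeo: "homeomorphic_map (moduli_topology n L) (moduli_topology n L) (act w)" if "w \<in> carrier (FG0 n)" for w
    unfolding homeomorphic_map_maps
    by (rule exI[of _ "act (inv\<^bsub>FG n\<^esub> w)"])
      (use that inv cancel continuous_map_act_FG0 in \<open>simp add: homeomorphic_maps_def topspace_moduli_topology\<close>)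
  \<comment> \<open>All words of a coset act alike, and words of the kernel preserve the component
    of \<open>L\<close>, so the common map may be restricted to it.\<close>
  define \<phi> where "\<phi> C = restrict (the_elem (act ` C)) ?X" for C
  have phi: "\<phi> (?R #>\<^bsub>FG0 n\<^esub> w) = restrict (act w) ?X" if "w \<in> carrier (FG0 n)" for w
    unfolding \<phi>_def coset A.the_elem_coset[OF swap_relations_normal swap_relations_act mem[OF that]] ..
  have bij: "restrict (act w) ?X \<in> carrier (BijGroup ?X)" if "w \<in> carrier (FG0 n)" for w
  proof -
    have "bij_betw (restrict (act w) ?X) ?X ?X"
      by (rule bij_betwI[where g = "act (inv\<^bsub>FG n\<^esub> w)"])
        (use that inv cancel maps in auto)
    then show ?thesis
      by (simp add: BijGroup_def Bij_def)
  qed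
  have carr: "\<exists>w\<in>carrier (FG0 n). C = ?R #>\<^bsub>FG0 n\<^esub> w" if "C \<in> carrier (FG0 n Mod ?R)" for C
    using that by (auto simp only: carrier_FactGroup)
  have "group_action (FG0 n Mod ?R) ?X \<phi>"
    unfolding group_action_def group_hom_def group_hom_axioms_def
  proof (intro conjI normal.factorgroup_is_group[OF normal] group_BijGroup homI)
    fix C assume "C \<in> carrier (FG0 n Mod ?R)"
    then show "\<phi> C \<in> carrier (BijGroup ?X)"
      using carr phi bij by metis
  next
    fix C D assume "C \<in> carrier (FG0 n Mod ?R)" "D \<in> carrier (FG0 n Mod ?R)"
    then obtain v w where v: "v \<in> carrier (FG0 n)" "C = ?R #>\<^bsub>FG0 n\<^esub> v"
      and w: "w \<in> carrier (FG0 n)" "D = ?R #>\<^bsub>FG0 n\<^esub> w"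
      using carr by metis
    have vw: "v \<otimes>\<^bsub>FG n\<^esub> w \<in> carrier (FG0 n)"
      using subgroup.m_closed[OF F0 v(1) w(1)] .
    have "C \<otimes>\<^bsub>FG0 n Mod ?R\<^esub> D = ?R #>\<^bsub>FG0 n\<^esub> (v \<otimes>\<^bsub>FG0 n\<^esub> w)"
      unfolding v(2) w(2) mult_FactGroup by (rule normal.rcos_sum[OF normal v(1) w(1)])
    also have "v \<otimes>\<^bsub>FG0 n\<^esub> w = v \<otimes>\<^bsub>FG n\<^esub> w"
      by (simp add: FG0_def)
    finally have "\<phi> (C \<otimes>\<^bsub>FG0 n Mod ?R\<^esub> D) = restrict (act (v \<otimes>\<^bsub>FG n\<^esub> w)) ?X"
      using phi[OF vw] by simp
    also have "\<dots> = compose ?X (restrict (act v) ?X) (restrict (act w) ?X)"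
      using mult[OF mem[OF v(1)] mem[OF w(1)]] maps[OF w(1)] sub
      by (auto simp: compose_def subset_iff intro!: restrict_ext)
    also have "\<dots> = \<phi> C \<otimes>\<^bsub>BijGroup ?X\<^esub> \<phi> D"
      using BijGroup_mult[OF bij[OF v(1)] bij[OF w(1)]] phi v w by simp
    finally show "\<phi> (C \<otimes>\<^bsub>FG0 n Mod ?R\<^esub> D) = \<phi> C \<otimes>\<^bsub>BijGroup ?X\<^esub> \<phi> D" .
  qed
  moreover have "\<phi> (?R #>\<^bsub>FG0 n\<^esub> w) c = act w c" if "w \<in> carrier (FG0 n)" "c \<in> ?X" for w c
    using phi that by simp
  moreover have "homeomorphic_map (moduli_topology n L) (moduli_topology n L) (\<phi> C)"
    if C: "C \<in> carrier (FG0 n Mod ?R)" for C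
  proof -
    obtain w where w: "w \<in> carrier (FG0 n)" "C = ?R #>\<^bsub>FG0 n\<^esub> w"
      using carr[OF C] by blast
    show ?thesis
      unfolding w(2) phi[OF w(1)]
      by (rule homeomorphic_map_eq[OF homeo[OF w(1)]]) (simp add: topspace_moduli_topology)
  qed
  ultimately show ?thesis
    by (intro exI[of _ \<phi>]) blast
qed

end

section \<open>The relations of the affine symmetric group\<close>

lemma crossing_lift_eq_cross: "crossing_lift n i = cross (int n) (int i)"
  by (simp add: crossing_lift_def cross_def fun_eq_iff)

lemma BijGroup_UNIV_mult:
  assumes "f \<in> carrier (BijGroup UNIV)" "g \<in> carrier (BijGroup UNIV)"
  shows "f \<otimes>\<^bsub>BijGroup UNIV\<^esub> g = f \<circ> g"
  using assms by (simp add: BijGroup_def compose_def fun_eq_iff)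

lemma BijGroup_UNIV_one: "\<one>\<^bsub>BijGroup UNIV\<^esub> = id"
  by (simp add: BijGroup_def restrict_def id_def)

lemma cyc_succ_mod: "int (cyc_succ n k) mod int n = (int k + 1) mod int n"
  by (auto simp: cyc_succ_def add.commute)

lemma index_eq_iff:
  assumes "i \<in> {1..n}" "j \<in> {1..n}"
  shows "int i mod int n = int j mod int n \<longleftrightarrow> i = j"
  using assms by (subst mod_eq_iff_near) auto

lemma cyc_adjacent_iff:
  assumes "i \<in> {1..n}" "j \<in> {1..n}"
  shows "cyc_adjacent n i j \<longleftrightarrow> int n dvd int i - int j - 1 \<or> int n dvd int i - int j + 1"
proof -
  have "j = cyc_succ n i \<longleftrightarrow> int n dvd int i - int j + 1" "i = cyc_succ n j \<longleftrightarrow> int n dvd int i - int j - 1"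
    if "n \<ge> 1" "i \<in> {1..n}" "j \<in> {1..n}" for i j
  proof -
    have "j = cyc_succ n i \<longleftrightarrow> (int i + 1) mod int n = int j mod int n"
      using index_eq_iff[OF that(3) cyc_succ_in[OF that(1,2)]] by (auto simp: cyc_succ_mod)
    then show "j = cyc_succ n i \<longleftrightarrow> int n dvd int i - int j + 1"
      by (simp add: mod_eq_dvd_iff algebra_simps)
    have "i = cyc_succ n j \<longleftrightarrow> int i mod int n = (int j + 1) mod int n"
      using index_eq_iff[OF that(2) cyc_succ_in[OF that(1,3)]] by (auto simp: cyc_succ_mod)
    then show "i = cyc_succ n j \<longleftrightarrow> int n dvd int i - int j - 1"
      by (simp add: mod_eq_dvd_iff algebra_simps)
  qed
  moreover have "n \<ge> 1"
    using assms by simp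
  ultimately show ?thesis
    using assms unfolding cyc_adjacent_def by metis
qed

locale swap_group =
  fixes n :: nat
  assumes n: "n \<ge> 3"
begin

lemma n1: "n \<ge> 1"
  using n by simp

sublocale F: group "FG n"
  by (rule group_free_group)

abbreviation R :: "nat word set" where
  "R \<equiv> swap_relations n"

abbreviation N :: "nat word set" where
  "N \<equiv> braid_relators n"

abbreviation W :: "nat word set monoid" where
  "W \<equiv> FG n Mod R"

abbreviation B :: "nat word set monoid" where
  "B \<equiv> braid_group n"

lemma crossing_lift_twice: "crossing_lift n i \<circ> crossing_lift n i = id"
  using n by (simp add: crossing_lift_eq_cross fun_eq_iff cross_cross)

lemma crossing_lift_closed: "crossing_lift n i \<in> carrier (BijGroup UNIV)"
  using crossing_lift_twice[of i] o_bij by (auto simp: BijGroup_def Bij_def)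

lemma inv_crossing_lift: "inv\<^bsub>BijGroup UNIV\<^esub> crossing_lift n i = crossing_lift n i"
  using crossing_lift_twice[of i] crossing_lift_closed[of i]
  by (intro group.inv_equality[OF group_BijGroup]) (simp_all add: BijGroup_UNIV_mult BijGroup_UNIV_one)

text \<open>\<open>strand_end\<close> ignores the signs of the letters; this agrees with the
  homomorphic extension because each crossing is an involution.\<close>

lemma strand_end_eq_free_lift:
  assumes "w \<in> carrier (FG n)"
  shows "strand_end n w = free_lift (BijGroup UNIV) (crossing_lift n) w"
  using assms
proof (induction w)
  case Nil
  then show ?case
    by (simp add: strand_end_def fun_eq_iff BijGroup_UNIV_one)
next
  case (Cons x w)
  obtain i b where x: "x = (i, b)"
    by fastforce
  have w: "w \<in> carrier (FG n)"
    using free_group_Cons(2) Cons.prems x by metis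
  have "free_lift (BijGroup UNIV) (crossing_lift n) w \<in> carrier (BijGroup UNIV)"
    using free_lift_hom[OF group_BijGroup, of "crossing_lift n" "{1..n}" UNIV] w crossing_lift_closed
    by (auto simp: hom_def Pi_iff)
  then have "free_lift (BijGroup UNIV) (crossing_lift n) (x # w) = crossing_lift n i \<circ> strand_end n w"
    using Cons.IH[OF w] crossing_lift_closed by (simp add: x free_lift_Cons inv_crossing_lift BijGroup_UNIV_mult)
  then show ?case
    by (simp add: x strand_end_def fun_eq_iff)
qed

sublocale strand: group_hom "FG n" "BijGroup UNIV" "strand_end n"
proof -
  have h: "free_lift (BijGroup UNIV) (crossing_lift n) \<in> hom (FG n) (BijGroup UNIV)"
    by (rule free_lift_hom[OF group_BijGroup]) (simp add: crossing_lift_closed)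
  have "strand_end n \<in> hom (FG n) (BijGroup UNIV)"
    by (rule homI) (use strand_end_eq_free_lift hom_in_carrier[OF h] hom_mult[OF h] F.m_closed in \<open>simp_all\<close>)
  then show "group_hom (FG n) (BijGroup UNIV) (strand_end n)"
    by (simp add: group_hom_def group_hom_axioms_def group_free_group group_BijGroup)
qed

lemma strand_end_mult:
  assumes "v \<in> carrier (FG n)" "w \<in> carrier (FG n)"
  shows "strand_end n (v \<otimes>\<^bsub>FG n\<^esub> w) = strand_end n v \<circ> strand_end n w"
  using strand.hom_mult[OF assms] BijGroup_UNIV_mult[OF strand.hom_closed[OF assms(1)] strand.hom_closed[OF assms(2)]]
  by simp

lemma strand_end_gen: "strand_end n (gen i) = crossing_lift n i"
  by (simp add: strand_end_def gen_def fun_eq_iff)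

lemma strand_end_add_period: "strand_end n w (k + int n * q) = strand_end n w k + int n * q"
  by (induction w) (auto simp: strand_end_def crossing_lift_eq_cross cross_add_period)

lemma swap_relations_strand: "R \<subseteq> kernel (FG n) (BijGroup UNIV) (strand_end n)"
proof (rule swap_relations_subset_kernel[OF strand.group_hom_axioms n1])
  have m: "crossing_lift n i \<otimes>\<^bsub>BijGroup UNIV\<^esub> crossing_lift n j = crossing_lift n i \<circ> crossing_lift n j" for i j
    using crossing_lift_closed by (simp add: BijGroup_UNIV_mult)
  have m3: "crossing_lift n i \<otimes>\<^bsub>BijGroup UNIV\<^esub> crossing_lift n j \<otimes>\<^bsub>BijGroup UNIV\<^esub> crossing_lift n k
    = crossing_lift n i \<circ> crossing_lift n j \<circ> crossing_lift n k" for i j k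
    using BijGroup_UNIV_mult[OF strand.H.m_closed[OF crossing_lift_closed[of i] crossing_lift_closed[of j]]
        crossing_lift_closed[of k]] by (simp only: m)
  show "strand_end n (gen i) \<otimes>\<^bsub>BijGroup UNIV\<^esub> strand_end n (gen i) = \<one>\<^bsub>BijGroup UNIV\<^esub>" for i
    by (simp only: strand_end_gen m crossing_lift_twice BijGroup_UNIV_one)
  show "strand_end n (gen i) \<otimes>\<^bsub>BijGroup UNIV\<^esub> strand_end n (gen j)
      = strand_end n (gen j) \<otimes>\<^bsub>BijGroup UNIV\<^esub> strand_end n (gen i)"
    if "i \<in> {1..n}" "j \<in> {1..n}" "\<not> cyc_adjacent n i j" for i j
    using that n cross_commute[of "int n" "int i" "int j"] cyc_adjacent_iff[OF that(1,2)]
    unfolding strand_end_gen m by (simp add: crossing_lift_eq_cross fun_eq_iff)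
  show "strand_end n (gen i) \<otimes>\<^bsub>BijGroup UNIV\<^esub> strand_end n (gen (cyc_succ n i)) \<otimes>\<^bsub>BijGroup UNIV\<^esub> strand_end n (gen i)
      = strand_end n (gen (cyc_succ n i)) \<otimes>\<^bsub>BijGroup UNIV\<^esub> strand_end n (gen i) \<otimes>\<^bsub>BijGroup UNIV\<^esub> strand_end n (gen (cyc_succ n i))"
    for i
  proof -
    have "cross (int n) (int (cyc_succ n i)) = cross (int n) (int i + 1)"
      by (rule cross_index_cong) (rule cyc_succ_mod)
    then show ?thesis
      using n cross_braid[of "int n" "int i"]
      unfolding strand_end_gen m3 by (simp add: crossing_lift_eq_cross fun_eq_iff)
  qed
qed

text \<open>Modulo n the lifted crossing is the transposition of the two edges at the vertex. This
  is what later identifies the kernel of the permutations with the pure elements.\<close>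

lemma perm_of_strand_end:
  assumes "w \<in> carrier (FG n)" "k \<in> {1..n}"
  shows "perm_of n w k \<in> {1..n} \<and> int (perm_of n w k) mod int n = strand_end n w (int k) mod int n"
  using assms(1)
proof (induction w)
  case Nil
  then show ?case
    using assms(2) by (simp add: perm_of_def sym_group_one strand_end_def)
next
  case (Cons x w)
  obtain i b where x: "x = (i, b)"
    by fastforce
  note W = free_group_Cons[OF Cons.prems[unfolded x]]
  let ?k = "perm_of n w k" and ?x = "strand_end n w (int k)"
  have IH: "?k \<in> {1..n}" "int ?k mod int n = ?x mod int n"
    using Cons.IH[OF W(2)] by auto
  have p: "perm_of n (x # w) k = edge_transposition n i ?k"
    by (simp del: sym_group_inv_equality add: inv_edge_transposition[OF W(1)] perm_of_def free_lift_Cons x sym_group_mult)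
  have e: "strand_end n (x # w) (int k) = cross (int n) (int i) ?x"
    by (simp add: strand_end_def x crossing_lift_eq_cross)
  have pred: "cyc_pred n i \<in> {1..n}"
    using cyc_pred_in[OF n1 W(1)] .
  have pred_mod: "int (cyc_pred n i) mod int n = (int i - 1) mod int n"
    using W(1) by (auto simp: cyc_pred_def)
  have x1: "?x mod int n = (int i - 1) mod int n \<longleftrightarrow> ?k = cyc_pred n i"
    using index_eq_iff[OF IH(1) pred] IH(2) pred_mod by simp
  have x2: "?x mod int n = int i mod int n \<longleftrightarrow> ?k = i"
    using index_eq_iff[OF IH(1) W(1)] IH(2) by simp
  consider "?k = cyc_pred n i" | "?k = i" "?k \<noteq> cyc_pred n i" | "?k \<noteq> i" "?k \<noteq> cyc_pred n i"
    by blast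
  then show ?case
  proof cases
    case 1
    have "int i mod int n = (?x + 1) mod int n"
      using x1 1 mod_add_cong[of ?x "int n" "int i - 1" 1 1] by simp
    then show ?thesis
      using 1 W(1) x1 by (simp add: p e edge_transposition_def cross_def)
  next
    case 2
    have "int (cyc_pred n i) mod int n = (?x - 1) mod int n"
      using x2 2 mod_diff_cong[of ?x "int n" "int i" 1 1] pred_mod by simp
    then show ?thesis
      using 2 pred x1 x2 by (simp add: p e edge_transposition_def cross_def)
  next
    case 3
    then show ?thesis
      using IH x1 x2 by (simp add: p e edge_transposition_def cross_def)
  qed
qed

lemma FG0_strand_end:
  assumes w: "w \<in> carrier (FG n)"
  shows "w \<in> carrier (FG0 n) \<longleftrightarrow> (\<forall>k. strand_end n w k mod int n = k mod int n)"
proof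
  assume "w \<in> carrier (FG0 n)"
  then have p: "perm_of n w = id"
    by (simp add: FG0_carrier)
  show "\<forall>k. strand_end n w k mod int n = k mod int n"
  proof
    fix k
    obtain y q where y: "k = y + int n * q" "int n - int n < y" "y \<le> int n"
      by (rule window_representative[of "int n" k "int n"]) (use n in auto)
    then have "nat y \<in> {1..n}" "int (nat y) = y"
      by auto
    then have "strand_end n w y mod int n = y mod int n"
      using perm_of_strand_end[OF w, of "nat y"] by (simp add: p)
    then show "strand_end n w k mod int n = k mod int n"
      by (simp add: y(1) strand_end_add_period)
  qed
next
  assume *: "\<forall>k. strand_end n w k mod int n = k mod int n"
  have "perm_of n w k = k" for k
  proof (cases "k \<in> {1..n}")
    case True
    then show ?thesis
      using perm_of_strand_end[OF w True] index_eq_iff[of "perm_of n w k" n k] * by simp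
  next
    case False
    have "perm_of n w permutes {1..n}"
      using hom_in_carrier[OF perm_of_hom w] by (simp only: sym_group_carrier)
    then show ?thesis
      using False by (rule permutes_not_in)
  qed
  then show "w \<in> carrier (FG0 n)"
    using w by (simp add: FG0_carrier fun_eq_iff)
qed

section \<open>The quotient by the relations as an affine presentation\<close>

lemma R_normal: "R \<lhd> FG n"
  by (rule swap_relations_normal)

definition q :: "nat word \<Rightarrow> nat word set" where
  "q w = R #>\<^bsub>FG n\<^esub> w"

sublocale W: group W
  by (rule normal.factorgroup_is_group[OF R_normal])

sublocale q: group_hom "FG n" W q
proof -
  have "q \<in> hom (FG n) W"
    using normal.r_coset_hom_Mod[OF R_normal] by (simp add: q_def[abs_def])
  then show "group_hom (FG n) W q"
    by (simp add: group_hom_def group_hom_axioms_def F.group_axioms W.group_axioms)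
qed

lemma q_eq_one_iff: "w \<in> carrier (FG n) \<Longrightarrow> q w = \<one>\<^bsub>W\<^esub> \<longleftrightarrow> w \<in> R"
  unfolding q_def one_FactGroup by (rule normal.rcos_eq_self_iff[OF R_normal])

lemma gen_closed: "i \<in> {1..n} \<Longrightarrow> gen i \<in> carrier (FG n)"
  by (rule gen_in_free_group)

lemma R_carrier: "w \<in> R \<Longrightarrow> w \<in> carrier (FG n)"
  by (rule subgroup.mem_carrier[OF normal_imp_subgroup[OF R_normal]])

lemma q_square: "i \<in> {1..n} \<Longrightarrow> q (gen i) \<otimes>\<^bsub>W\<^esub> q (gen i) = \<one>\<^bsub>W\<^esub>"
  using q_eq_one_iff[THEN iffD2, OF _ relation_in_swap_relations(1)[of i n]]
    R_carrier[OF relation_in_swap_relations(1)[of i n]] gen_closed q.hom_mult by metis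

lemma q_commute:
  assumes "i \<in> {1..n}" "j \<in> {1..n}" "\<not> cyc_adjacent n i j"
  shows "q (gen i) \<otimes>\<^bsub>W\<^esub> q (gen j) = q (gen j) \<otimes>\<^bsub>W\<^esub> q (gen i)"
proof (cases "i = j")
  case False
  note r = relation_in_swap_relations(2)[OF assms(1,2) False assms(3)]
  note g = gen_closed[OF assms(1)] gen_closed[OF assms(2)]
  have "q (gen i) \<otimes>\<^bsub>W\<^esub> q (gen j) \<otimes>\<^bsub>W\<^esub> inv\<^bsub>W\<^esub> q (gen i) \<otimes>\<^bsub>W\<^esub> inv\<^bsub>W\<^esub> q (gen j) = \<one>\<^bsub>W\<^esub>"
    using q_eq_one_iff[THEN iffD2, OF R_carrier[OF r] r] g
    by (simp only: q.hom_mult q.hom_inv F.m_closed F.inv_closed)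
  then show ?thesis
    using W.relator_eq_one_iff(1)[OF q.hom_closed[OF g(1)] q.hom_closed[OF g(2)]] by blast
qed simp

lemma q_braid:
  assumes i: "i \<in> {1..n}"
  defines "j \<equiv> cyc_succ n i"
  shows "q (gen i) \<otimes>\<^bsub>W\<^esub> q (gen j) \<otimes>\<^bsub>W\<^esub> q (gen i) = q (gen j) \<otimes>\<^bsub>W\<^esub> q (gen i) \<otimes>\<^bsub>W\<^esub> q (gen j)"
proof -
  note r = relation_in_swap_relations(3)[OF i, folded j_def]
  note g = gen_closed[OF i] gen_closed[OF cyc_succ_in[OF n1 i], folded j_def]
  have "q (gen i) \<otimes>\<^bsub>W\<^esub> q (gen j) \<otimes>\<^bsub>W\<^esub> q (gen i) \<otimes>\<^bsub>W\<^esub> inv\<^bsub>W\<^esub> q (gen j) \<otimes>\<^bsub>W\<^esub> inv\<^bsub>W\<^esub> q (gen i)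
      \<otimes>\<^bsub>W\<^esub> inv\<^bsub>W\<^esub> q (gen j) = \<one>\<^bsub>W\<^esub>"
    using q_eq_one_iff[THEN iffD2, OF R_carrier[OF r] r] g
    by (simp only: q.hom_mult q.hom_inv F.m_closed F.inv_closed)
  then show ?thesis
    using W.relator_eq_one_iff(2)[OF q.hom_closed[OF g(1)] q.hom_closed[OF g(2)]] by blast
qed

text \<open>Subtracting 1 before the reduction and adding it afterwards sends multiples of n to n
  instead of 0.\<close>

definition idx :: "int \<Rightarrow> nat" where
  "idx i = nat ((i - 1) mod int n) + 1"

lemma idx_in: "idx i \<in> {1..n}"
  using n pos_mod_bound[of "int n" "i - 1"] by (auto simp: idx_def simp del: pos_mod_bound)

lemma idx_mod: "int (idx i) mod int n = i mod int n"
  using n by (simp add: idx_def mod_simps)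

definition sW :: "int \<Rightarrow> nat word set" where
  "sW i = q (gen (idx i))"

definition actW :: "nat word set \<Rightarrow> int \<Rightarrow> int" where
  "actW C = the_elem (strand_end n ` C)"

lemma actW_q: "w \<in> carrier (FG n) \<Longrightarrow> actW (q w) = strand_end n w"
  unfolding actW_def q_def by (rule strand.the_elem_coset[OF R_normal swap_relations_strand])

lemma W_carrier: "C \<in> carrier W \<Longrightarrow> \<exists>w\<in>carrier (FG n). C = q w"
  by (auto simp only: carrier_FactGroup q_def)

sublocale A: affine_presentation W n sW actW
proof unfold_locales
  show "n \<ge> 3"
    by (rule n)
  show "sW i \<in> carrier W" for i
    unfolding sW_def by (rule q.hom_closed[OF gen_closed[OF idx_in]])
  show "sW i = sW j" if "i mod int n = j mod int n" for i j
    using index_eq_iff[OF idx_in idx_in] that by (simp add: sW_def idx_mod)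
  show "sW i \<otimes>\<^bsub>W\<^esub> sW i = \<one>\<^bsub>W\<^esub>" for i
    unfolding sW_def by (rule q_square[OF idx_in])
  show "sW i \<otimes>\<^bsub>W\<^esub> sW j = sW j \<otimes>\<^bsub>W\<^esub> sW i" if "\<not> int n dvd i - j - 1" "\<not> int n dvd i - j + 1" for i j
    unfolding sW_def
  proof (rule q_commute[OF idx_in idx_in])
    have 1: "int n dvd int (idx i) - int (idx j) + c \<longleftrightarrow> int n dvd i - j + c" for c
    proof -
      have "(int (idx i) - int (idx j) + c) mod int n = (i - j + c) mod int n"
        by (intro mod_add_cong mod_diff_cong idx_mod refl)
      then show ?thesis
        by (simp add: dvd_eq_mod_eq_0)
    qed
    show "\<not> cyc_adjacent n (idx i) (idx j)"
      using that 1[of "-1"] 1[of 1] by (simp add: cyc_adjacent_iff[OF idx_in idx_in])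
  qed
  show "sW i \<otimes>\<^bsub>W\<^esub> sW (i + 1) \<otimes>\<^bsub>W\<^esub> sW i = sW (i + 1) \<otimes>\<^bsub>W\<^esub> sW i \<otimes>\<^bsub>W\<^esub> sW (i + 1)" for i
  proof -
    have "int (idx (i + 1)) mod int n = int (cyc_succ n (idx i)) mod int n"
      unfolding idx_mod cyc_succ_mod by (intro mod_add_cong idx_mod[symmetric] refl)
    then have "idx (i + 1) = cyc_succ n (idx i)"
      using index_eq_iff[OF idx_in cyc_succ_in[OF n1 idx_in]] by blast
    then show ?thesis
      using q_braid[OF idx_in] by (simp only: sW_def)
  qed
  show "carrier W = generate W (range sW)"
  proof
    show "generate W (range sW) \<subseteq> carrier W"
      by (rule W.generate_incl) (auto simp only: sW_def intro!: q.hom_closed gen_closed idx_in)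
    have gen: "q (gen i) \<in> generate W (range sW)" if "i \<in> {1..n}" for i
    proof -
      have "idx (int i) = i"
        using index_eq_iff[OF idx_in that] idx_mod by blast
      then show ?thesis
        by (metis generate.incl rangeI sW_def)
    qed
    have "q w \<in> generate W (range sW)" if "w \<in> carrier (FG n)" for w
      using that
    proof (induction w)
      case Nil
      have "q [] = \<one>\<^bsub>W\<^esub>"
        using q.hom_one by (simp only: free_group_simps)
      then show ?case
        using generate.one by metis
    next
      case (Cons x w)
      obtain i b where x: "x = (i, b)"
        by fastforce
      note V = free_group_Cons[OF Cons.prems[unfolded x]]
      note g = gen_closed[OF V(1)]
      have "inv\<^bsub>W\<^esub> q (gen i) = q (gen i)"
        using q_square[OF V(1)] q.hom_closed[OF g] by (intro W.inv_equality)
      then have "q (x # w) = q (gen i) \<otimes>\<^bsub>W\<^esub> q w"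
        unfolding x V(3) using g V(2) by (simp only: q.hom_mult q.hom_inv F.inv_closed split: if_split) simp
      then show ?case
        using generate.eng[OF gen[OF V(1)] Cons.IH[OF V(2)]] by simp
    qed
    then show "carrier W \<subseteq> generate W (range sW)"
      using W_carrier by blast
  qed
  show "actW (x \<otimes>\<^bsub>W\<^esub> y) k = actW x (actW y k)" if "x \<in> carrier W" "y \<in> carrier W" for x y k
  proof -
    obtain v w where "v \<in> carrier (FG n)" "x = q v" "w \<in> carrier (FG n)" "y = q w"
      using W_carrier \<open>x \<in> carrier W\<close> \<open>y \<in> carrier W\<close> by metis
    then show ?thesis
      using actW_q[of "v \<otimes>\<^bsub>FG n\<^esub> w"] by (simp only: q.hom_mult[symmetric] F.m_closed actW_q strand_end_mult comp_apply)
  qed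
  show "actW (sW i) = cross (int n) i" for i
    unfolding sW_def actW_q[OF gen_closed[OF idx_in]] strand_end_gen crossing_lift_eq_cross
    by (rule cross_index_cong) (rule idx_mod)
qed

end

section \<open>Comparison with balanced annular braids\<close>

context swap_group
begin

lemma FG0_subgroup: "subgroup (carrier (FG0 n)) (FG n)"
  by (rule normal_imp_subgroup[OF FG0_normal])

lemma FG0_eq: "FG0 n = (FG n)\<lparr>carrier := carrier (FG0 n)\<rparr>"
  by (simp add: FG0_def)

lemma FG0_coset: "C #>\<^bsub>FG0 n\<^esub> w = C #>\<^bsub>FG n\<^esub> w"
  by (subst FG0_eq) (rule r_coset_consistent)

lemma R_normal_FG0: "R \<lhd> FG0 n"
  using F.normal_restrict_supergroup[OF FG0_subgroup R_normal swap_relations_subset_FG0[OF n]]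
  by (simp only: FG0_eq[symmetric])

lemma FG0_closed: "w \<in> carrier (FG0 n) \<Longrightarrow> w \<in> carrier (FG n)"
  by (simp add: FG0_carrier)

lemma q_Pure: "w \<in> carrier (FG n) \<Longrightarrow> q w \<in> A.Pure \<longleftrightarrow> w \<in> carrier (FG0 n)"
  by (simp add: A.Pure_def actW_q FG0_strand_end q.hom_closed)

lemma Pure_eq_image: "A.Pure = q ` carrier (FG0 n)"
proof
  show "A.Pure \<subseteq> q ` carrier (FG0 n)"
  proof
    fix C assume C: "C \<in> A.Pure"
    then obtain w where "w \<in> carrier (FG n)" "C = q w"
      using W_carrier by (auto simp only: A.Pure_def)
    then show "C \<in> q ` carrier (FG0 n)"
      using C q_Pure by blast
  qed
  show "q ` carrier (FG0 n) \<subseteq> A.Pure"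
    using q_Pure FG0_closed by blast
qed

text \<open>The cosets of R inside the kernel are literally cosets in the free group. This makes the
  two groups equal as records, so that the results on \<open>A.PG\<close> transfer by
  rewriting.\<close>

lemma FG0_Mod_eq: "FG0 n Mod R = W\<lparr>carrier := A.Pure\<rparr>"
proof -
  have "rcosets\<^bsub>FG0 n\<^esub> R = A.Pure"
    unfolding Pure_eq_image RCOSETS_def FG0_coset q_def by blast
  moreover have "set_mult (FG0 n) = set_mult (FG n)"
    by (subst FG0_eq) (simp add: fun_eq_iff)
  ultimately show ?thesis
    by (simp add: FactGroup_def)
qed

definition braid_relations :: "(nat word \<times> nat word) set" where
  "braid_relations = {(gen i \<otimes>\<^bsub>FG n\<^esub> gen j, gen j \<otimes>\<^bsub>FG n\<^esub> gen i) | i j.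
         i \<in> {1..n} \<and> j \<in> {1..n} \<and> \<not> cyc_adjacent n i j}
      \<union> {(gen i \<otimes>\<^bsub>FG n\<^esub> gen j \<otimes>\<^bsub>FG n\<^esub> gen i, gen j \<otimes>\<^bsub>FG n\<^esub> gen i \<otimes>\<^bsub>FG n\<^esub> gen j) | i j.
         i \<in> {1..n} \<and> j \<in> {1..n} \<and> cyc_adjacent n i j}"

lemma N_eq: "N = normal_closure (FG n) {u \<otimes>\<^bsub>FG n\<^esub> inv\<^bsub>FG n\<^esub> v | u v. (u, v) \<in> braid_relations}"
  by (simp only: braid_relators_def relators_def braid_relations_def)

lemma braid_relations_closed:
  assumes "(u, v) \<in> braid_relations"
  shows "u \<in> carrier (FG n)" "v \<in> carrier (FG n)"
  using assms unfolding braid_relations_def by (auto intro!: F.m_closed gen_closed simp del: atLeastAtMost_iff)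

lemma braid_relations_q:
  assumes "(u, v) \<in> braid_relations"
  shows "q u = q v"
proof -
  from assms consider
    i j where "i \<in> {1..n}" "j \<in> {1..n}" "\<not> cyc_adjacent n i j"
      "u = gen i \<otimes>\<^bsub>FG n\<^esub> gen j" "v = gen j \<otimes>\<^bsub>FG n\<^esub> gen i"
    | i j where "i \<in> {1..n}" "j \<in> {1..n}" "cyc_adjacent n i j"
      "u = gen i \<otimes>\<^bsub>FG n\<^esub> gen j \<otimes>\<^bsub>FG n\<^esub> gen i" "v = gen j \<otimes>\<^bsub>FG n\<^esub> gen i \<otimes>\<^bsub>FG n\<^esub> gen j"
    unfolding braid_relations_def by blast
  then show ?thesis
  proof cases
    case 1
    then show ?thesis
      using q_commute[OF 1(1-3)] by (simp only: q.hom_mult gen_closed)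
  next
    case 2
    then have "q (gen i) \<otimes>\<^bsub>W\<^esub> q (gen j) \<otimes>\<^bsub>W\<^esub> q (gen i) = q (gen j) \<otimes>\<^bsub>W\<^esub> q (gen i) \<otimes>\<^bsub>W\<^esub> q (gen j)"
      using q_braid[of i] q_braid[of j] unfolding cyc_adjacent_def by metis
    with 2 show ?thesis
      by (simp only: q.hom_mult gen_closed F.m_closed)
  qed
qed

lemma N_relators_carrier:
  "{u \<otimes>\<^bsub>FG n\<^esub> inv\<^bsub>FG n\<^esub> v | u v. (u, v) \<in> braid_relations} \<subseteq> carrier (FG n)"
  using braid_relations_closed by auto

lemma N_normal: "N \<lhd> FG n"
  unfolding N_eq by (rule F.normal_closure_normal[OF N_relators_carrier])

lemma N_subset_R: "N \<subseteq> R"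
  unfolding N_eq
proof (rule F.normal_closure_minimal[OF R_normal], clarify)
  fix u v assume uv: "(u, v) \<in> braid_relations"
  note c = braid_relations_closed[OF uv]
  have "q (u \<otimes>\<^bsub>FG n\<^esub> inv\<^bsub>FG n\<^esub> v) = \<one>\<^bsub>W\<^esub>"
    using c braid_relations_q[OF uv] by (simp only: q.hom_mult q.hom_inv F.inv_closed W.r_inv q.hom_closed)
  then show "u \<otimes>\<^bsub>FG n\<^esub> inv\<^bsub>FG n\<^esub> v \<in> R"
    using q_eq_one_iff[OF F.m_closed[OF c(1) F.inv_closed[OF c(2)]]] by blast
qed

abbreviation bc :: "nat word \<Rightarrow> nat word set" where
  "bc \<equiv> braid_class n"

sublocale B: group B
  unfolding braid_group_def by (rule normal.factorgroup_is_group[OF N_normal])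

sublocale bc: group_hom "FG n" B bc
proof -
  have "bc \<in> hom (FG n) B"
    using normal.r_coset_hom_Mod[OF N_normal] by (simp add: braid_class_def[abs_def] braid_group_def)
  then show "group_hom (FG n) B bc"
    by (simp add: group_hom_def group_hom_axioms_def F.group_axioms B.group_axioms)
qed

lemma B_carrier: "C \<in> carrier B \<Longrightarrow> \<exists>w\<in>carrier (FG n). C = bc w"
  by (auto simp only: braid_group_def carrier_FactGroup braid_class_def)

lemma bc_relation:
  assumes "(u, v) \<in> braid_relations"
  shows "bc u = bc v"
proof -
  note c = braid_relations_closed[OF assms]
  have "u \<otimes>\<^bsub>FG n\<^esub> inv\<^bsub>FG n\<^esub> v \<in> N"
    unfolding N_eq using F.normal_closure_incl[OF N_relators_carrier] assms by blast
  then show ?thesis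
    unfolding braid_class_def using c normal.rcos_eq_iff[OF N_normal] by simp
qed

lemma N_perm: "N \<subseteq> kernel (FG n) (sym_group n) (perm_of n)"
  using N_subset_R swap_relations_subset_FG0[OF n] by (auto simp: FG0_def)

lemma braid_perm_bc: "w \<in> carrier (FG n) \<Longrightarrow> braid_perm n (bc w) = perm_of n w"
  unfolding braid_perm_def braid_class_def
  by (rule group_hom.the_elem_coset[OF group_hom_perm_of N_normal N_perm])

lemma braid_perm_group_hom: "group_hom B (sym_group n) (braid_perm n)"
  using group_hom.hom_the_elem_Mod[OF group_hom_perm_of N_normal N_perm] B.group_axioms
  by (simp add: group_hom_def group_hom_axioms_def sym_group_is_group braid_perm_def[abs_def] braid_group_def)

abbreviation PB :: "nat word set monoid" where
  "PB \<equiv> pure_braid_group n"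

abbreviation SQ :: "nat word set set" where
  "SQ \<equiv> square_relations n"

lemma PB_carrier: "carrier PB = bc ` carrier (FG0 n)"
proof -
  have "bc w \<in> carrier PB \<longleftrightarrow> w \<in> carrier (FG0 n)" if "w \<in> carrier (FG n)" for w
    using that bc.hom_closed[OF that]
    by (simp add: pure_braid_group_def kernel_def braid_perm_bc FG0_carrier sym_group_one)
  moreover have "carrier PB \<subseteq> carrier B"
    by (auto simp: pure_braid_group_def kernel_def)
  ultimately show ?thesis
    using B_carrier FG0_closed by blast
qed

lemma PB_eq: "PB = B\<lparr>carrier := carrier PB\<rparr>"
  by (simp add: pure_braid_group_def)

lemma PB_subgroup: "subgroup (carrier PB) B"
  using group_hom.subgroup_kernel[OF braid_perm_group_hom] by (simp add: pure_braid_group_def)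

lemma square_carrier: "{bc (gen i) \<otimes>\<^bsub>B\<^esub> bc (gen i) | i. i \<in> {1..n}} \<subseteq> carrier B"
  using bc.hom_closed[OF gen_closed] by auto

lemma SQ_normal: "SQ \<lhd> B"
  unfolding square_relations_def by (rule B.normal_closure_normal[OF square_carrier])

lemma SQ_carrier: "C \<in> SQ \<Longrightarrow> C \<in> carrier B"
  by (rule subgroup.mem_carrier[OF normal_imp_subgroup[OF SQ_normal]])

text \<open>The quotients of the free group by R and of the braid group by the squares satisfy each
  other's relations: the map \<open>k\<close> from braids to the first kills the squares, and the
  map \<open>h\<close> from words to the second kills the swap relations.\<close>

lemma bc_SQ_iff:
  assumes "w \<in> carrier (FG n)"
  shows "bc w \<in> SQ \<longleftrightarrow> w \<in> R"
proof
  define k where "k C = the_elem (q ` C)" for C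
  have Nk: "N \<subseteq> kernel (FG n) W q"
    using N_subset_R R_carrier q_eq_one_iff by (auto simp only: kernel_def)
  have k: "k (bc v) = q v" if "v \<in> carrier (FG n)" for v
    unfolding k_def braid_class_def using that by (rule q.the_elem_coset[OF N_normal Nk])
  interpret k: group_hom B W k
    using q.hom_the_elem_Mod[OF N_normal Nk] B.group_axioms W.group_axioms
    by (simp add: group_hom_def group_hom_axioms_def k_def[abs_def] braid_group_def)
  have "SQ \<subseteq> kernel B W k"
    unfolding square_relations_def
  proof (rule B.normal_closure_minimal[OF k.normal_kernel], clarify)
    fix i assume i: "i \<in> {1..n}"
    note g = gen_closed[OF i]
    show "bc (gen i) \<otimes>\<^bsub>B\<^esub> bc (gen i) \<in> kernel B W k"
      using bc.hom_closed[OF g] q_square[OF i] k[OF g] by (simp add: kernel_def)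
  qed
  then show "w \<in> R" if "bc w \<in> SQ"
    using that k[OF assms] q_eq_one_iff[OF assms] by (auto simp only: kernel_def)
next
  define h where "h v = SQ #>\<^bsub>B\<^esub> bc v" for v
  interpret Q: group "B Mod SQ"
    by (rule normal.factorgroup_is_group[OF SQ_normal])
  have "(\<lambda>C. SQ #>\<^bsub>B\<^esub> C) \<circ> bc \<in> hom (FG n) (B Mod SQ)"
    by (rule hom_compose[OF bc.homh normal.r_coset_hom_Mod[OF SQ_normal]])
  then interpret h: group_hom "FG n" "B Mod SQ" h
    by (simp add: group_hom_def group_hom_axioms_def F.group_axioms Q.group_axioms h_def[abs_def] comp_def)
  have "R \<subseteq> kernel (FG n) (B Mod SQ) h"
  proof (rule swap_relations_subset_kernel[OF h.group_hom_axioms n1])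
    fix i assume i: "i \<in> {1..n}"
    note g = gen_closed[OF i]
    have "bc (gen i \<otimes>\<^bsub>FG n\<^esub> gen i) \<in> SQ"
      unfolding square_relations_def bc.hom_mult[OF g g]
      by (rule subsetD[OF B.normal_closure_incl[OF square_carrier]]) (use i in blast)
    then have "h (gen i \<otimes>\<^bsub>FG n\<^esub> gen i) = \<one>\<^bsub>B Mod SQ\<^esub>"
      unfolding h_def one_FactGroup using normal.rcos_eq_self_iff[OF SQ_normal] SQ_carrier by blast
    then show "h (gen i) \<otimes>\<^bsub>B Mod SQ\<^esub> h (gen i) = \<one>\<^bsub>B Mod SQ\<^esub>"
      by (simp only: h.hom_mult g)
  next
    fix i j assume ij: "i \<in> {1..n}" "j \<in> {1..n}" "\<not> cyc_adjacent n i j"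
    note g = gen_closed[OF ij(1)] gen_closed[OF ij(2)]
    have "(gen i \<otimes>\<^bsub>FG n\<^esub> gen j, gen j \<otimes>\<^bsub>FG n\<^esub> gen i) \<in> braid_relations"
      unfolding braid_relations_def using ij by blast
    then have "h (gen i \<otimes>\<^bsub>FG n\<^esub> gen j) = h (gen j \<otimes>\<^bsub>FG n\<^esub> gen i)"
      unfolding h_def by (simp only: bc_relation)
    then show "h (gen i) \<otimes>\<^bsub>B Mod SQ\<^esub> h (gen j) = h (gen j) \<otimes>\<^bsub>B Mod SQ\<^esub> h (gen i)"
      by (simp only: h.hom_mult g)
  next
    fix i assume i: "i \<in> {1..n}"
    let ?j = "cyc_succ n i"
    have j: "?j \<in> {1..n}" "cyc_adjacent n i ?j"
      using cyc_succ_in[OF n1 i] by (simp_all add: cyc_adjacent_def)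
    note g = gen_closed[OF i] gen_closed[OF j(1)]
    have "(gen i \<otimes>\<^bsub>FG n\<^esub> gen ?j \<otimes>\<^bsub>FG n\<^esub> gen i, gen ?j \<otimes>\<^bsub>FG n\<^esub> gen i \<otimes>\<^bsub>FG n\<^esub> gen ?j) \<in> braid_relations"
      unfolding braid_relations_def using i j by blast
    then have "h (gen i \<otimes>\<^bsub>FG n\<^esub> gen ?j \<otimes>\<^bsub>FG n\<^esub> gen i) = h (gen ?j \<otimes>\<^bsub>FG n\<^esub> gen i \<otimes>\<^bsub>FG n\<^esub> gen ?j)"
      unfolding h_def by (simp only: bc_relation)
    then show "h (gen i) \<otimes>\<^bsub>B Mod SQ\<^esub> h (gen ?j) \<otimes>\<^bsub>B Mod SQ\<^esub> h (gen i)
        = h (gen ?j) \<otimes>\<^bsub>B Mod SQ\<^esub> h (gen i) \<otimes>\<^bsub>B Mod SQ\<^esub> h (gen ?j)"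
      by (simp only: h.hom_mult g F.m_closed)
  qed
  then show "bc w \<in> SQ" if "w \<in> R"
    using that normal.rcos_eq_self_iff[OF SQ_normal bc.hom_closed[OF assms]]
    by (auto simp only: kernel_def h_def one_FactGroup)
qed

lemma SQ_normal_PB: "SQ \<lhd> PB"
proof -
  have "SQ \<subseteq> carrier PB"
  proof
    fix C assume "C \<in> SQ"
    then obtain w where w: "w \<in> carrier (FG n)" "C = bc w" "bc w \<in> SQ"
      using SQ_carrier B_carrier by blast
    then have "w \<in> carrier (FG0 n)"
      using bc_SQ_iff swap_relations_subset_FG0[OF n] by blast
    then show "C \<in> carrier PB"
      using w by (simp add: PB_carrier)
  qed
  then show ?thesis
    using B.normal_restrict_supergroup[OF PB_subgroup SQ_normal] by (simp only: PB_eq[symmetric])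
qed

text \<open>Crossings satisfy the braid relations, so all words of one braid have the same strand
  ends and the image in \<open>winding_vector\<close> is a singleton.\<close>

lemma winding_vector_bc:
  assumes "w \<in> carrier (FG n)"
  shows "winding_vector n (bc w) = (\<lambda>k\<in>{1..n}. (strand_end n w (int k) - int k) div int n)"
proof -
  have "N \<subseteq> kernel (FG n) (BijGroup UNIV) (strand_end n)"
    using N_subset_R swap_relations_strand by blast
  then have eq: "strand_end n v = strand_end n w" if "v \<in> bc w" for v
    using that unfolding braid_class_def by (intro strand.hom_eq_on_coset[OF N_normal _ assms])
  have mem: "w \<in> bc w"
    unfolding braid_class_def by (rule F.rcos_self[OF assms normal_imp_subgroup[OF N_normal]])
  define f where "f v = (\<lambda>k\<in>{1..n}. (strand_end n v (int k) - int k) div int n)" for v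
  have "f v = f w" if "v \<in> bc w" for v
    unfolding f_def eq[OF that] ..
  then have "f ` bc w = {f w}"
    using mem by blast
  then show ?thesis
    by (simp only: winding_vector_def f_def[abs_def] the_elem_eq)
qed

text \<open>The first isomorphism theorem for words of the kernel, read as pure braids modulo
  squares: the map is onto by \<open>PB_carrier\<close>, and its kernel is R by
  \<open>bc_SQ_iff\<close>.\<close>

theorem ex_braid_iso:
  "\<exists>\<psi>\<in>iso (FG0 n Mod R) (pure_braid_quotient n).
     \<forall>w\<in>carrier (FG0 n). \<psi> (R #>\<^bsub>FG0 n\<^esub> w) = SQ #>\<^bsub>PB\<^esub> bc w"
proof -
  interpret F0: group "FG0 n"
    using subgroup.subgroup_is_group[OF FG0_subgroup F.group_axioms] by (simp only: FG0_eq[symmetric])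
  interpret PB: group PB
    using subgroup.subgroup_is_group[OF PB_subgroup B.group_axioms] by (simp only: PB_eq[symmetric])
  define h where "h w = SQ #>\<^bsub>PB\<^esub> bc w" for w
  have "bc \<in> hom (FG0 n) PB"
  proof (rule homI)
    fix v w assume "v \<in> carrier (FG0 n)" "w \<in> carrier (FG0 n)"
    then show "bc (v \<otimes>\<^bsub>FG0 n\<^esub> w) = bc v \<otimes>\<^bsub>PB\<^esub> bc w"
      using bc.hom_mult FG0_closed by (simp add: FG0_def pure_braid_group_def)
  qed (simp add: PB_carrier)
  from hom_compose[OF this normal.r_coset_hom_Mod[OF SQ_normal_PB]]
  interpret h: group_hom "FG0 n" "PB Mod SQ" h
    using normal.factorgroup_is_group[OF SQ_normal_PB] F0.group_axioms
    by (simp add: group_hom_def group_hom_axioms_def h_def[abs_def] comp_def)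
  have "h w = \<one>\<^bsub>PB Mod SQ\<^esub> \<longleftrightarrow> w \<in> R" if "w \<in> carrier (FG0 n)" for w
    unfolding h_def one_FactGroup bc_SQ_iff[OF FG0_closed[OF that], symmetric]
    using that by (intro normal.rcos_eq_self_iff[OF SQ_normal_PB]) (simp add: PB_carrier)
  then have ker: "kernel (FG0 n) (PB Mod SQ) h = R"
    using swap_relations_subset_FG0[OF n] by (auto simp only: kernel_def)
  have onto: "h ` carrier (FG0 n) = carrier (PB Mod SQ)"
    by (simp only: carrier_FactGroup PB_carrier image_image h_def[abs_def])
  define \<psi> where "\<psi> C = the_elem (h ` C)" for C
  have "\<psi> (R #>\<^bsub>FG0 n\<^esub> w) = SQ #>\<^bsub>PB\<^esub> bc w" if "w \<in> carrier (FG0 n)" for w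
    using h.the_elem_coset[OF R_normal_FG0 _ that] ker unfolding \<psi>_def h_def by blast
  moreover have "\<psi> \<in> iso (FG0 n Mod R) (PB Mod SQ)"
    using h.FactGroup_iso_set[OF onto] unfolding ker \<psi>_def[abs_def] .
  ultimately show ?thesis
    unfolding pure_braid_quotient_def by blast
qed

text \<open>The translations \<open>A.t 1 i\<close> turn strand 1 once forwards and strand i once
  backwards, so \<open>A.act_t\<close> reads off the required winding vectors.\<close>

theorem ex_generators:
  "\<exists>x w. (\<forall>i\<in>{2..n}. x i \<in> carrier (FG0 n Mod R) \<and> w i \<in> carrier (FG0 n) \<and> x i = R #>\<^bsub>FG0 n\<^esub> w i
      \<and> winding_vector n (bc (w i)) = (\<lambda>k\<in>{1..n}. if k = 1 then 1 else if k = i then -1 else 0))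
    \<and> generate (FG0 n Mod R) (x ` {2..n}) = carrier (FG0 n Mod R)"
proof -
  define x where "x i = A.t 1 (int i)" for i
  have "\<exists>w\<in>carrier (FG0 n). x i = q w" for i
    using A.t_Pure[of 1 "int i"] unfolding Pure_eq_image x_def by blast
  then obtain w where w: "\<And>i. w i \<in> carrier (FG0 n)" "\<And>i. x i = q (w i)"
    by metis
  have "winding_vector n (bc (w i)) = (\<lambda>k\<in>{1..n}. if k = 1 then 1 else if k = i then -1 else 0)"
    if i: "i \<in> {2..n}" for i
    unfolding winding_vector_bc[OF FG0_closed[OF w(1)]]
  proof (rule restrict_ext)
    fix k assume k: "k \<in> {1..n}"
    have "strand_end n (w i) (int k) = actW (x i) (int k)"
      by (simp only: w(2) actW_q[OF FG0_closed[OF w(1)]])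
    also have "\<dots> = int k + int n * (of_bool (k = 1) - of_bool (k = i))"
      using index_eq_iff[OF k, of 1] index_eq_iff[OF k, of i] i by (simp add: x_def A.act_t)
    finally show "(strand_end n (w i) (int k) - int k) div int n = (if k = 1 then 1 else if k = i then -1 else 0)"
      using n i by auto
  qed
  moreover have "x i \<in> carrier (FG0 n Mod R)" for i
    using A.t_Pure by (simp add: FG0_Mod_eq x_def)
  moreover have "x ` {2..n} = A.t 1 ` {2..int n}"
    using image_int_atLeastAtMost[of 2 n] by (simp only: x_def[abs_def] image_image[symmetric] of_nat_numeral)
  ultimately show ?thesis
    using w A.PG_generate by (intro exI[of _ x] exI[of _ w]) (simp add: FG0_Mod_eq FG0_coset q_def)
qed

end

theorem theorem3p8:
  fixes n :: nat and L :: "nat \<Rightarrow> real"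
  assumes n: "n \<ge> 3"
    and pos: "\<forall>i\<in>{1..n}. L i > 0"
    and distinct: "inj_on L {1..n}"
  shows
    "(\<exists>\<phi>. group_action (FG0 n Mod swap_relations n) (moduli_space n L :: (nat \<Rightarrow> real ^ 2) set set) \<phi>
        \<and> (\<forall>w\<in>carrier (FG0 n). \<forall>c\<in>moduli_space n L.
              \<phi> (swap_relations n #>\<^bsub>FG0 n\<^esub> w) c = swap_action n L w c)
        \<and> (\<forall>x\<in>carrier (FG0 n Mod swap_relations n).
              homeomorphic_map (moduli_topology n L) (moduli_topology n L) (\<phi> x)))
     \<and> (\<exists>\<phi>. group_action (FG0 n Mod swap_relations n) (moduli_space n L :: (nat \<Rightarrow> real ^ 3) set set) \<phi>
        \<and> (\<forall>w\<in>carrier (FG0 n). \<forall>c\<in>moduli_space n L.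
              \<phi> (swap_relations n #>\<^bsub>FG0 n\<^esub> w) c = swap_action n L w c)
        \<and> (\<forall>x\<in>carrier (FG0 n Mod swap_relations n).
              homeomorphic_map (moduli_topology n L) (moduli_topology n L) (\<phi> x)))
     \<and> (\<exists>\<psi>\<in>iso (FG0 n Mod swap_relations n) (pure_braid_quotient n).
          (\<forall>w\<in>carrier (FG0 n).
              \<psi> (swap_relations n #>\<^bsub>FG0 n\<^esub> w)
                = square_relations n #>\<^bsub>pure_braid_group n\<^esub> braid_class n w)
        \<and> (\<exists>x \<beta>.
              (\<forall>i\<in>{2..n}.
                  x i \<in> carrier (FG0 n Mod swap_relations n)
                \<and> \<beta> i \<in> carrier (pure_braid_group n)
                \<and> \<psi> (x i) = square_relations n #>\<^bsub>pure_braid_group n\<^esub> \<beta> i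
                \<and> winding_vector n (\<beta> i) = (\<lambda>k\<in>{1..n}. if k = 1 then 1 else if k = i then -1 else 0))
            \<and> generate (FG0 n Mod swap_relations n) (x ` {2..n})
                = carrier (FG0 n Mod swap_relations n)))
     \<and> FG0 n Mod swap_relations n \<cong> product_group {1..n - 1} (\<lambda>_. integer_group)
     \<and> comm_group (FG0 n Mod swap_relations n)"
proof (intro conjI)
  interpret swap_group n
    by unfold_locales (rule n)
  interpret plane: linkage n L "TYPE(2)"
    by unfold_locales (rule n distinct mirror_braid_2)+
  interpret space: linkage n L "TYPE(3)"
    by unfold_locales (rule n distinct mirror_braid_3)+
  show "\<exists>\<phi>. group_action (FG0 n Mod swap_relations n) (moduli_space n L :: (nat \<Rightarrow> real ^ 2) set set) \<phi>
        \<and> (\<forall>w\<in>carrier (FG0 n). \<forall>c\<in>moduli_space n L.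
              \<phi> (swap_relations n #>\<^bsub>FG0 n\<^esub> w) c = swap_action n L w c)
        \<and> (\<forall>x\<in>carrier (FG0 n Mod swap_relations n).
              homeomorphic_map (moduli_topology n L) (moduli_topology n L) (\<phi> x))"
    by (rule plane.moduli_action)
  show "\<exists>\<phi>. group_action (FG0 n Mod swap_relations n) (moduli_space n L :: (nat \<Rightarrow> real ^ 3) set set) \<phi>
        \<and> (\<forall>w\<in>carrier (FG0 n). \<forall>c\<in>moduli_space n L.
              \<phi> (swap_relations n #>\<^bsub>FG0 n\<^esub> w) c = swap_action n L w c)
        \<and> (\<forall>x\<in>carrier (FG0 n Mod swap_relations n).
              homeomorphic_map (moduli_topology n L) (moduli_topology n L) (\<phi> x))"
    by (rule space.moduli_action)
  obtain \<psi> where psi: "\<psi> \<in> iso (FG0 n Mod R) (pure_braid_quotient n)"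
    "\<forall>w\<in>carrier (FG0 n). \<psi> (R #>\<^bsub>FG0 n\<^esub> w) = SQ #>\<^bsub>PB\<^esub> bc w"
    using ex_braid_iso by blast
  obtain x w where x: "generate (FG0 n Mod R) (x ` {2..n}) = carrier (FG0 n Mod R)"
    "\<forall>i\<in>{2..n}. x i \<in> carrier (FG0 n Mod R) \<and> w i \<in> carrier (FG0 n) \<and> x i = R #>\<^bsub>FG0 n\<^esub> w i
      \<and> winding_vector n (bc (w i)) = (\<lambda>k\<in>{1..n}. if k = 1 then 1 else if k = i then -1 else 0)"
    using ex_generators by blast
  have "\<forall>i\<in>{2..n}. x i \<in> carrier (FG0 n Mod R) \<and> bc (w i) \<in> carrier PB \<and> \<psi> (x i) = SQ #>\<^bsub>PB\<^esub> bc (w i)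
      \<and> winding_vector n (bc (w i)) = (\<lambda>k\<in>{1..n}. if k = 1 then 1 else if k = i then -1 else 0)"
    using x(2) psi(2) by (auto simp only: PB_carrier)
  with psi x(1) show "\<exists>\<psi>\<in>iso (FG0 n Mod swap_relations n) (pure_braid_quotient n).
          (\<forall>w\<in>carrier (FG0 n).
              \<psi> (swap_relations n #>\<^bsub>FG0 n\<^esub> w)
                = square_relations n #>\<^bsub>pure_braid_group n\<^esub> braid_class n w)
        \<and> (\<exists>x \<beta>.
              (\<forall>i\<in>{2..n}.
                  x i \<in> carrier (FG0 n Mod swap_relations n)
                \<and> \<beta> i \<in> carrier (pure_braid_group n)
                \<and> \<psi> (x i) = square_relations n #>\<^bsub>pure_braid_group n\<^esub> \<beta> i
                \<and> winding_vector n (\<beta> i) = (\<lambda>k\<in>{1..n}. if k = 1 then 1 else if k = i then -1 else 0))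
            \<and> generate (FG0 n Mod swap_relations n) (x ` {2..n})
                = carrier (FG0 n Mod swap_relations n))"
    by (intro bexI[of _ \<psi>] conjI exI[of _ x] exI[of _ "\<lambda>i. bc (w i)"])
  show "FG0 n Mod swap_relations n \<cong> product_group {1..n - 1} (\<lambda>_. integer_group)"
    unfolding FG0_Mod_eq by (rule is_isoI[OF A.PG_iso])
  show "comm_group (FG0 n Mod swap_relations n)"
    unfolding FG0_Mod_eq by (rule A.PG_comm_group)
qed

end
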